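(* Let $n\ge 2$ be an integer, let $v_n>0$, and let $\hat V(x)=v_n x^{2n}$. For a temperature $T>0$ put $\beta=1/T$ and consider the constrained saddle point problem for an even probability density $\rho\ge 0$ with compact support in $\mathbb{R}$ and a real number $\hat\mu$: $$\int \rho(x)\,dx=1,\qquad \int \rho(x)\,x^2\,dx=1,\qquad \hat\mu\, x+\frac{\beta}{2}\hat V'(x)=P\!\!\int \frac{\rho(y)}{x-y}\,dy\quad\text{for all } x \text{ in the interior of the support of }\rho .$$ Define $$T_{\mathrm c}=\frac{v_n}{2\sqrt{\pi}}\left[\frac43\left(1+\frac1n\right)\right]^n\frac{\Gamma\left(n-\frac12\right)}{\Gamma(n-1)} .$$ Then a single-cut solution exists if and only if $T\ge T_{\mathrm c}$. At $T=T_{\mathrm c}$ the single-cut solution satisfies $\rho(0)=0$ and has support $[-a,a]$ with $a^2=\frac43\,\frac{n+1}{n}$. For $T<T_{\mathrm c}$ the solution is a disconnected two-cut solution.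
   Context: $P\!\int$ denotes the Cauchy principal value integral and $\Gamma$ the Gamma function. A single-cut solution is a solution $(\rho,\hat\mu)$ in which $\rho$ is continuous on $\mathbb{R}$, nonnegative everywhere, and has connected support $[-a,a]$ for some $a>0$ (equivalently, $\rho$ equals an even polynomial times $\sqrt{a^2-x^2}$ on $[-a,a]$, vanishes outside, and is nonnegative). A two-cut solution is a solution in which $\rho$ is continuous on $\mathbb{R}$ and nonnegative with support $[-b,-a]\cup[a,b]$ for some $0<a<b$ (so $\rho$ vanishes like a square root at the four endpoints). These equations are the large $N$ saddle point equations for the symmetrized density of rescaled singular values of an $N\times N$ real matrix $M$ in the matrix integral with weight $\delta(\mathrm{tr}(MM^T)-N^2)\,e^{-\beta \frac{v_n}{N^{n-1}}\mathrm{tr}[(MM^T)^n]}$, where $\hat\mu$ is the Lagrange multiplier of the constraint. *)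

theory Defs
  imports "HOL-Analysis.Analysis"
begin

definition potential :: "nat \<Rightarrow> real \<Rightarrow> real \<Rightarrow> real" where
  "potential n v x = v * x ^ (2 * n)"

text \<open>The support is that of a function, not of a measure. For continuous functions, as in
  \<open>single_cut\<close> and \<open>two_cut\<close> below, it is also the support of the measure with this density.\<close>

definition fun_support :: "(real \<Rightarrow> real) \<Rightarrow> real set" where
  "fun_support \<rho> = closure {x. \<rho> x \<noteq> 0}"

text \<open>Cauchy principal value at \<open>x\<close> of an integral over the real line. The integrability
  requirement excludes the default value 0 of the Bochner integral of a non-integrable function.\<close>

definition has_principal_value :: "(real \<Rightarrow> real) \<Rightarrow> real \<Rightarrow> real \<Rightarrow> bool" where
  "has_principal_value f x I \<longleftrightarrow>
     (\<forall>\<epsilon>>0. set_integrable lborel {y. \<epsilon> < \<bar>x - y\<bar>} f) \<and>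
     ((\<lambda>\<epsilon>. set_lebesgue_integral lborel {y. \<epsilon> < \<bar>x - y\<bar>} f) \<longlongrightarrow> I) (at_right 0)"

definition saddle_point_solution ::
  "nat \<Rightarrow> real \<Rightarrow> real \<Rightarrow> (real \<Rightarrow> real) \<Rightarrow> real \<Rightarrow> bool" where
  "saddle_point_solution n v T \<rho> \<mu> \<longleftrightarrow>
     (\<forall>x. 0 \<le> \<rho> x) \<and>
     (\<forall>x. \<rho> (- x) = \<rho> x) \<and>
     compact (fun_support \<rho>) \<and>
     has_bochner_integral lborel \<rho> 1 \<and>
     has_bochner_integral lborel (\<lambda>x. \<rho> x * x\<^sup>2) 1 \<and>
     (\<forall>x \<in> interior (fun_support \<rho>).
        has_principal_value (\<lambda>y. \<rho> y / (x - y)) x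
          (\<mu> * x + (1 / T) / 2 * deriv (potential n v) x))"

definition single_cut ::
  "nat \<Rightarrow> real \<Rightarrow> real \<Rightarrow> (real \<Rightarrow> real) \<Rightarrow> real \<Rightarrow> bool" where
  "single_cut n v T \<rho> \<mu> \<longleftrightarrow>
     saddle_point_solution n v T \<rho> \<mu> \<and> continuous_on UNIV \<rho> \<and>
     (\<exists>a>0. fun_support \<rho> = {-a..a})"

definition two_cut ::
  "nat \<Rightarrow> real \<Rightarrow> real \<Rightarrow> (real \<Rightarrow> real) \<Rightarrow> real \<Rightarrow> bool" where
  "two_cut n v T \<rho> \<mu> \<longleftrightarrow>
     saddle_point_solution n v T \<rho> \<mu> \<and> continuous_on UNIV \<rho> \<and>
     (\<exists>a b. 0 < a \<and> a < b \<and> fun_support \<rho> = {-b..-a} \<union> {a..b})"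

definition critical_temperature :: "nat \<Rightarrow> real \<Rightarrow> real" where
  "critical_temperature n v =
     v / (2 * sqrt pi) * (4 / 3 * (1 + 1 / real n)) ^ n *
     (Gamma (real n - 1 / 2) / Gamma (real n - 1))"

end

theory Submission
  imports Defs "HOL-Probability.Sinc_Integral"
begin

text \<open>The argument rests on Tricomi's identity: if \<open>f\<close> is continuous with compact support and \<open>h\<close> is the
  principal value of \<open>\<integral> f y / (x - y) dy\<close> wherever \<open>f x \<noteq> 0\<close>, then the Cauchy transform \<open>G\<close> of \<open>f\<close>
  satisfies \<open>(G z)\<^sup>2 = 2 * \<integral> f x * h x / (z - x) dx\<close>. For \<open>h = 0\<close> it forces \<open>f = 0\<close>, so a
  single-cut solution with support \<open>[-a, a]\<close> is the explicit polynomial times \<open>sqrt (a\<^sup>2 - x\<^sup>2)\<close>. The two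
  moment conditions and \<open>0 \<le> \<rho> 0\<close> then become an equation between \<open>T\<close> and \<open>a\<close>, in which \<open>T\<close> increases
  with \<open>a\<close>, and a lower bound for \<open>a\<close>. For \<open>h\<close> the force \<open>U\<close> of the potential the identity says that
  \<open>(G - U)\<^sup>2\<close> is a polynomial \<open>R\<close>, which is nonnegative on the zeros of \<open>\<rho>\<close> and nonpositive on the
  support, hence zero at the ends of a gap. As \<open>U x / x\<close> increases in \<open>x > 0\<close> and \<open>G x / x\<close> decreases
  across gaps, the only possible gap is one around the origin. Two-cut solutions for \<open>T\<close> below the
  critical value are found by the intermediate value theorem in the ratio of the two endpoints; when
  this ratio is 0 the solution is a single cut with \<open>\<rho> 0 = 0\<close>, which exists only at the critical
  temperature.\<close>


section \<open>Regularised kernels\<close>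

text \<open>A solution is only known to be continuous, and its principal value is only known
  pointwise in the interior of the support, with no rate of convergence. Plemelj's formulas, which
  want Hoelder continuity, are out of reach, and so is a naive exchange of limit and integral. This
  is why so much effort goes into an L2 bound for the regularised transform that uses nothing but
  boundedness of the density. The support is equally rough: a priori it may have infinitely many
  components, so no number of cuts can be assumed and gaps are excluded one at a time.

  The number 4/3 (n + 1) / n is the value of a^2 at which the polynomial factor of the one-cut
  density vanishes at the origin, where it has its minimum. The Gamma quotient is, up to the factors
  sqrt pi and n - 1, a moment of the arcsine law. For two cuts, homogeneity leaves the ratio of the
  endpoints as the only parameter: the moment conditions determine the scale and the temperature,
  and the latter is continuous in the ratio and small when the ratio is close to 1.\<close>

lemma inverse_quadratic_has_integral:
  "has_bochner_integral lborel (\<lambda>t::real. 1 / (1 + t\<^sup>2)) pi"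
proof -
  have e: "einterval (-\<infinity>) \<infinity> = (UNIV :: real set)"
    by (auto simp: einterval_def)
  have "integrable lborel (\<lambda>t::real. 1 / (1 + t\<^sup>2))"
    using integrable_inverse_1_plus_square unfolding e set_integrable_def
    by (simp add: inverse_eq_divide)
  moreover have "(LBINT t. 1 / (1 + t\<^sup>2)) = pi"
    using LBINT_inverse_1_plus_square
    unfolding interval_lebesgue_integral_def e set_lebesgue_integral_def
    by (simp add: inverse_eq_divide)
  ultimately show ?thesis by (simp add: has_bochner_integral_iff)
qed

lemma positive_null_sequence:
  obtains e :: "nat \<Rightarrow> real" where "\<And>k. 0 < e k" "e \<longlonglongrightarrow> 0"
  using that[of "\<lambda>k. inverse (real (Suc k))"] LIMSEQ_inverse_real_of_nat by auto

lemma scaled_kernel_integral: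
  fixes f \<kappa> :: "real \<Rightarrow> real"
  assumes "0 < e"
  shows "(LBINT y. f y * (\<kappa> ((x - y) / e) / e)) = (LBINT t. f (x - e * t) * \<kappa> t)"
  using assms by (subst lborel_integral_real_affine[where c="-e" and t=x])
    (auto simp: field_simps simp flip: integral_mult_right_zero)

text \<open>An approximate identity without normalisation or sign: the integral of
  \<open>\<kappa>\<close> is pi for the Poisson kernel and 0 for the odd kernel that compares
  truncation with \<open>conj_poisson\<close>. After the substitution y = x - e t, the bound on
  \<open>\<kappa>\<close> gives the dominating function.\<close>

lemma scaled_kernel_tendsto:
  fixes f \<kappa> :: "real \<Rightarrow> real"
  assumes f: "continuous_on UNIV f" "\<And>x. \<bar>f x\<bar> \<le> M"
    and \<kappa>[measurable]: "\<kappa> \<in> borel_measurable borel" and \<kappa>_le: "\<And>t. \<bar>\<kappa> t\<bar> \<le> 1 / (1 + t\<^sup>2)"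
    and e: "\<And>k. 0 < e k" "e \<longlonglongrightarrow> 0"
  shows "(\<lambda>k. LBINT y. f y * (\<kappa> ((x - y) / e k) / e k)) \<longlonglongrightarrow> f x * (LBINT t. \<kappa> t)"
proof -
  have [measurable]: "f \<in> borel_measurable borel"
    by (rule borel_measurable_continuous_onI[OF f(1)])
  have "(\<lambda>k. LBINT t. f (x - e k * t) * \<kappa> t) \<longlonglongrightarrow> (LBINT t. f x * \<kappa> t)"
  proof (rule integral_dominated_convergence[where w = "\<lambda>t. M * (1 / (1 + t\<^sup>2))"])
    show "integrable lborel (\<lambda>t. M * (1 / (1 + t\<^sup>2)))"
      using inverse_quadratic_has_integral
      by (intro integrable_mult_right) (auto simp: has_bochner_integral_iff)
    show "AE t in lborel. (\<lambda>k. f (x - e k * t) * \<kappa> t) \<longlonglongrightarrow> f x * \<kappa> t"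
    proof (rule AE_I2)
      fix t
      have "(\<lambda>k. x - e k * t) \<longlonglongrightarrow> x - 0 * t" by (intro tendsto_intros e)
      then have "(\<lambda>k. f (x - e k * t)) \<longlonglongrightarrow> f x"
        using f(1) by (intro isCont_tendsto_compose[of x f]) (auto simp: continuous_on_eq_continuous_at)
      then show "(\<lambda>k. f (x - e k * t) * \<kappa> t) \<longlonglongrightarrow> f x * \<kappa> t" by (intro tendsto_intros)
    qed
    have "0 \<le> M" using f(2)[of 0] by linarith
    then show "AE t in lborel. norm (f (x - e k * t) * \<kappa> t) \<le> M * (1 / (1 + t\<^sup>2))" for k
      by (intro AE_I2) (use f(2) \<kappa>_le in \<open>auto simp: abs_mult simp del: times_divide_eq_right intro!: mult_mono\<close>)
  qed auto
  then show ?thesis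
    unfolding scaled_kernel_integral[OF e(1)] by simp
qed

text \<open>Together with \<open>conj_poisson\<close>, the two parts of 1 / (u + i e): the imaginary
  part is minus \<open>poisson e u\<close>, the real part is \<open>conj_poisson e u\<close>.
  Neither is divided by pi, so limits carry a factor pi.\<close>

definition poisson :: "real \<Rightarrow> real \<Rightarrow> real" where
  "poisson e u = e / (u\<^sup>2 + e\<^sup>2)"

definition conj_poisson :: "real \<Rightarrow> real \<Rightarrow> real" where
  "conj_poisson e u = u / (u\<^sup>2 + e\<^sup>2)"

lemma poisson_measurable [measurable]: "poisson e \<in> borel_measurable borel"
  and conj_poisson_measurable [measurable]: "conj_poisson e \<in> borel_measurable borel"
  unfolding poisson_def[abs_def] conj_poisson_def[abs_def] by measurable

lemma poisson_nonneg: "0 \<le> e \<Longrightarrow> 0 \<le> poisson e u"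
  by (simp add: poisson_def)

lemma poisson_le:
  assumes "0 < e" shows "\<bar>poisson e u\<bar> \<le> 1 / e"
  using assms by (simp add: poisson_def power2_eq_square field_simps add_pos_nonneg)

lemma conj_poisson_le:
  assumes "0 < e" shows "\<bar>conj_poisson e u\<bar> \<le> 1 / e"
proof -
  have "0 \<le> (\<bar>u\<bar> - e)\<^sup>2" by simp
  then have "2 * (\<bar>u\<bar> * e) \<le> u\<^sup>2 + e\<^sup>2" by (simp add: power2_diff)
  then have "\<bar>u\<bar> * e \<le> u\<^sup>2 + e\<^sup>2" using assms by (smt (verit) mult_nonneg_nonneg abs_ge_zero)
  moreover have "0 < u\<^sup>2 + e\<^sup>2" using assms by (simp add: add_nonneg_pos)
  ultimately show ?thesis using assms by (simp add: conj_poisson_def field_simps)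
qed

lemma poisson_scaled:
  assumes "0 < e" shows "poisson e u = 1 / (1 + (u / e)\<^sup>2) / e"
proof -
  have "1 + (u / e)\<^sup>2 = (u\<^sup>2 + e\<^sup>2) / e\<^sup>2" using assms by (simp add: power_divide add_divide_distrib)
  then show ?thesis using assms by (simp add: poisson_def power2_eq_square)
qed

lemma conj_poisson_scaled:
  assumes "0 < e" shows "conj_poisson e u = u / e / (1 + (u / e)\<^sup>2) / e"
proof -
  have "1 + (u / e)\<^sup>2 = (u\<^sup>2 + e\<^sup>2) / e\<^sup>2" using assms by (simp add: power_divide add_divide_distrib)
  then show ?thesis using assms by (simp add: conj_poisson_def power2_eq_square)
qed

lemma poisson_integral_tendsto:
  assumes f: "continuous_on UNIV f" "\<And>x. \<bar>f x\<bar> \<le> M" and e: "\<And>k. 0 < e k" "e \<longlonglongrightarrow> 0"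
  shows "(\<lambda>k. LBINT y. f y * poisson (e k) (x - y)) \<longlonglongrightarrow> pi * f x"
  using scaled_kernel_tendsto[OF f, of "\<lambda>t. 1 / (1 + t\<^sup>2)" e x] e inverse_quadratic_has_integral
  by (simp add: poisson_scaled[OF e(1)] has_bochner_integral_iff mult.commute)

text \<open>The bound is uniform in e; through the cyclic inequality it becomes the uniform L2 bound
  for the conjugate kernel.\<close>

lemma poisson_integral_le:
  assumes [measurable]: "f \<in> borel_measurable borel" and f: "\<And>x. 0 \<le> f x" "\<And>x. f x \<le> M"
    and e: "0 < e"
  shows "(LBINT y. f y * poisson e (x - y)) \<le> M * pi"
proof -
  have "(LBINT y. f y * poisson e (x - y)) = (LBINT t. f (x - e * t) * (1 / (1 + t\<^sup>2)))"
    using scaled_kernel_integral[OF e, of f "\<lambda>t. 1 / (1 + t\<^sup>2)" x] by (simp add: poisson_scaled[OF e])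
  also have "\<dots> \<le> (LBINT t. M * (1 / (1 + t\<^sup>2)))"
  proof (rule integral_mono')
    show "integrable lborel (\<lambda>t. M * (1 / (1 + t\<^sup>2)))"
      using inverse_quadratic_has_integral
      by (intro integrable_mult_right) (auto simp: has_bochner_integral_iff)
    show "f (x - e * t) * (1 / (1 + t\<^sup>2)) \<le> M * (1 / (1 + t\<^sup>2))"
      "0 \<le> M * (1 / (1 + t\<^sup>2))" for t
      using f order_trans[OF f] by (auto intro!: mult_right_mono divide_right_mono)
  qed
  also have "\<dots> = M * pi"
    using inverse_quadratic_has_integral
    by (subst integral_mult_right_zero) (auto simp: has_bochner_integral_iff)
  finally show ?thesis .
qed

lemma integral_odd_eq_0:
  fixes g :: "real \<Rightarrow> real"
  assumes "\<And>t. g (- t) = - g t"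
  shows "(LBINT t. g t) = 0"
proof -
  have "(LBINT t. g t) = (LBINT t. g (- t))"
    using lborel_integral_real_affine[of "-1" g 0] by simp
  then show ?thesis by (simp add: assms)
qed

lemma integrable_bounded_mult:
  fixes f g :: "real \<Rightarrow> real"
  assumes "integrable lborel f" and [measurable]: "g \<in> borel_measurable borel" and "\<And>x. \<bar>g x\<bar> \<le> C"
  shows "integrable lborel (\<lambda>x. f x * g x)"
proof (rule Bochner_Integration.integrable_bound)
  show "integrable lborel (\<lambda>x. C * \<bar>f x\<bar>)" using assms(1) by auto
  show "AE x in lborel. norm (f x * g x) \<le> norm (C * \<bar>f x\<bar>)"
  proof (rule AE_I2)
    fix x have "\<bar>f x\<bar> * \<bar>g x\<bar> \<le> \<bar>f x\<bar> * C" by (intro mult_left_mono assms) auto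
    moreover have "0 \<le> C" using assms(3)[of 0] by linarith
    ultimately show "norm (f x * g x) \<le> norm (C * \<bar>f x\<bar>)" by (simp add: abs_mult mult.commute)
  qed
  show "(\<lambda>x. f x * g x) \<in> borel_measurable lborel"
    using borel_measurable_integrable[OF assms(1)] by simp
qed

text \<open>The difference between the truncated kernel and \<^const>\<open>conj_poisson\<close> is an odd integrable
  kernel, so the two regularisations have the same limit.\<close>

lemma truncated_minus_conj_poisson_tendsto:
  assumes f: "continuous_on UNIV f" "\<And>x. \<bar>f x\<bar> \<le> M" "integrable lborel f"
    and e: "\<And>k. 0 < e k" "e \<longlonglongrightarrow> 0"
  shows "(\<lambda>k. (LINT y:{y. e k < \<bar>x - y\<bar>}|lborel. f y / (x - y)) -
    (LBINT y. f y * conj_poisson (e k) (x - y))) \<longlonglongrightarrow> 0"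
proof -
  define \<kappa> :: "real \<Rightarrow> real" where "\<kappa> t = indicator {t. 1 < \<bar>t\<bar>} t / t - t / (1 + t\<^sup>2)" for t
  have [measurable]: "\<kappa> \<in> borel_measurable borel" unfolding \<kappa>_def[abs_def] by measurable
  have [measurable]: "f \<in> borel_measurable borel"
    by (rule borel_measurable_continuous_onI[OF f(1)])
  have \<kappa>_le: "\<bar>\<kappa> t\<bar> \<le> 1 / (1 + t\<^sup>2)" for t
  proof (cases "1 < \<bar>t\<bar>")
    case True
    moreover have pos: "0 < 1 + t\<^sup>2" by (simp add: add_pos_nonneg)
    \<comment> \<open>At infinity the two kernels cancel to order t^(-3), so their difference is
      absolutely integrable although neither of them is.\<close>
    ultimately have "\<kappa> t = 1 / (t * (1 + t\<^sup>2))"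
      by (simp add: \<kappa>_def diff_frac_eq power2_eq_square) 
    moreover note pos
    ultimately show ?thesis using True
      by (auto simp: abs_mult intro!: divide_left_mono)
  next
    case False
    then show ?thesis by (auto simp: \<kappa>_def abs_mult divide_simps add_pos_nonneg)
  qed
  have odd: "(LBINT t. \<kappa> t) = 0"
    by (rule integral_odd_eq_0) (auto simp: \<kappa>_def indicator_def)
  have eq: "(LINT y:{y. e k < \<bar>x - y\<bar>}|lborel. f y / (x - y)) -
      (LBINT y. f y * conj_poisson (e k) (x - y)) =
      (LBINT y. f y * (\<kappa> ((x - y) / e k) / e k))" for k
  proof -
    have ek: "0 < e k" by (rule e)
    have "(LINT y:{y. e k < \<bar>x - y\<bar>}|lborel. f y / (x - y)) -
        (LBINT y. f y * conj_poisson (e k) (x - y)) =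
        (LBINT y. f y * (indicator {y. e k < \<bar>x - y\<bar>} y / (x - y)) -
          f y * conj_poisson (e k) (x - y))"
      unfolding set_lebesgue_integral_def
    proof (subst Bochner_Integration.integral_diff)
      show "integrable lborel (\<lambda>y. f y * (indicator {y. e k < \<bar>x - y\<bar>} y / (x - y)))"
        using ek by (intro integrable_bounded_mult[OF f(3), where C="1 / e k"])
          (auto simp: indicator_def divide_simps)
      show "integrable lborel (\<lambda>y. f y * conj_poisson (e k) (x - y))"
        using conj_poisson_le[OF ek] by (intro integrable_bounded_mult[OF f(3), where C="1 / e k"]) auto
    qed (simp add: mult.commute)
    also have "\<dots> = (LBINT y. f y * (\<kappa> ((x - y) / e k) / e k))"
    proof (rule Bochner_Integration.integral_cong[OF refl])
      fix y
      have "indicator {t. 1 < \<bar>t\<bar>} ((x - y) / e k) = (indicator {y. e k < \<bar>x - y\<bar>} y :: real)"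
        using ek by (simp add: indicator_def abs_divide)
      then have "\<kappa> ((x - y) / e k) / e k =
          indicator {y. e k < \<bar>x - y\<bar>} y / (x - y) - conj_poisson (e k) (x - y)"
        unfolding \<kappa>_def conj_poisson_scaled[OF ek] using ek
        by (simp add: diff_divide_distrib) (simp add: left_diff_distrib)
      then show "f y * (indicator {y. e k < \<bar>x - y\<bar>} y / (x - y)) - f y * conj_poisson (e k) (x - y)
          = f y * (\<kappa> ((x - y) / e k) / e k)"
        by (simp add: right_diff_distrib)
    qed
    finally show ?thesis .
  qed
  show ?thesis
    using scaled_kernel_tendsto[OF f(1,2), of \<kappa> e x] \<kappa>_le e odd by (simp add: eq)
qed

lemma principal_value_conj_poisson_tendsto:
  assumes f: "continuous_on UNIV f" "\<And>x. \<bar>f x\<bar> \<le> M" "integrable lborel f"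
    and e: "\<And>k. 0 < e k" "e \<longlonglongrightarrow> 0"
    and pv: "has_principal_value (\<lambda>y. f y / (x - y)) x I"
  shows "(\<lambda>k. LBINT y. f y * conj_poisson (e k) (x - y)) \<longlonglongrightarrow> I"
proof -
  have "filterlim e (at_right 0) sequentially"
    using e by (auto simp: filterlim_at less_imp_neq[symmetric])
  then have "(\<lambda>k. LINT y:{y. e k < \<bar>x - y\<bar>}|lborel. f y / (x - y)) \<longlonglongrightarrow> I"
    using pv unfolding has_principal_value_def by (auto intro: filterlim_compose)
  from tendsto_diff[OF this truncated_minus_conj_poisson_tendsto[OF f e, where x = x]]
  show ?thesis by simp
qed

section \<open>Boundedness of the regularised Hilbert transform\<close>

lemma integrable_pair_const_bound:
  fixes \<Phi> :: "real \<Rightarrow> real \<Rightarrow> 'b::{banach,second_countable_topology}"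
  assumes N: "finite_measure N" "sets N = sets borel"
    and \<Phi>: "(\<lambda>(x, y). \<Phi> x y) \<in> borel_measurable (borel \<Otimes>\<^sub>M borel)" "\<And>x y. norm (\<Phi> x y) \<le> B"
  shows "integrable (N \<Otimes>\<^sub>M N) (\<lambda>(x, y). \<Phi> x y)"
proof -
  interpret NN: finite_measure "N \<Otimes>\<^sub>M N" by (intro finite_measure_pair_measure N)
  show ?thesis
    using \<Phi> by (intro NN.integrable_const_bound[where B=B])
      (auto simp: measurable_cong_sets[OF sets_pair_measure_cong[OF N(2) N(2)] refl])
qed

lemma Fubini_bounded:
  fixes \<Phi> :: "real \<Rightarrow> real \<Rightarrow> 'b::{banach,second_countable_topology}"
  assumes N: "finite_measure N" "sets N = sets borel"
    and \<Phi>: "(\<lambda>(x, y). \<Phi> x y) \<in> borel_measurable (borel \<Otimes>\<^sub>M borel)" "\<And>x y. norm (\<Phi> x y) \<le> B"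
  shows "(LINT x|N. (LINT y|N. \<Phi> x y)) = (LINT y|N. (LINT x|N. \<Phi> x y))"
proof -
  interpret N: finite_measure N by (rule N)
  interpret pair_sigma_finite N N ..
  show ?thesis
    by (rule Fubini_integral[symmetric]) (rule integrable_pair_const_bound[OF N \<Phi>])
qed

lemma norm_integral_le_const:
  fixes g :: "real \<Rightarrow> 'b::{banach,second_countable_topology}"
  assumes N: "finite_measure N" "sets N = sets borel"
    and g: "\<And>y. norm (g y) \<le> B" "g \<in> borel_measurable borel"
  shows "norm (LINT y|N. g y) \<le> B * measure N (space N)"
proof -
  interpret N: finite_measure N by (rule N)
  note N(2)[measurable_cong] and g(2)[measurable]
  have "norm (LINT y|N. g y) \<le> (LINT y|N. norm (g y))" by (rule integral_norm_bound)
  also have "\<dots> \<le> (LINT y|N. B)"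
    by (rule integral_mono) (auto intro!: N.integrable_const_bound[OF AE_I2] g)
  finally show ?thesis by (simp add: mult.commute)
qed

lemma integral_add3:
  fixes f g h :: "'a \<Rightarrow> real"
  assumes "integrable N f" "integrable N g" "integrable N h"
  shows "(LINT x|N. f x + g x + h x) = (LINT x|N. f x) + (LINT x|N. g x) + (LINT x|N. h x)"
  using assms by simp

text \<open>By Fubini and relabelling, each of the three cyclic terms integrates to the same square.
  The parity of \<open>r\<close> does not enter, so one identity serves both the odd conjugate
  kernel and the even Poisson kernel.\<close>

lemma cyclic_integral:
  fixes r :: "real \<Rightarrow> real"
  assumes N: "finite_measure N" "sets N = sets borel"
    and [measurable]: "r \<in> borel_measurable borel" and r: "\<And>x. \<bar>r x\<bar> \<le> B"
  shows "3 * (LINT x|N. (LINT y|N. r (x - y))\<^sup>2) =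
    (LINT x|N. (LINT y|N. (LINT z|N. r (x - y) * r (x - z) + r (y - x) * r (y - z) + r (z - x) * r (z - y))))"
proof -
  interpret N: finite_measure N by (rule N)
  note N(2)[measurable_cong]
  define u where "u x = (LINT y|N. r (x - y))" for x
  have u_meas[measurable]: "u \<in> borel_measurable borel" unfolding u_def[abs_def] by measurable
  have int: "integrable N (\<lambda>y. r (x - y))" "integrable N (\<lambda>y. r (y - x))" for x
    by (auto intro!: N.integrable_const_bound[where B=B] r)
  have B0: "0 \<le> B" using r[of 0] by linarith
  define m where "m = measure N (space N)"
  have m0: "0 \<le> m" by (simp add: m_def)
  have bd: "\<bar>LINT y|N. g y\<bar> \<le> G * m" if "\<And>y. \<bar>g y\<bar> \<le> G" "g \<in> borel_measurable borel" for g :: "real \<Rightarrow> real" and G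
    using norm_integral_le_const[OF N, of g G] that by (simp add: m_def)
  have u_le: "\<bar>u x\<bar> \<le> B * m" for x unfolding u_def by (rule bd) (auto intro: r)
  have ru: "\<bar>r a * u b\<bar> \<le> B * (B * m)" for a b
    unfolding abs_mult by (intro mult_mono r u_le) (auto simp: B0)
  have rr: "\<bar>r a * r b\<bar> \<le> B * B" for a b
    unfolding abs_mult by (intro mult_mono r) (auto simp: B0)
  have uu: "\<bar>u a * u b\<bar> \<le> (B * m) * (B * m)" for a b
    unfolding abs_mult by (intro mult_mono u_le) (auto simp: B0 m0)
  define c where "c x y = (LINT z|N. r (z - x) * r (z - y))" for x y
  have c_meas[measurable]: "(\<lambda>(x, y). c x y) \<in> borel_measurable (borel \<Otimes>\<^sub>M borel)"
    unfolding c_def by measurable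
  have c_le: "\<bar>c x y\<bar> \<le> (B * B) * m" for x y unfolding c_def by (rule bd) (auto intro: rr)
  have t1: "(LINT x|N. (LINT y|N. r (x - y) * u x)) = (LINT x|N. (u x)\<^sup>2)"
    by (simp add: u_def power2_eq_square)
  have t2: "(LINT x|N. (LINT y|N. r (y - x) * u y)) = (LINT x|N. (u x)\<^sup>2)"
    by (subst Fubini_bounded[OF N, where B="B * (B * m)"]) (use ru in \<open>auto simp: power2_eq_square simp flip: u_def\<close>)
  \<comment> \<open>The repeated variable is now the innermost one, and Fubini has to move it
    outwards twice.\<close>
  have t3: "(LINT x|N. (LINT y|N. c x y)) = (LINT x|N. (u x)\<^sup>2)"
  proof -
    have "(LINT y|N. c x y) = (LINT z|N. r (z - x) * u z)" for x
      unfolding c_def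
      by (subst Fubini_bounded[OF N, where B="B * B"]) (use rr in \<open>auto simp: u_def\<close>)
    then show ?thesis by (simp add: t2)
  qed
  have "(LINT x|N. (LINT y|N. (LINT z|N. r (x - y) * r (x - z) + r (y - x) * r (y - z) + r (z - x) * r (z - y)))) =
     (LINT x|N. (LINT y|N. r (x - y) * u x + r (y - x) * u y + c x y))"
  proof -
    have "(LINT z|N. r (x - y) * r (x - z) + r (y - x) * r (y - z) + r (z - x) * r (z - y)) =
      r (x - y) * u x + r (y - x) * u y + c x y" for x y
      unfolding c_def u_def
      by (subst integral_add3) (use rr in \<open>auto intro!: int N.integrable_const_bound[where B="B*B"]\<close>)
    then show ?thesis by simp
  qed
  also have "\<dots> = (LINT x|N. (LINT y|N. r (x - y) * u x) + (LINT y|N. r (y - x) * u y) + (LINT y|N. c x y))"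
  proof -
    have i: "integrable N (\<lambda>y. r (x - y) * u x)" "integrable N (\<lambda>y. r (y - x) * u y)"
      "integrable N (\<lambda>y. c x y)" for x
      by (rule N.integrable_const_bound[OF AE_I2]; (unfold real_norm_def)?; (rule ru c_le)?; measurable)+
    have "(LINT y|N. r (x - y) * u x + r (y - x) * u y + c x y) =
      (LINT y|N. r (x - y) * u x) + (LINT y|N. r (y - x) * u y) + (LINT y|N. c x y)" for x
      by (rule integral_add3[OF i])
    then show ?thesis by simp
  qed
  also have "\<dots> = (LINT x|N. (LINT y|N. r (x - y) * u x)) + (LINT x|N. (LINT y|N. r (y - x) * u y)) + (LINT x|N. (LINT y|N. c x y))"
  proof -
    have i: "integrable N (\<lambda>x. LINT y|N. r (x - y) * u x)" "integrable N (\<lambda>x. LINT y|N. r (y - x) * u y)"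
      "integrable N (\<lambda>x. LINT y|N. c x y)"
      by (rule N.integrable_const_bound; (intro AE_I2, unfold real_norm_def, rule bd)?; (rule ru c_le)?; measurable)+
    show ?thesis
      by (rule integral_add3[OF i])
  qed
  finally show ?thesis unfolding t1 t2 t3 by (simp flip: u_def)
qed

text \<open>For e = 0 and distinct points the left side is zero: 1 / ((x - y) (x - z)) and its two
  cyclic companions cancel. For e > 0, over a common denominator, the terms of order e^2 on both
  sides agree and the numerators differ by exactly 3/2 e^4.\<close>

lemma conj_poisson_cyclic_le:
  fixes x y z e :: real
  assumes "0 < e"
  defines "q \<equiv> conj_poisson e" and "p \<equiv> poisson e"
  shows "q (x - y) * q (x - z) + q (y - x) * q (y - z) + q (z - x) * q (z - y) \<le>
    (p (x - y) * p (x - z) + p (y - x) * p (y - z) + p (z - x) * p (z - y)) / 2"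
proof -
  define a b A B C where "a = x - y" and "b = y - z"
    and "A = a\<^sup>2 + e\<^sup>2" and "B = b\<^sup>2 + e\<^sup>2" and "C = (a + b)\<^sup>2 + e\<^sup>2"
  have pos: "0 < A" "0 < B" "0 < C"
    using assms(1) by (auto simp: A_def B_def C_def add_nonneg_pos)
  have eqs: "x - y = a" "y - z = b" "x - z = a + b" "y - x = - a" "z - y = - b" "z - x = - (a + b)"
    by (auto simp: a_def b_def)
  have q: "q (x - y) * q (x - z) + q (y - x) * q (y - z) + q (z - x) * q (z - y) =
      (a * (a + b) * B - a * b * C + b * (a + b) * A) / (A * B * C)"
    unfolding q_def conj_poisson_def eqs power2_minus A_def[symmetric] B_def[symmetric] C_def[symmetric]
    using pos by (simp add: field_simps)
  have p: "(p (x - y) * p (x - z) + p (y - x) * p (y - z) + p (z - x) * p (z - y)) / 2 =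
      (e\<^sup>2 * (A + B + C) / 2) / (A * B * C)"
    unfolding p_def poisson_def eqs power2_minus A_def[symmetric] B_def[symmetric] C_def[symmetric]
    using pos by (simp add: field_simps power2_eq_square[of e])
  have "e\<^sup>2 * (A + B + C) / 2 - (a * (a + b) * B - a * b * C + b * (a + b) * A) = 3 / 2 * e ^ 4"
    unfolding A_def B_def C_def by (simp add: field_simps power2_eq_square power4_eq_xxxx)
  then have "a * (a + b) * B - a * b * C + b * (a + b) * A \<le> e\<^sup>2 * (A + B + C) / 2"
    by (smt (verit) zero_le_even_power even_numeral mult_nonneg_nonneg divide_nonneg_nonneg)
  then show ?thesis unfolding p q using pos by (intro divide_right_mono) auto
qed


text \<open>Cyclic symmetrisation turns the square of the conjugate Poisson integral into that of the
  Poisson integral. The result is the \<open>L\<^sup>2\<close> boundedness of the Hilbert transform with respect to the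
  measure that is transformed, which is all that is needed here.\<close>

lemma conj_poisson_square_le:
  assumes N: "finite_measure N" "sets N = sets borel" and e: "0 < e"
  shows "(LINT x|N. (LINT y|N. conj_poisson e (x - y))\<^sup>2) \<le> (LINT x|N. (LINT y|N. poisson e (x - y))\<^sup>2) / 2"
proof -
  interpret N: finite_measure N by (rule N)
  note N(2)[measurable_cong]
  define m where "m = measure N (space N)"
  define Q where "Q r x y z = r (x - y) * r (x - z) + r (y - x) * r (y - z) + r (z - x) * r (z - y)"
    for r :: "real \<Rightarrow> real" and x y z
  have bd: "\<bar>LINT y|N. g y\<bar> \<le> G * m" if "\<And>y. \<bar>g y\<bar> \<le> G" "g \<in> borel_measurable borel" for g :: "real \<Rightarrow> real" and G
    using norm_integral_le_const[OF N, of g G] that by (simp add: m_def)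
  have bdd: "\<bar>Q r x y z\<bar> \<le> 3 * (1 / e * (1 / e))" if "\<And>u. \<bar>r u\<bar> \<le> 1 / e" for r :: "real \<Rightarrow> real" and x y z
  proof -
    have "\<bar>r a * r b\<bar> \<le> 1 / e * (1 / e)" for a b
      unfolding abs_mult using e by (intro mult_mono that) auto
    from this[of "x - y" "x - z"] this[of "y - x" "y - z"] this[of "z - x" "z - y"]
    show ?thesis unfolding Q_def by linarith
  qed
  have int: "integrable N (\<lambda>z. Q r x y z)" "integrable N (\<lambda>y. LINT z|N. Q r x y z)"
      "integrable N (\<lambda>x. LINT y|N. LINT z|N. Q r x y z)"
    if [measurable]: "r \<in> borel_measurable borel" and r: "\<And>u. \<bar>r u\<bar> \<le> 1 / e" for r :: "real \<Rightarrow> real" and x y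
  proof -
    have m1: "(\<lambda>z. Q r x y z) \<in> borel_measurable borel" for x y
      unfolding Q_def by measurable
    have m2: "(\<lambda>y. LINT z|N. Q r x y z) \<in> borel_measurable borel" for x
      unfolding Q_def by measurable
    have m3: "(\<lambda>x. LINT y|N. LINT z|N. Q r x y z) \<in> borel_measurable borel"
      unfolding Q_def by measurable
    note meas = m1 m2 m3 and N_cong = measurable_cong_sets[OF N(2) refl]
    note b2 = bd[OF bdd[OF r] m1] note b3 = bd[OF b2 m2]
    show "integrable N (\<lambda>z. Q r x y z)"
      by (rule N.integrable_const_bound[OF AE_I2])
        (unfold N_cong real_norm_def, rule bdd[OF r], rule meas)
    show "integrable N (\<lambda>y. LINT z|N. Q r x y z)"
      by (rule N.integrable_const_bound[OF AE_I2])
        (unfold N_cong real_norm_def, rule b2, rule meas)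
    show "integrable N (\<lambda>x. LINT y|N. LINT z|N. Q r x y z)"
      by (rule N.integrable_const_bound[OF AE_I2])
        (unfold N_cong real_norm_def, rule b3, rule meas)
  qed
  have le: "Q (conj_poisson e) x y z \<le> Q (poisson e) x y z / 2" for x y z
    using conj_poisson_cyclic_le[OF e] by (simp add: Q_def)
  have "3 * (LINT x|N. (LINT y|N. conj_poisson e (x - y))\<^sup>2) = (LINT x|N. LINT y|N. LINT z|N. Q (conj_poisson e) x y z)"
    unfolding Q_def by (rule cyclic_integral[OF N]) (auto intro: conj_poisson_le e)
  also have "\<dots> \<le> (LINT x|N. LINT y|N. LINT z|N. Q (poisson e) x y z / 2)"
    using e by (intro integral_mono le int)
      (auto intro!: int poisson_le conj_poisson_le)
  also have "\<dots> = (LINT x|N. LINT y|N. LINT z|N. Q (poisson e) x y z) / 2"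
    by simp
  also have "(LINT x|N. LINT y|N. LINT z|N. Q (poisson e) x y z) = 3 * (LINT x|N. (LINT y|N. poisson e (x - y))\<^sup>2)"
    unfolding Q_def by (rule cyclic_integral[OF N, symmetric]) (auto intro: poisson_le e)
  finally show ?thesis by simp
qed

text \<open>Blows up as e tends to 0 and serves only for integrability at fixed e; uniform control
  comes from the L2 bound.\<close>

lemma conj_poisson_integral_le:
  assumes f: "integrable lborel f" and e: "0 < e"
  shows "\<bar>LBINT y. f y * conj_poisson e (x - y)\<bar> \<le> (LBINT y. \<bar>f y\<bar>) / e"
proof -
  have "\<bar>LBINT y. f y * conj_poisson e (x - y)\<bar> \<le> (LBINT y. \<bar>f y * conj_poisson e (x - y)\<bar>)"
    by (rule integral_abs_bound)
  also have "\<dots> \<le> (LBINT y. \<bar>f y\<bar> * (1 / e))"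
  proof (rule integral_mono)
    show "integrable lborel (\<lambda>y. \<bar>f y * conj_poisson e (x - y)\<bar>)"
      by (intro integrable_abs integrable_bounded_mult[where C="1 / e"] f conj_poisson_le e) auto
  qed (use f conj_poisson_le[OF e] in \<open>auto simp: abs_mult simp del: times_divide_eq_right intro!: mult_left_mono\<close>)
  finally show ?thesis by simp
qed

lemma finite_measure_density_integrable:
  fixes g :: "real \<Rightarrow> real"
  assumes "integrable lborel g" "\<And>x. 0 \<le> g x"
  shows "finite_measure (density lborel g)"
proof (rule finite_measureI)
  have [measurable]: "g \<in> borel_measurable borel" using borel_measurable_integrable[OF assms(1)] by simp
  have "(\<integral>\<^sup>+x. ennreal (g x) \<partial>lborel) < \<infinity>"
    using assms unfolding integrable_iff_bounded by simp
  then show "emeasure (density lborel g) (space (density lborel g)) \<noteq> \<infinity>"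
    by (simp add: emeasure_density)
qed

text \<open>With g times Lebesgue measure as the finite measure, the Poisson integral on the right
  of the cyclic inequality is at most M pi at every point.\<close>

lemma weighted_conj_poisson_square_le:
  assumes g: "integrable lborel g" "\<And>x. 0 \<le> g x" "\<And>x. g x \<le> M" and e: "0 < e"
  shows "(LBINT x. g x * (LBINT y. g y * conj_poisson e (x - y))\<^sup>2) \<le> (M * pi)\<^sup>2 / 2 * (LBINT x. g x)"
proof -
  have [measurable]: "g \<in> borel_measurable borel" using borel_measurable_integrable[OF g(1)] by simp
  let ?N = "density lborel g"
  have N: "finite_measure ?N" "sets ?N = sets borel"
    using finite_measure_density_integrable[OF g(1,2)] by auto
  interpret N: finite_measure ?N by (rule N)
  have D: "(LINT y|?N. u y) = (LBINT y. g y * u y)" if "u \<in> borel_measurable borel" for u :: "real \<Rightarrow> real"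
    using that g(2) by (subst integral_real_density) auto
  have P: "0 \<le> (LBINT y. g y * poisson e (x - y))" "(LBINT y. g y * poisson e (x - y)) \<le> M * pi" for x
    using poisson_integral_le[OF _ g(2,3) e, where x=x] g(2) poisson_nonneg[of e] e
    by (auto intro!: integral_nonneg)
  have "(LBINT x. g x * (LBINT y. g y * conj_poisson e (x - y))\<^sup>2) =
      (LINT x|?N. (LINT y|?N. conj_poisson e (x - y))\<^sup>2)"
    by (simp add: D)
  also have "\<dots> \<le> (LINT x|?N. (LINT y|?N. poisson e (x - y))\<^sup>2) / 2"
    by (rule conj_poisson_square_le[OF N e])
  also have "(LINT x|?N. (LINT y|?N. poisson e (x - y))\<^sup>2) \<le> (LINT x|?N. (M * pi)\<^sup>2)"
  proof (rule integral_mono)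
    have le: "(LINT y|?N. poisson e (x - y))\<^sup>2 \<le> (M * pi)\<^sup>2" for x
      using P[of x] by (auto simp: D intro!: power_mono)
    then show "(LINT y|?N. poisson e (x - y))\<^sup>2 \<le> (M * pi)\<^sup>2" for x .
    show "integrable ?N (\<lambda>x. (LINT y|?N. poisson e (x - y))\<^sup>2)"
    proof (rule N.integrable_const_bound[OF AE_I2])
      show "norm ((LINT y|?N. poisson e (x - y))\<^sup>2) \<le> (M * pi)\<^sup>2" for x using le[of x] by simp
    qed (simp add: D)
  qed auto
  also have "(LINT x|?N. (M * pi)\<^sup>2) = (M * pi)\<^sup>2 * (LBINT x. g x)"
    using D[of "\<lambda>_. (M * pi)\<^sup>2"] by simp
  finally show ?thesis by simp
qed

text \<open>The uniqueness argument deals with a difference of two densities, so f may change sign.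
  Splitting it leaves cross terms, the transform of one part weighted by the other; they are
  controlled through the transform of |f|. The constant 9 is (8 + 8 + 2) / 2.\<close>

lemma abs_weighted_conj_poisson_square_le:
  assumes f: "integrable lborel f" "\<And>x. \<bar>f x\<bar> \<le> M" and e: "0 < e"
  shows "(LBINT x. \<bar>f x\<bar> * (LBINT y. f y * conj_poisson e (x - y))\<^sup>2) \<le>
    9 * (M * pi)\<^sup>2 * (LBINT x. \<bar>f x\<bar>)"
proof -
  have [measurable]: "f \<in> borel_measurable borel" using borel_measurable_integrable[OF f(1)] by simp
  define fp fm where "fp x = max 0 (f x)" and "fm x = max 0 (- f x)" for x
  have int: "integrable lborel fp" "integrable lborel fm"
    unfolding fp_def[abs_def] fm_def[abs_def] using f(1) by auto
  define Q where "Q g x = (LBINT y. g y * conj_poisson e (x - y))" for g x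
  define E where "E g = (LBINT x. g x * (Q g x)\<^sup>2)" for g
  have Qint: "integrable lborel (\<lambda>y. g y * conj_poisson e (x - y))" if "integrable lborel g" for g x
    by (intro integrable_bounded_mult[where C="1 / e"] that conj_poisson_le e) auto
  have Qabs: "Q (\<lambda>y. \<bar>f y\<bar>) x = Q fp x + Q fm x" for x
  proof -
    have "Q (\<lambda>y. \<bar>f y\<bar>) x = (LBINT y. fp y * conj_poisson e (x - y) + fm y * conj_poisson e (x - y))"
      unfolding Q_def by (rule Bochner_Integration.integral_cong) (auto simp: fp_def fm_def max_def)
    then show ?thesis unfolding Q_def by (simp add: Qint int)
  qed
  have Qf: "Q f x = Q fp x - Q fm x" for x
  proof -
    have "Q f x = (LBINT y. fp y * conj_poisson e (x - y) - fm y * conj_poisson e (x - y))"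
      unfolding Q_def by (rule Bochner_Integration.integral_cong) (auto simp: fp_def fm_def max_def)
    then show ?thesis unfolding Q_def by (simp add: Qint int)
  qed
  have Qm[measurable]: "Q g \<in> borel_measurable borel" if "integrable lborel g" for g
  proof -
    have [measurable]: "g \<in> borel_measurable borel" using borel_measurable_integrable[OF that] by simp
    show ?thesis unfolding Q_def[abs_def] by measurable
  qed
  have Eint: "integrable lborel (\<lambda>x. g x * (Q h x)\<^sup>2)" if "integrable lborel g" "integrable lborel h" for g h
  proof (rule integrable_bounded_mult[OF that(1), where C="((LBINT y. \<bar>h y\<bar>) / e)\<^sup>2"])
    show "(\<lambda>x. (Q h x)\<^sup>2) \<in> borel_measurable borel" using Qm[OF that(2)] by measurable
    show "\<bar>(Q h x)\<^sup>2\<bar> \<le> ((LBINT y. \<bar>h y\<bar>) / e)\<^sup>2" for x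
      using power_mono[OF conj_poisson_integral_le[OF that(2) e, of x], of 2] by (simp add: Q_def)
  qed
  \<comment> \<open>With a and b the transforms of the two parts, a - b is read as 2 a - (a + b)
    where f is nonnegative and as (a + b) - 2 b elsewhere.\<close>
  have le: "\<bar>f x\<bar> * (Q f x)\<^sup>2 \<le> 8 * (fp x * (Q fp x)\<^sup>2) + 8 * (fm x * (Q fm x)\<^sup>2)
      + 2 * (\<bar>f x\<bar> * (Q (\<lambda>y. \<bar>f y\<bar>) x)\<^sup>2)" for x
  proof -
    define a b where "a = Q fp x" and "b = Q fm x"
    have "0 \<le> (3 * a + b)\<^sup>2" "0 \<le> (a + 3 * b)\<^sup>2" by auto
    then have "(a - b)\<^sup>2 \<le> 8 * a\<^sup>2 + 2 * (a + b)\<^sup>2" "(a - b)\<^sup>2 \<le> 8 * b\<^sup>2 + 2 * (a + b)\<^sup>2"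
      by (auto simp: power2_eq_square algebra_simps)
    then have "\<bar>f x\<bar> * (a - b)\<^sup>2 \<le> \<bar>f x\<bar> * (8 * a\<^sup>2 + 2 * (a + b)\<^sup>2)"
       "\<bar>f x\<bar> * (a - b)\<^sup>2 \<le> \<bar>f x\<bar> * (8 * b\<^sup>2 + 2 * (a + b)\<^sup>2)"
      by (auto intro: mult_left_mono)
    then show ?thesis
      unfolding Qabs Qf a_def[symmetric] b_def[symmetric] fp_def fm_def
      by (cases "0 \<le> f x") (auto simp: max_def algebra_simps)
  qed
  have "(LBINT x. \<bar>f x\<bar> * (Q f x)\<^sup>2) \<le> (LBINT x. 8 * (fp x * (Q fp x)\<^sup>2) + 8 * (fm x * (Q fm x)\<^sup>2)
      + 2 * (\<bar>f x\<bar> * (Q (\<lambda>y. \<bar>f y\<bar>) x)\<^sup>2))"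
    by (rule integral_mono) (use le Eint[OF int(1) int(1)] Eint[OF int(2) int(2)]
        Eint[OF integrable_abs[OF f(1)] integrable_abs[OF f(1)]] Eint[OF integrable_abs[OF f(1)] f(1)] in auto)
  also have "\<dots> = 8 * E fp + 8 * E fm + 2 * E (\<lambda>y. \<bar>f y\<bar>)"
    unfolding E_def by (subst integral_add3) (auto intro!: Eint int f integrable_abs)
  also have "\<dots> \<le> 8 * ((M * pi)\<^sup>2 / 2 * (LBINT x. \<bar>f x\<bar>)) + 8 * ((M * pi)\<^sup>2 / 2 * (LBINT x. \<bar>f x\<bar>))
      + 2 * ((M * pi)\<^sup>2 / 2 * (LBINT x. \<bar>f x\<bar>))"
  proof -
    have *: "E g \<le> (M * pi)\<^sup>2 / 2 * (LBINT x. \<bar>f x\<bar>)"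
      if "integrable lborel g" "\<And>x. 0 \<le> g x" "\<And>x. g x \<le> \<bar>f x\<bar>" for g
    proof -
      have "E g \<le> (M * pi)\<^sup>2 / 2 * (LBINT x. g x)"
        unfolding E_def Q_def
        by (rule weighted_conj_poisson_square_le) (use that order_trans[OF that(3) f(2)] e in auto)
      also have "\<dots> \<le> (M * pi)\<^sup>2 / 2 * (LBINT x. \<bar>f x\<bar>)"
        using that f(1) by (intro mult_left_mono integral_mono) auto
      finally show ?thesis .
    qed
    have "E fp \<le> (M * pi)\<^sup>2 / 2 * (LBINT x. \<bar>f x\<bar>)" "E fm \<le> (M * pi)\<^sup>2 / 2 * (LBINT x. \<bar>f x\<bar>)"
      "E (\<lambda>y. \<bar>f y\<bar>) \<le> (M * pi)\<^sup>2 / 2 * (LBINT x. \<bar>f x\<bar>)"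
      by (intro * int integrable_abs f; simp add: fp_def fm_def)+
    then show ?thesis by linarith
  qed
  finally show ?thesis by (simp add: Q_def ac_simps)
qed

text \<open>The L2 bound makes the sequence uniformly integrable, so convergence almost everywhere
  improves to convergence in L1, as in Vitali's theorem.\<close>

lemma L2_bounded_integral_tendsto:
  fixes g :: "nat \<Rightarrow> real \<Rightarrow> real"
  assumes N: "finite_measure N" and g[measurable]: "\<And>k. g k \<in> borel_measurable N"
    and lim: "AE x in N. (\<lambda>k. g k x) \<longlonglongrightarrow> 0"
    and sq: "\<And>k. integrable N (\<lambda>x. (g k x)\<^sup>2)" "\<And>k. (LINT x|N. (g k x)\<^sup>2) \<le> C"
  shows "(\<lambda>k. LINT x|N. \<bar>g k x\<bar>) \<longlonglongrightarrow> 0"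
proof (rule LIMSEQ_I)
  interpret N: finite_measure N by (rule N)
  fix r :: real assume r: "0 < r"
  have C0: "0 \<le> C" by (rule order_trans[OF _ sq(2)[of 0]]) (simp add: integral_nonneg)
  \<comment> \<open>Chosen so that the part above height L contributes at most C / L < r /
    2.\<close>
  define L where "L = 2 * (C + 1) / r"
  have L: "0 < L" "C / L < r / 2" using C0 r by (auto simp: L_def field_simps)
  have min_int: "integrable N (\<lambda>x. min \<bar>g k x\<bar> L)" for k
    using L by (intro N.integrable_const_bound[where B=L]) auto
  have "(\<lambda>k. LINT x|N. min \<bar>g k x\<bar> L) \<longlonglongrightarrow> (LINT x|N. 0)"
  proof (rule integral_dominated_convergence[where w="\<lambda>_. L"])
    show "AE x in N. (\<lambda>k. min \<bar>g k x\<bar> L) \<longlonglongrightarrow> 0"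
      using lim
    proof eventually_elim
      case (elim x)
      have "(\<lambda>k. min \<bar>g k x\<bar> L) \<longlonglongrightarrow> min \<bar>0\<bar> L" by (intro tendsto_intros elim)
      then show ?case using L by simp
    qed
  qed (use L in auto)
  then obtain k0 where k0: "\<And>k. k0 \<le> k \<Longrightarrow> \<bar>LINT x|N. min \<bar>g k x\<bar> L\<bar> < r / 2"
    using r LIMSEQ_D[of "\<lambda>k. LINT x|N. min \<bar>g k x\<bar> L" 0 "r / 2"] by auto
  have "norm ((LINT x|N. \<bar>g k x\<bar>) - 0) < r" if "k0 \<le> k" for k
  proof -
    have le: "\<bar>t\<bar> \<le> min \<bar>t\<bar> L + t\<^sup>2 / L" for t :: real
    proof (cases "\<bar>t\<bar> \<le> L")
      case False
      then have "\<bar>t\<bar> * L \<le> \<bar>t\<bar> * \<bar>t\<bar>" by (intro mult_left_mono) auto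
      then show ?thesis using L False
        by (simp add: field_simps power2_eq_square min_def) (smt (verit) mult_nonneg_nonneg)
    qed (use L in auto)
    have "(LINT x|N. \<bar>g k x\<bar>) \<le> (LINT x|N. min \<bar>g k x\<bar> L + (g k x)\<^sup>2 / L)"
      by (rule integral_mono') (use min_int sq le L in auto)
    also have "\<dots> = (LINT x|N. min \<bar>g k x\<bar> L) + (LINT x|N. (g k x)\<^sup>2) / L"
      using min_int sq by simp
    also have "\<dots> < r / 2 + r / 2"
    proof (intro add_strict_mono)
      show "(LINT x|N. (g k x)\<^sup>2) / L < r / 2"
        using divide_right_mono[OF sq(2)[of k], of L] L by linarith
    qed (use k0[OF that] in auto)
    finally show ?thesis by (simp add: integral_nonneg)
  qed
  then show "\<exists>no. \<forall>k\<ge>no. norm ((LINT x|N. \<bar>g k x\<bar>) - 0) < r" by blast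
qed

section \<open>Symmetrisation of the principal value\<close>

lemma square_diff_le_2: "(a - b)\<^sup>2 \<le> 2 * a\<^sup>2 + 2 * b\<^sup>2" for a b :: real
  using zero_le_power2[of "a + b"] by (simp add: power2_eq_square algebra_simps)

lemma conj_poisson_swap: "conj_poisson e (y - x) = - conj_poisson e (x - y)"
  by (simp add: conj_poisson_def power2_commute[of y x] minus_divide_left)

text \<open>Exchanging x and y turns the term with w y into minus the term with w x. The measure has
  density |f| to be positive and finite; the signs of f move into the integrand.\<close>

lemma regularised_difference_integral:
  fixes f :: "real \<Rightarrow> real" and w :: "real \<Rightarrow> 'b::{banach,second_countable_topology}"
  assumes f: "integrable lborel f" and e: "0 < e"
    and [measurable]: "w \<in> borel_measurable borel" and w_le: "\<And>x. f x \<noteq> 0 \<Longrightarrow> norm (w x) \<le> W"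
  defines "N \<equiv> density lborel (\<lambda>x. \<bar>f x\<bar>)"
  shows "(LINT x|N. (LINT y|N. (sgn (f x) * sgn (f y) * conj_poisson e (x - y)) *\<^sub>R (w x - w y))) =
    2 *\<^sub>R (LINT x|N. (sgn (f x) * (LBINT y. f y * conj_poisson e (x - y))) *\<^sub>R w x)"
proof -
  have f_meas[measurable]: "f \<in> borel_measurable borel" using borel_measurable_integrable[OF f] by simp
  have N: "finite_measure N" "sets N = sets borel"
    using finite_measure_density_integrable[of "\<lambda>x. \<bar>f x\<bar>"] f by (auto simp: N_def)
  interpret N: finite_measure N by (rule N)
  note N(2)[measurable_cong]
  have D: "(LINT y|N. sgn (f y) * conj_poisson e (x - y)) = (LBINT y. f y * conj_poisson e (x - y))" for x
    unfolding N_def by (subst integral_real_density) (auto simp: mult.assoc[symmetric] abs_mult_sgn)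
  define S where "S x y = sgn (f x) * sgn (f y) * conj_poisson e (x - y)" for x y
  have S_meas: "(\<lambda>(x, y). S x y) \<in> borel_measurable (borel \<Otimes>\<^sub>M borel)"
    unfolding S_def by measurable
  have S_measx[measurable]: "S x \<in> borel_measurable borel" for x unfolding S_def[abs_def] by measurable
  have W0: "0 \<le> max 0 W" by simp
  have S_le: "\<bar>S x y\<bar> \<le> 1 / e * (if f x \<noteq> 0 \<and> f y \<noteq> 0 then 1 else 0)" for x y
    using conj_poisson_le[OF e, of "x - y"] by (auto simp: S_def abs_mult sgn_if)
  have Sx: "norm (S x y *\<^sub>R w x) \<le> 1 / e * max 0 W" for x y
  proof (cases "f x \<noteq> 0 \<and> f y \<noteq> 0")
    case True
    then show ?thesis unfolding norm_scaleR
      using S_le[of x y] w_le[of x] e by (intro mult_mono) auto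
  next
    case False
    then show ?thesis using e by (auto simp: S_def)
  qed
  have anti: "S x y = - S y x" for x y
    unfolding S_def by (subst conj_poisson_swap) simp
  have Sy: "norm (S x y *\<^sub>R w y) \<le> 1 / e * max 0 W" for x y
    using Sx[of y x] by (subst anti) simp
  have int1: "integrable N (\<lambda>y. S x y *\<^sub>R w x)" "integrable N (\<lambda>y. S x y *\<^sub>R w y)" for x
    using Sx Sy by (auto intro!: N.integrable_const_bound[OF AE_I2])
  have m: "(\<lambda>(x, y). S x y *\<^sub>R w x) \<in> borel_measurable (borel \<Otimes>\<^sub>M borel)"
    "(\<lambda>(x, y). S x y *\<^sub>R w y) \<in> borel_measurable (borel \<Otimes>\<^sub>M borel)"
    unfolding S_def by measurable
  note bd = norm_integral_le_const[OF N]
  have m': "(\<lambda>x. LINT y|N. S x y *\<^sub>R w x) \<in> borel_measurable N" "(\<lambda>x. LINT y|N. S x y *\<^sub>R w y) \<in> borel_measurable N"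
    unfolding S_def by measurable
  have int2: "integrable N (\<lambda>x. LINT y|N. S x y *\<^sub>R w x)" "integrable N (\<lambda>x. LINT y|N. S x y *\<^sub>R w y)"
    by (rule N.integrable_const_bound[OF AE_I2]; (rule bd)?; (rule Sx Sy m')?; measurable)+
  define Q where "Q x = (LBINT y. f y * conj_poisson e (x - y))" for x
  have i1: "(LINT y|N. S x y *\<^sub>R w x) = (sgn (f x) * Q x) *\<^sub>R w x" for x
  proof -
    have "integrable N (\<lambda>y. S x y)"
      by (intro N.integrable_const_bound[where B="1 / e"] AE_I2)
        (auto intro!: order_trans[OF S_le] simp: e less_imp_le)
    then have "(LINT y|N. S x y *\<^sub>R w x) = (LINT y|N. S x y) *\<^sub>R w x" by (rule integral_scaleR_left)
    also have "(LINT y|N. S x y) = sgn (f x) * Q x"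
      unfolding S_def Q_def by (simp add: mult.assoc D)
    finally show ?thesis .
  qed
  have i2: "(LINT x|N. (LINT y|N. S x y *\<^sub>R w y)) = - (LINT x|N. (sgn (f x) * Q x) *\<^sub>R w x)"
  proof -
    have "(LINT x|N. (LINT y|N. S x y *\<^sub>R w y)) = (LINT y|N. (LINT x|N. S x y *\<^sub>R w y))"
      by (rule Fubini_bounded[OF N m(2) Sy])
    also have "\<dots> = (LINT y|N. - (sgn (f y) * Q y) *\<^sub>R w y)"
      by (subst anti) (simp add: i1)
    finally show ?thesis by simp
  qed
  have "(LINT x|N. (LINT y|N. S x y *\<^sub>R (w x - w y))) =
      (LINT x|N. (LINT y|N. S x y *\<^sub>R w x) - (LINT y|N. S x y *\<^sub>R w y))"
    by (simp add: scaleR_right_diff_distrib int1)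
  also have "\<dots> = (LINT x|N. (LINT y|N. S x y *\<^sub>R w x)) - (LINT x|N. (LINT y|N. S x y *\<^sub>R w y))"
    by (rule Bochner_Integration.integral_diff[OF int2])
  also have "\<dots> = 2 *\<^sub>R (LINT x|N. (sgn (f x) * Q x) *\<^sub>R w x)"
    unfolding i1 i2 by (simp add: scaleR_2)
  finally show ?thesis by (simp add: S_def Q_def)
qed

text \<open>The factor in front of K is x - y times \<open>conj_poisson\<close>. It is at most 1 and
  tends to 1 off the diagonal, and a measure with a density gives no mass to the point y =
  x.\<close>

lemma regularised_kernel_tendsto:
  fixes f :: "real \<Rightarrow> real" and K :: "real \<Rightarrow> real \<Rightarrow> 'b::{banach,second_countable_topology}"
  assumes f: "integrable lborel f" and e: "\<And>k. 0 < e k" "e \<longlonglongrightarrow> (0::real)"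
    and K[measurable]: "(\<lambda>(x, y). K x y) \<in> borel_measurable (borel \<Otimes>\<^sub>M borel)"
    and K_le: "\<And>x y. f x \<noteq> 0 \<Longrightarrow> f y \<noteq> 0 \<Longrightarrow> norm (K x y) \<le> C"
  defines "N \<equiv> density lborel (\<lambda>x. \<bar>f x\<bar>)"
  shows "(\<lambda>k. LINT x|N. (LINT y|N. (sgn (f x) * sgn (f y) * ((x - y)\<^sup>2 / ((x - y)\<^sup>2 + (e k)\<^sup>2))) *\<^sub>R K x y))
    \<longlonglongrightarrow> (LINT x|N. (LINT y|N. (sgn (f x) * sgn (f y)) *\<^sub>R K x y))"
proof -
  have [measurable]: "f \<in> borel_measurable borel" using borel_measurable_integrable[OF f] by simp
  have N: "finite_measure N" "sets N = sets borel"
    using finite_measure_density_integrable[of "\<lambda>x. \<bar>f x\<bar>"] f by (auto simp: N_def)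
  interpret N: finite_measure N by (rule N)
  note N(2)[measurable_cong]
  have [measurable]: "K x \<in> borel_measurable borel" for x
    using measurable_compose[OF measurable_Pair1' K, of x] by simp
  define S where "S k x y = (sgn (f x) * sgn (f y) * ((x - y)\<^sup>2 / ((x - y)\<^sup>2 + (e k)\<^sup>2))) *\<^sub>R K x y" for k x y
  have S_le: "norm (S k x y) \<le> max 0 C" for k x y
  proof (cases "f x \<noteq> 0 \<and> f y \<noteq> 0")
    case True
    have "(x - y)\<^sup>2 / ((x - y)\<^sup>2 + (e k)\<^sup>2) \<le> 1" "0 \<le> (x - y)\<^sup>2 / ((x - y)\<^sup>2 + (e k)\<^sup>2)"
      using e(1)[of k] by (auto simp: divide_simps add_nonneg_pos)
    then have "\<bar>(x - y)\<^sup>2 / ((x - y)\<^sup>2 + (e k)\<^sup>2)\<bar> * norm (K x y) \<le> 1 * C"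
      using K_le[of x y] True by (intro mult_mono) auto
    then show ?thesis using True by (auto simp: S_def abs_mult sgn_if)
  qed (auto simp: S_def)
  have AE_ne: "AE y in N. y \<noteq> x" for x
    unfolding N_def by (subst AE_density) (auto intro: AE_mp[OF AE_lborel_singleton[of x]])
  have S_tendsto: "(\<lambda>k. S k x y) \<longlonglongrightarrow> (sgn (f x) * sgn (f y)) *\<^sub>R K x y" if "y \<noteq> x" for x y
  proof -
    have "(\<lambda>k. S k x y) \<longlonglongrightarrow> (sgn (f x) * sgn (f y) * ((x - y)\<^sup>2 / ((x - y)\<^sup>2 + 0\<^sup>2))) *\<^sub>R K x y"
      unfolding S_def using that by (intro tendsto_intros e) auto
    then show ?thesis using that by simp
  qed
  have inner: "(\<lambda>k. LINT y|N. S k x y) \<longlonglongrightarrow> (LINT y|N. (sgn (f x) * sgn (f y)) *\<^sub>R K x y)" for x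
  proof (rule integral_dominated_convergence[where w="\<lambda>_. max 0 C"])
    show "AE y in N. (\<lambda>k. S k x y) \<longlonglongrightarrow> (sgn (f x) * sgn (f y)) *\<^sub>R K x y"
      using AE_ne[of x] by eventually_elim (rule S_tendsto)
    show "(\<lambda>y. S k x y) \<in> borel_measurable N" for k unfolding S_def by measurable
  qed (use S_le in auto)
  have "(\<lambda>k. LINT x|N. (LINT y|N. S k x y)) \<longlonglongrightarrow> (LINT x|N. (LINT y|N. (sgn (f x) * sgn (f y)) *\<^sub>R K x y))"
  proof (rule integral_dominated_convergence[where w="\<lambda>_. max 0 C * measure N (space N)"])
    show "AE x in N. (\<lambda>k. LINT y|N. S k x y) \<longlonglongrightarrow> (LINT y|N. (sgn (f x) * sgn (f y)) *\<^sub>R K x y)"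
      using inner by simp
    show "(\<lambda>x. LINT y|N. S k x y) \<in> borel_measurable N" for k unfolding S_def by measurable
    show "AE x in N. norm (LINT y|N. S k x y) \<le> max 0 C * measure N (space N)" for k
      by (intro AE_I2 norm_integral_le_const[OF N] S_le) (simp add: S_def)
  qed auto
  then show ?thesis by (simp add: S_def)
qed

text \<open>The principal value is given where f is nonzero, which is almost everywhere for N. The
  pointwise convergence there and the uniform L2 bound give convergence in L1, which can be tested
  against a bounded w.\<close>

lemma conj_poisson_weak_tendsto:
  fixes f h :: "real \<Rightarrow> real" and w :: "real \<Rightarrow> 'b::{banach,second_countable_topology}"
  assumes f: "continuous_on UNIV f" "\<And>x. \<bar>f x\<bar> \<le> M" "integrable lborel f"
    and e: "\<And>k. 0 < e k" "e \<longlonglongrightarrow> 0"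
    and pv: "\<And>x. f x \<noteq> 0 \<Longrightarrow> has_principal_value (\<lambda>y. f y / (x - y)) x (h x)"
    and h[measurable]: "h \<in> borel_measurable borel" and h_le: "\<And>x. f x \<noteq> 0 \<Longrightarrow> \<bar>h x\<bar> \<le> H"
    and w[measurable]: "w \<in> borel_measurable borel" and w_le: "\<And>x. f x \<noteq> 0 \<Longrightarrow> norm (w x) \<le> W"
  defines "N \<equiv> density lborel (\<lambda>x. \<bar>f x\<bar>)"
  shows "(\<lambda>k. LINT x|N. (sgn (f x) * (LBINT y. f y * conj_poisson (e k) (x - y))) *\<^sub>R w x)
    \<longlonglongrightarrow> (LINT x|N. (sgn (f x) * h x) *\<^sub>R w x)"
proof -
  have [measurable]: "f \<in> borel_measurable borel" using borel_measurable_integrable[OF f(3)] by simp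
  have N: "finite_measure N" "sets N = sets borel"
    using finite_measure_density_integrable[of "\<lambda>x. \<bar>f x\<bar>"] f by (auto simp: N_def)
  interpret N: finite_measure N by (rule N)
  note N(2)[measurable_cong]
  have AE_f: "AE x in N. f x \<noteq> 0"
    unfolding N_def by (subst AE_density) auto
  define Q where "Q k x = (LBINT y. f y * conj_poisson (e k) (x - y))" for k x
  have Q_meas[measurable]: "Q k \<in> borel_measurable borel" for k unfolding Q_def[abs_def] by measurable
  define G where "G k = (LBINT y. \<bar>f y\<bar>) / e k" for k
  have Q_le: "\<bar>Q k x\<bar> \<le> G k" for k x
    unfolding Q_def G_def by (rule conj_poisson_integral_le[OF f(3) e(1)])
  have H0: "AE x in N. \<bar>h x\<bar> \<le> max 0 H" using AE_f by eventually_elim (use h_le in force)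
  have Q2: "integrable N (\<lambda>x. (Q k x)\<^sup>2)" for k
    using power_mono[OF Q_le[of k] abs_ge_zero, of _ 2]
    by (intro N.integrable_const_bound[where B="(G k)\<^sup>2"] AE_I2) auto
  have h2: "integrable N (\<lambda>x. (h x)\<^sup>2)"
  proof (rule N.integrable_const_bound[where B="(max 0 H)\<^sup>2"])
    show "AE x in N. norm ((h x)\<^sup>2) \<le> (max 0 H)\<^sup>2"
      using H0
    proof eventually_elim
      case (elim x)
      from power_mono[OF elim abs_ge_zero, of 2] show ?case by simp
    qed
  qed measurable
  have sum2: "integrable N (\<lambda>x. 2 * (Q k x)\<^sup>2 + 2 * (h x)\<^sup>2)" for k
    by (intro Bochner_Integration.integrable_add integrable_mult_right Q2 h2)
  have Qh2: "integrable N (\<lambda>x. (Q k x - h x)\<^sup>2)" for k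
    by (rule Bochner_Integration.integrable_bound[where f="\<lambda>x. 2 * (Q k x)\<^sup>2 + 2 * (h x)\<^sup>2"])
      (auto intro!: sum2 AE_I2 simp: square_diff_le_2)
  have Qh: "integrable N (\<lambda>x. \<bar>Q k x - h x\<bar>)" for k
  proof (rule N.integrable_const_bound[where B="G k + max 0 H"])
    show "AE x in N. norm \<bar>Q k x - h x\<bar> \<le> G k + max 0 H"
      using H0
    proof eventually_elim
      case (elim x)
      then show ?case using Q_le[of k x] abs_triangle_ineq4[of "Q k x" "h x"] by simp
    qed
  qed measurable
  have sq: "(LINT x|N. (Q k x - h x)\<^sup>2) \<le> 2 * (9 * (M * pi)\<^sup>2 * (LBINT x. \<bar>f x\<bar>)) + 2 * (LINT x|N. (h x)\<^sup>2)" for k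
  proof -
    have "(LINT x|N. (Q k x - h x)\<^sup>2) \<le> (LINT x|N. 2 * (Q k x)\<^sup>2 + 2 * (h x)\<^sup>2)"
      by (rule integral_mono[OF Qh2]) (auto intro: sum2 simp: square_diff_le_2)
    also have "\<dots> = 2 * (LINT x|N. (Q k x)\<^sup>2) + 2 * (LINT x|N. (h x)\<^sup>2)" using Q2 h2 by simp
    also have "(LINT x|N. (Q k x)\<^sup>2) = (LBINT x. \<bar>f x\<bar> * (Q k x)\<^sup>2)"
      unfolding N_def by (subst integral_real_density) auto
    finally show ?thesis
      using abs_weighted_conj_poisson_square_le[OF f(3,2) e(1)[of k]] unfolding Q_def by linarith
  qed
  have lim: "AE x in N. (\<lambda>k. Q k x - h x) \<longlonglongrightarrow> 0"
    using AE_f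
  proof eventually_elim
    case (elim x)
    from principal_value_conj_poisson_tendsto[OF f e pv[OF elim]]
    show ?case unfolding Q_def by (simp add: LIM_zero_iff)
  qed
  have to0: "(\<lambda>k. LINT x|N. \<bar>Q k x - h x\<bar>) \<longlonglongrightarrow> 0"
    by (rule L2_bounded_integral_tendsto[OF N(1) _ lim Qh2 sq]) measurable
  have w_le': "AE x in N. norm (w x) \<le> max 0 W" using AE_f by eventually_elim (use w_le in force)
  have int: "integrable N (\<lambda>x. (sgn (f x) * Q k x) *\<^sub>R w x)" for k
  proof (rule N.integrable_const_bound[where B="G k * max 0 W"])
    show "AE x in N. norm ((sgn (f x) * Q k x) *\<^sub>R w x) \<le> G k * max 0 W"
      using w_le'
    proof eventually_elim
      case (elim x)
      have "\<bar>sgn (f x) * Q k x\<bar> \<le> G k" using Q_le[of k x] by (auto simp: abs_mult sgn_if)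
      then show ?case unfolding norm_scaleR by (intro mult_mono elim) auto
    qed
  qed measurable
  have inth: "integrable N (\<lambda>x. (sgn (f x) * h x) *\<^sub>R w x)"
  proof (rule N.integrable_const_bound[where B="max 0 H * max 0 W"])
    show "AE x in N. norm ((sgn (f x) * h x) *\<^sub>R w x) \<le> max 0 H * max 0 W"
      using w_le' H0
    proof eventually_elim
      case (elim x)
      have "\<bar>sgn (f x) * h x\<bar> \<le> max 0 H" using elim by (auto simp: abs_mult sgn_if)
      then show ?case unfolding norm_scaleR by (intro mult_mono elim) auto
    qed
  qed measurable
  have "(\<lambda>k. (LINT x|N. (sgn (f x) * Q k x) *\<^sub>R w x) - (LINT x|N. (sgn (f x) * h x) *\<^sub>R w x)) \<longlonglongrightarrow> 0"
  proof (rule Lim_null_comparison)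
    show "(\<lambda>k. max 0 W * (LINT x|N. \<bar>Q k x - h x\<bar>)) \<longlonglongrightarrow> 0"
      using tendsto_mult_right_zero[OF to0] by simp
    show "\<forall>\<^sub>F k in sequentially. norm ((LINT x|N. (sgn (f x) * Q k x) *\<^sub>R w x) - (LINT x|N. (sgn (f x) * h x) *\<^sub>R w x))
        \<le> max 0 W * (LINT x|N. \<bar>Q k x - h x\<bar>)"
    proof (rule always_eventually, rule allI)
      fix k
      have "norm ((LINT x|N. (sgn (f x) * Q k x) *\<^sub>R w x) - (LINT x|N. (sgn (f x) * h x) *\<^sub>R w x)) =
          norm (LINT x|N. (sgn (f x) * (Q k x - h x)) *\<^sub>R w x)"
        by (simp add: Bochner_Integration.integral_diff[OF int inth, symmetric] right_diff_distrib scaleR_left_diff_distrib)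
      also have "\<dots> \<le> (LINT x|N. norm ((sgn (f x) * (Q k x - h x)) *\<^sub>R w x))" by (rule integral_norm_bound)
      also have "\<dots> \<le> (LINT x|N. max 0 W * \<bar>Q k x - h x\<bar>)"
      proof (rule integral_mono_AE')
        show "AE x in N. norm ((sgn (f x) * (Q k x - h x)) *\<^sub>R w x) \<le> max 0 W * \<bar>Q k x - h x\<bar>"
          using w_le'
        proof eventually_elim
          case (elim x)
          have "\<bar>sgn (f x) * (Q k x - h x)\<bar> * norm (w x) \<le> \<bar>Q k x - h x\<bar> * max 0 W"
            by (intro mult_mono elim) (auto simp: abs_mult sgn_if)
          then show ?case unfolding norm_scaleR by (simp add: mult.commute)
        qed
      qed (use Qh in auto)
      finally show "norm ((LINT x|N. (sgn (f x) * Q k x) *\<^sub>R w x) - (LINT x|N. (sgn (f x) * h x) *\<^sub>R w x))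
        \<le> max 0 W * (LINT x|N. \<bar>Q k x - h x\<bar>)" by simp
    qed
  qed
  then show ?thesis by (simp add: Q_def LIM_zero_iff)
qed

text \<open>For the regularised kernel the identity is antisymmetry in \<open>x\<close> and \<open>y\<close>. Pointwise convergence, which is all
  that \<^const>\<open>has_principal_value\<close> gives, suffices in the limit because of the \<open>L\<^sup>2\<close> bound.\<close>

theorem principal_value_symmetrisation:
  fixes f h :: "real \<Rightarrow> real" and w :: "real \<Rightarrow> 'b::{banach,second_countable_topology}"
    and K :: "real \<Rightarrow> real \<Rightarrow> 'b"
  assumes f: "continuous_on UNIV f" "\<And>x. \<bar>f x\<bar> \<le> M" "integrable lborel f"
    and pv: "\<And>x. f x \<noteq> 0 \<Longrightarrow> has_principal_value (\<lambda>y. f y / (x - y)) x (h x)"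
    and h: "h \<in> borel_measurable borel" "\<And>x. f x \<noteq> 0 \<Longrightarrow> \<bar>h x\<bar> \<le> H"
    and w: "w \<in> borel_measurable borel" "\<And>x. f x \<noteq> 0 \<Longrightarrow> norm (w x) \<le> W"
    and K: "(\<lambda>(x, y). K x y) \<in> borel_measurable (borel \<Otimes>\<^sub>M borel)"
      "\<And>x y. f x \<noteq> 0 \<Longrightarrow> f y \<noteq> 0 \<Longrightarrow> norm (K x y) \<le> C"
    and eq: "\<And>x y. f x \<noteq> 0 \<Longrightarrow> f y \<noteq> 0 \<Longrightarrow> w x - w y = (x - y) *\<^sub>R K x y"
  shows "(LBINT x. f x *\<^sub>R (LBINT y. f y *\<^sub>R K x y)) = 2 *\<^sub>R (LBINT x. (f x * h x) *\<^sub>R w x)"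
proof -
  obtain e :: "nat \<Rightarrow> real" where e: "\<And>k. 0 < e k" "e \<longlonglongrightarrow> 0"
    using positive_null_sequence by blast
  define N where "N = density lborel (\<lambda>x. \<bar>f x\<bar>)"
  have [measurable]: "f \<in> borel_measurable borel" using borel_measurable_integrable[OF f(3)] by simp
  note [measurable] = h(1) w(1) K(1)
  have [measurable]: "K x \<in> borel_measurable borel" for x
    using measurable_compose[OF measurable_Pair1' K(1), of x] by simp
  have lhs: "(LINT x|N. (LINT y|N. (sgn (f x) * sgn (f y)) *\<^sub>R K x y)) =
      (LBINT x. f x *\<^sub>R (LBINT y. f y *\<^sub>R K x y))"
  proof -
    have "(LINT y|N. (sgn (f x) * sgn (f y)) *\<^sub>R K x y) = sgn (f x) *\<^sub>R (LBINT y. f y *\<^sub>R K x y)" for x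
    proof -
      have "(LINT y|N. (sgn (f x) * sgn (f y)) *\<^sub>R K x y) = sgn (f x) *\<^sub>R (LINT y|N. sgn (f y) *\<^sub>R K x y)"
        by (simp flip: scaleR_scaleR)
      also have "(LINT y|N. sgn (f y) *\<^sub>R K x y) = (LBINT y. f y *\<^sub>R K x y)"
        unfolding N_def by (subst integral_density) (auto simp: abs_mult_sgn)
      finally show ?thesis .
    qed
    then show ?thesis unfolding N_def by (subst integral_density) (auto simp: abs_mult_sgn)
  qed
  have rhs: "(LINT x|N. (sgn (f x) * h x) *\<^sub>R w x) = (LBINT x. (f x * h x) *\<^sub>R w x)"
    unfolding N_def by (subst integral_density) (auto simp: mult.assoc[symmetric] abs_mult_sgn)
  have step: "(LINT x|N. (LINT y|N. (sgn (f x) * sgn (f y) * ((x - y)\<^sup>2 / ((x - y)\<^sup>2 + (e k)\<^sup>2))) *\<^sub>R K x y)) =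
      2 *\<^sub>R (LINT x|N. (sgn (f x) * (LBINT y. f y * conj_poisson (e k) (x - y))) *\<^sub>R w x)" for k
  proof -
    \<comment> \<open>One factor x - y comes from \<open>eq\<close>; where f vanishes at x or y,
      both sides are 0.\<close>
    have "(sgn (f x) * sgn (f y) * ((x - y)\<^sup>2 / ((x - y)\<^sup>2 + (e k)\<^sup>2))) *\<^sub>R K x y =
        (sgn (f x) * sgn (f y) * conj_poisson (e k) (x - y)) *\<^sub>R (w x - w y)" for x y
      using eq[of x y] by (cases "f x = 0 \<or> f y = 0") (auto simp: conj_poisson_def power2_eq_square)
    then show ?thesis
      using regularised_difference_integral[OF f(3) e(1) w] unfolding N_def by simp
  qed
  have "(\<lambda>k. 2 *\<^sub>R (LINT x|N. (sgn (f x) * (LBINT y. f y * conj_poisson (e k) (x - y))) *\<^sub>R w x))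
      \<longlonglongrightarrow> 2 *\<^sub>R (LINT x|N. (sgn (f x) * h x) *\<^sub>R w x)"
    unfolding N_def by (intro tendsto_intros conj_poisson_weak_tendsto[OF f e pv h w])
  moreover have "(\<lambda>k. 2 *\<^sub>R (LINT x|N. (sgn (f x) * (LBINT y. f y * conj_poisson (e k) (x - y))) *\<^sub>R w x))
      \<longlonglongrightarrow> (LINT x|N. (LINT y|N. (sgn (f x) * sgn (f y)) *\<^sub>R K x y))"
    using regularised_kernel_tendsto[OF f(3) e K] unfolding N_def[symmetric] step .
  ultimately show ?thesis
    unfolding lhs rhs by (rule LIMSEQ_unique[symmetric])
qed

section \<open>The loop equation and the support\<close>

lemma compact_support_mult_integrable:
  fixes f :: "real \<Rightarrow> real" and g :: "real \<Rightarrow> 'b::{banach,second_countable_topology}"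
  assumes "continuous_on UNIV f" "compact (fun_support f)" "continuous_on (fun_support f) g"
  shows "integrable lborel (\<lambda>x. f x *\<^sub>R g x)"
proof -
  have "integrable lborel (\<lambda>x. indicator (fun_support f) x *\<^sub>R (f x *\<^sub>R g x))"
    using assms by (intro borel_integrable_compact continuous_intros) (auto intro: continuous_on_subset)
  also have "(\<lambda>x. indicator (fun_support f) x *\<^sub>R (f x *\<^sub>R g x)) = (\<lambda>x. f x *\<^sub>R g x)"
  proof
    fix x
    show "indicator (fun_support f) x *\<^sub>R (f x *\<^sub>R g x) = f x *\<^sub>R g x"
      using closure_subset[of "{x. f x \<noteq> 0}"] by (cases "f x = 0") (auto simp: fun_support_def)
  qed
  finally show ?thesis .
qed

lemma compact_support_integrable:
  fixes f :: "real \<Rightarrow> real"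
  assumes "continuous_on UNIV f" "compact (fun_support f)"
  shows "integrable lborel f"
  using compact_support_mult_integrable[OF assms, of "\<lambda>_. 1 :: real"] by simp

lemma compact_support_bounded:
  fixes f :: "real \<Rightarrow> real"
  assumes "continuous_on UNIV f" "compact (fun_support f)"
  shows "\<exists>M. \<forall>x. \<bar>f x\<bar> \<le> M"
proof -
  have "bounded (f ` fun_support f)"
    using assms by (intro compact_imp_bounded compact_continuous_image) (auto intro: continuous_on_subset)
  then obtain M where M: "\<And>x. x \<in> fun_support f \<Longrightarrow> \<bar>f x\<bar> \<le> M" by (auto simp: bounded_real)
  have "\<bar>f x\<bar> \<le> max 0 M" for x
    using M[of x] closure_subset[of "{x. f x \<noteq> 0}"] by (cases "f x = 0") (auto simp: fun_support_def)
  then show ?thesis by blast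
qed

lemma fun_supportI: "f x \<noteq> 0 \<Longrightarrow> x \<in> fun_support f"
  using closure_subset[of "{x. f x \<noteq> 0}"] by (auto simp: fun_support_def)

section \<open>The Cauchy transform and Tricomi's identity\<close>

definition cauchy_transform :: "(real \<Rightarrow> real) \<Rightarrow> complex \<Rightarrow> complex" where
  "cauchy_transform f z = (LBINT y. f y *\<^sub>R (1 / (z - of_real y)))"

lemma cauchy_kernel_measurable [measurable]:
  "(\<lambda>y. 1 / (z - complex_of_real y)) \<in> borel_measurable borel"
  by measurable

lemma cauchy_kernel_integrable:
  assumes f: "integrable lborel f" and \<delta>: "0 < \<delta>" "\<And>y. f y \<noteq> 0 \<Longrightarrow> \<delta> \<le> cmod (z - of_real y)"
  shows "integrable lborel (\<lambda>y. f y *\<^sub>R (1 / (z - complex_of_real y)))"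
proof (rule Bochner_Integration.integrable_bound)
  show "integrable lborel (\<lambda>y. \<bar>f y\<bar> / \<delta>)" using f by auto
  have [measurable]: "f \<in> borel_measurable borel" using borel_measurable_integrable[OF f] by simp
  show "(\<lambda>y. f y *\<^sub>R (1 / (z - complex_of_real y))) \<in> borel_measurable lborel" by measurable
  show "AE y in lborel. norm (f y *\<^sub>R (1 / (z - complex_of_real y))) \<le> norm (\<bar>f y\<bar> / \<delta>)"
  proof (rule AE_I2)
    fix y
    show "norm (f y *\<^sub>R (1 / (z - complex_of_real y))) \<le> norm (\<bar>f y\<bar> / \<delta>)"
    proof (cases "f y = 0")
      case False
      then have "1 / cmod (z - of_real y) \<le> 1 / \<delta>" using \<delta> by (intro divide_left_mono) (auto intro: mult_pos_pos less_le_trans)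
      from mult_left_mono[OF this abs_ge_zero[of "f y"]] show ?thesis
        using \<delta> by (simp add: norm_divide)
    qed auto
  qed
qed

text \<open>For w x = 1 / (z - x) the quotient (w x - w y) / (x - y) is the product w x w y, so the
  double integral of the symmetrisation factors into a square. The distance \<delta> is to the
  points where f is nonzero, not to the real axis: z may be a real point in a gap.\<close>

lemma cauchy_transform_square:
  assumes f: "continuous_on UNIV f" "compact (fun_support f)"
    and pv: "\<And>x. f x \<noteq> 0 \<Longrightarrow> has_principal_value (\<lambda>y. f y / (x - y)) x (h x)"
    and h: "continuous_on UNIV h"
    and \<delta>: "0 < \<delta>" "\<And>y. f y \<noteq> 0 \<Longrightarrow> \<delta> \<le> cmod (z - of_real y)"
  shows "(cauchy_transform f z)\<^sup>2 = 2 * (LBINT x. (f x * h x) *\<^sub>R (1 / (z - of_real x)))"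
proof -
  obtain M where M: "\<And>x. \<bar>f x\<bar> \<le> M" using compact_support_bounded[OF f] by blast
  have "bounded (h ` fun_support f)"
    using f h by (intro compact_imp_bounded compact_continuous_image) (auto intro: continuous_on_subset)
  then obtain H where H: "\<And>x. x \<in> fun_support f \<Longrightarrow> \<bar>h x\<bar> \<le> H" by (auto simp: bounded_real)
  have inv: "norm (1 / (z - complex_of_real y)) \<le> 1 / \<delta>" if "f y \<noteq> 0" for y
  proof -
    have "1 / cmod (z - of_real y) \<le> 1 / \<delta>"
      using \<delta>(1) \<delta>(2)[OF that] by (intro divide_left_mono) (auto intro: mult_pos_pos less_le_trans)
    then show ?thesis by (simp add: norm_divide)
  qed
  have ne: "z - complex_of_real y \<noteq> 0" if "f y \<noteq> 0" for y using \<delta>(1) \<delta>(2)[OF that] by auto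
  have "(LBINT x. f x *\<^sub>R (LBINT y. f y *\<^sub>R (1 / (z - of_real x) * (1 / (z - of_real y))))) =
      2 *\<^sub>R (LBINT x. (f x * h x) *\<^sub>R (1 / (z - of_real x)))"
  proof (rule principal_value_symmetrisation[OF f(1) M compact_support_integrable[OF f] pv])
    show "h \<in> borel_measurable borel" by (rule borel_measurable_continuous_onI[OF h])
    show "(\<lambda>(x, y). 1 / (z - complex_of_real x) * (1 / (z - complex_of_real y))) \<in> borel_measurable (borel \<Otimes>\<^sub>M borel)"
      by measurable
    show "norm (1 / (z - complex_of_real x) * (1 / (z - complex_of_real y))) \<le> 1 / \<delta> * (1 / \<delta>)"
      if "f x \<noteq> 0" "f y \<noteq> 0" for x y
      unfolding norm_mult using inv[OF that(1)] inv[OF that(2)] \<delta>(1) by (intro mult_mono) auto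
    show "1 / (z - complex_of_real x) - 1 / (z - complex_of_real y) =
        (x - y) *\<^sub>R (1 / (z - complex_of_real x) * (1 / (z - complex_of_real y)))"
      if "f x \<noteq> 0" "f y \<noteq> 0" for x y
      using ne[OF that(1)] ne[OF that(2)] by (simp add: field_simps scaleR_conv_of_real)
  qed (use H fun_supportI inv in auto)
  also have "(LBINT x. f x *\<^sub>R (LBINT y. f y *\<^sub>R (1 / (z - of_real x) * (1 / (z - of_real y))))) =
      (LBINT x. f x *\<^sub>R (1 / (z - of_real x)) * cauchy_transform f z)"
  proof -
    have "(LBINT y. f y *\<^sub>R (1 / (z - of_real x) * (1 / (z - of_real y)))) =
        1 / (z - of_real x) * cauchy_transform f z" for x
      unfolding cauchy_transform_def
      by (subst integral_mult_right_zero[symmetric]) (simp add: mult_scaleR_right)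
    then show ?thesis by simp
  qed
  also have "\<dots> = (cauchy_transform f z)\<^sup>2"
    by (subst integral_mult_left_zero) (simp add: cauchy_transform_def power2_eq_square)
  finally show ?thesis by (simp add: scaleR_conv_of_real)
qed

lemma Im_cauchy_transform:
  assumes f: "integrable lborel f" and e: "0 < e"
  shows "Im (cauchy_transform f (Complex x e)) = - (LBINT y. f y * poisson e (x - y))"
proof -
  have "e \<le> cmod (Complex x e - of_real y)" for y
    using abs_Im_le_cmod[of "Complex x e - of_real y"] e by simp
  then have "integrable lborel (\<lambda>y. f y *\<^sub>R (1 / (Complex x e - complex_of_real y)))"
    using e by (intro cauchy_kernel_integrable[OF f]) auto
  then have "Im (cauchy_transform f (Complex x e)) = (LBINT y. Im (f y *\<^sub>R (1 / (Complex x e - complex_of_real y))))"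
    unfolding cauchy_transform_def by (rule integral_Im[symmetric])
  also have "\<dots> = (LBINT y. - (f y * poisson e (x - y)))"
    by (rule Bochner_Integration.integral_cong) (auto simp: Im_divide poisson_def)
  finally show ?thesis by simp
qed

text \<open>A vanishing square leaves no choice of branch: the Cauchy transform is zero above the
  real axis, and its boundary values recover f. Continuity on the whole line is essential: 1 / sqrt
  (a^2 - x^2), cut off at |x| = a, has principal value 0 inside the interval.\<close>

lemma zero_principal_value_imp_zero:
  assumes f: "continuous_on UNIV f" "compact (fun_support f)"
    and pv: "\<And>x. f x \<noteq> 0 \<Longrightarrow> has_principal_value (\<lambda>y. f y / (x - y)) x 0"
  shows "f x = 0"
proof -
  obtain e :: "nat \<Rightarrow> real" where e: "\<And>k. 0 < e k" "e \<longlonglongrightarrow> 0"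
    using positive_null_sequence by blast
  obtain M where M: "\<And>x. \<bar>f x\<bar> \<le> M" using compact_support_bounded[OF f] by blast
  have "(LBINT y. f y * poisson (e k) (x - y)) = 0" for k
  proof -
    have "e k \<le> cmod (Complex x (e k) - of_real y)" for y
      using abs_Im_le_cmod[of "Complex x (e k) - of_real y"] by simp
    then have "(cauchy_transform f (Complex x (e k)))\<^sup>2 = 0"
      using cauchy_transform_square[OF f pv _ e(1)[of k], of "Complex x (e k)"] by simp
    then show ?thesis
      using Im_cauchy_transform[OF compact_support_integrable[OF f] e(1)[of k], of x] by simp
  qed
  then have "(\<lambda>k. 0) \<longlonglongrightarrow> pi * f x"
    using poisson_integral_tendsto[OF f(1) M e, of x] by simp
  then show ?thesis by (simp add: LIMSEQ_const_iff)
qed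

section \<open>Equilibrium densities: the spectral polynomial and the gaps of the support\<close>

locale equilibrium_density =
  fixes \<rho> :: "real \<Rightarrow> real" and \<mu> \<theta> :: real and n :: nat
  assumes n: "2 \<le> n" and \<theta>: "0 < \<theta>"
    and nonneg: "0 \<le> \<rho> x" and even: "\<rho> (- x) = \<rho> x"
    and cont: "continuous_on UNIV \<rho>" and compact: "compact (fun_support \<rho>)"
    and pv: "\<rho> x \<noteq> 0 \<Longrightarrow> has_principal_value (\<lambda>y. \<rho> y / (x - y)) x (\<mu> * x + \<theta> * x ^ (2 * n - 1))"
begin

definition resolvent_shift :: "complex \<Rightarrow> complex" where
  "resolvent_shift z = cauchy_transform \<rho> z - (of_real \<mu> * z + of_real \<theta> * z ^ (2 * n - 1))"

text \<open>For the force U, the bracket after the factor 2 is the integral of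
  \<open>\<rho> y\<close> (U z - U y) / (z - y), expanded in the moments of \<open>\<rho>\<close>.
  The type is generic because the loop equation needs complex arguments and the sign argument real
  ones.\<close>

definition spectral_polynomial :: "'a::real_normed_field \<Rightarrow> 'a" where
  "spectral_polynomial z = (of_real \<mu> * z + of_real \<theta> * z ^ (2 * n - 1))\<^sup>2 -
     2 * (of_real (\<mu> * (LBINT y. \<rho> y)) +
       of_real \<theta> * (\<Sum>i<2 * n - 1. of_real (LBINT y. \<rho> y * y ^ (2 * n - 1 - Suc i)) * z ^ i))"

lemma spectral_polynomial_of_real: "spectral_polynomial (of_real x) = of_real (spectral_polynomial x)"
  unfolding spectral_polynomial_def by simp

lemma continuous_on_spectral_polynomial: "continuous_on A spectral_polynomial"
  unfolding spectral_polynomial_def[abs_def] by (intro continuous_intros)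

lemma moment_integrable: "integrable lborel (\<lambda>y. \<rho> y * y ^ k)"
  using compact_support_mult_integrable[OF cont compact, of "\<lambda>y. y ^ k"] by (simp add: continuous_on_power)

text \<open>Writing U x / (z - x) as U z / (z - x) minus a divided difference turns Tricomi's
  identity into a quadratic equation for the Cauchy transform with polynomial coefficients; then the
  square is completed.\<close>

theorem loop_equation:
  assumes \<delta>: "0 < \<delta>" "\<And>y. \<rho> y \<noteq> 0 \<Longrightarrow> \<delta> \<le> cmod (z - of_real y)"
  shows "(resolvent_shift z)\<^sup>2 = spectral_polynomial z"
proof -
  define m where "m k = (LBINT y. \<rho> y * y ^ k)" for k
  define U where "U = of_real \<mu> * z + of_real \<theta> * z ^ (2 * n - 1)"
  define P where "P x = complex_of_real \<mu> + of_real \<theta> * (\<Sum>i<2 * n - 1. of_real (x ^ (2 * n - 1 - Suc i)) * z ^ i)" for x :: real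
  have "continuous_on UNIV (\<lambda>x. \<mu> * x + \<theta> * x ^ (2 * n - 1))" by (intro continuous_intros)
  from cauchy_transform_square[OF cont compact pv this \<delta>]
  have sq: "(cauchy_transform \<rho> z)\<^sup>2 = 2 * (LBINT x. (\<rho> x * (\<mu> * x + \<theta> * x ^ (2 * n - 1))) *\<^sub>R (1 / (z - of_real x)))" .
  have split: "(\<rho> x * (\<mu> * x + \<theta> * x ^ (2 * n - 1))) *\<^sub>R (1 / (z - of_real x)) =
      (\<rho> x *\<^sub>R (1 / (z - of_real x))) * U - \<rho> x *\<^sub>R P x" for x
  proof (cases "\<rho> x = 0")
    case False
    then have ne: "z - of_real x \<noteq> 0" using \<delta>(1) \<delta>(2)[of x] by auto
    have "z ^ (2 * n - 1) - of_real x ^ (2 * n - 1) =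
        (z - of_real x) * (\<Sum>i<2 * n - 1. of_real x ^ (2 * n - 1 - Suc i) * z ^ i)"
      by (rule power_diff_sumr2)
    moreover have "U - (of_real \<mu> * of_real x + of_real \<theta> * of_real x ^ (2 * n - 1)) =
        of_real \<mu> * (z - of_real x) + of_real \<theta> * (z ^ (2 * n - 1) - of_real x ^ (2 * n - 1))"
      unfolding U_def by (simp only: right_diff_distrib) simp
    ultimately have "U - (of_real \<mu> * of_real x + of_real \<theta> * of_real x ^ (2 * n - 1)) = (z - of_real x) * P x"
      unfolding P_def of_real_power by (simp only: distrib_left mult_ac)
    then have "of_real (\<mu> * x + \<theta> * x ^ (2 * n - 1)) = U - (z - of_real x) * P x"
      by (simp add: algebra_simps)
    then have "of_real (\<mu> * x + \<theta> * x ^ (2 * n - 1)) * (1 / (z - of_real x)) = 1 / (z - of_real x) * U - P x"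
      using ne by (simp add: field_simps)
    then show ?thesis
      unfolding scaleR_conv_of_real of_real_mult[of "\<rho> x"] mult.assoc by (simp add: right_diff_distrib)
  qed auto
  have Pint: "has_bochner_integral lborel (\<lambda>x. \<rho> x *\<^sub>R P x)
      (of_real \<mu> * of_real (m 0) + of_real \<theta> * (\<Sum>i<2 * n - 1. of_real (m (2 * n - 1 - Suc i)) * z ^ i))"
  proof -
    have mk: "has_bochner_integral lborel (\<lambda>x. complex_of_real (\<rho> x * x ^ k)) (of_real (m k))" for k
      unfolding m_def by (intro has_bochner_integral_of_real has_bochner_integral_integrable moment_integrable)
    have "has_bochner_integral lborel (\<lambda>x. of_real \<mu> * complex_of_real (\<rho> x * x ^ 0) +
        of_real \<theta> * (\<Sum>i<2 * n - 1. of_real (\<rho> x * x ^ (2 * n - 1 - Suc i)) * z ^ i))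
      (of_real \<mu> * of_real (m 0) + of_real \<theta> * (\<Sum>i<2 * n - 1. of_real (m (2 * n - 1 - Suc i)) * z ^ i))"
      by (intro has_bochner_integral_add has_bochner_integral_mult_right has_bochner_integral_sum
          has_bochner_integral_mult_left mk)
    moreover have "(\<lambda>x. of_real \<mu> * complex_of_real (\<rho> x * x ^ 0) +
        of_real \<theta> * (\<Sum>i<2 * n - 1. of_real (\<rho> x * x ^ (2 * n - 1 - Suc i)) * z ^ i)) = (\<lambda>x. \<rho> x *\<^sub>R P x)"
      by (simp add: P_def scaleR_conv_of_real algebra_simps sum_distrib_left)
    ultimately show ?thesis by simp
  qed
  have Gint: "integrable lborel (\<lambda>x. \<rho> x *\<^sub>R (1 / (z - complex_of_real x)))"
    by (rule cauchy_kernel_integrable[OF compact_support_integrable[OF cont compact] \<delta>])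
  have "(LBINT x. (\<rho> x * (\<mu> * x + \<theta> * x ^ (2 * n - 1))) *\<^sub>R (1 / (z - of_real x))) =
      cauchy_transform \<rho> z * U - (LBINT x. \<rho> x *\<^sub>R P x)"
    using Bochner_Integration.integral_diff[OF integrable_mult_left[OF Gint, of U]
        integrable.intros[OF Pint]]
    unfolding split cauchy_transform_def by (simp only: integral_mult_left_zero)
  then have "(cauchy_transform \<rho> z)\<^sup>2 = 2 * (cauchy_transform \<rho> z * U -
      (of_real \<mu> * of_real (m 0) + of_real \<theta> * (\<Sum>i<2 * n - 1. of_real (m (2 * n - 1 - Suc i)) * z ^ i)))"
    using sq Pint by (simp add: has_bochner_integral_iff)
  then show ?thesis
    unfolding resolvent_shift_def spectral_polynomial_def U_def[symmetric]
    by (simp add: m_def power2_diff algebra_simps)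
qed

text \<open>The sequences are the real and imaginary parts of \<open>resolvent_shift\<close> at
  points approaching x from above. A limit of the real part would amount to a principal value at x,
  which is not given where \<open>\<rho>\<close> vanishes; the limits of the two parts of the square
  take its place.\<close>

lemma boundary_limits:
  obtains a b :: "nat \<Rightarrow> real" where
    "b \<longlonglongrightarrow> - pi * \<rho> x" "(\<lambda>k. (a k)\<^sup>2 - (b k)\<^sup>2) \<longlonglongrightarrow> spectral_polynomial x" "(\<lambda>k. a k * b k) \<longlonglongrightarrow> 0"
proof -
  obtain e :: "nat \<Rightarrow> real" where e: "\<And>k. 0 < e k" "e \<longlonglongrightarrow> 0"
    using positive_null_sequence by blast
  define z where "z k = Complex x (e k)" for k
  have z: "z \<longlonglongrightarrow> of_real x"
    unfolding z_def[abs_def] complex_of_real_def by (intro tendsto_Complex tendsto_const e)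
  define a b where "a k = Re (resolvent_shift (z k))" and "b k = Im (resolvent_shift (z k))" for k
  have "(\<lambda>k. spectral_polynomial (z k)) \<longlonglongrightarrow> spectral_polynomial (complex_of_real x)"
    using continuous_on_spectral_polynomial[of UNIV] z
    by (intro isCont_tendsto_compose[of _ spectral_polynomial]) (auto simp: continuous_on_eq_continuous_at)
  moreover have "spectral_polynomial (z k) = (resolvent_shift (z k))\<^sup>2" for k
  proof (rule loop_equation[symmetric, OF e(1)])
    show "e k \<le> cmod (z k - of_real y)" for y
      using abs_Im_le_cmod[of "z k - of_real y"] by (simp add: z_def)
  qed
  ultimately have R: "(\<lambda>k. (resolvent_shift (z k))\<^sup>2) \<longlonglongrightarrow> of_real (spectral_polynomial x)"
    by (simp add: spectral_polynomial_of_real)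
  have "(\<lambda>k. (a k)\<^sup>2 - (b k)\<^sup>2) \<longlonglongrightarrow> spectral_polynomial x"
    using tendsto_Re[OF R] by (simp add: a_def b_def Re_power2)
  moreover have "(\<lambda>k. a k * b k) \<longlonglongrightarrow> 0"
    using tendsto_mult_left[OF tendsto_Im[OF R], of "1/2"] by (simp add: a_def b_def Im_power2)
  moreover have "b \<longlonglongrightarrow> - pi * \<rho> x"
  proof -
    obtain M where M: "\<And>x. \<bar>\<rho> x\<bar> \<le> M" using compact_support_bounded[OF cont compact] by blast
    have "(\<lambda>k. Im (of_real \<mu> * z k + of_real \<theta> * z k ^ (2 * n - 1))) \<longlonglongrightarrow>
        Im (of_real \<mu> * of_real x + of_real \<theta> * of_real x ^ (2 * n - 1))"
      by (intro tendsto_intros z)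
    from tendsto_diff[OF tendsto_minus[OF poisson_integral_tendsto[OF cont M e, of x]] this]
    show ?thesis
      by (simp add: b_def[abs_def] resolvent_shift_def z_def Im_cauchy_transform e
          compact_support_integrable[OF cont compact] flip: of_real_power of_real_mult of_real_add)
  qed
  ultimately show ?thesis by (rule that[rotated])
qed

lemma spectral_polynomial_nonneg:
  assumes "\<rho> x = 0" shows "0 \<le> (spectral_polynomial x :: real)"
proof -
  obtain a b :: "nat \<Rightarrow> real" where
    b: "b \<longlonglongrightarrow> - pi * \<rho> x" and ab: "(\<lambda>k. (a k)\<^sup>2 - (b k)\<^sup>2) \<longlonglongrightarrow> spectral_polynomial x"
    by (rule boundary_limits)
  from tendsto_add[OF ab tendsto_power[OF b, of 2]] assms
  have "(\<lambda>k. (a k)\<^sup>2) \<longlonglongrightarrow> spectral_polynomial x" by simp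
  then show ?thesis by (rule LIMSEQ_le_const) auto
qed

text \<open>Where the imaginary part has a nonzero limit, the vanishing product forces the real part
  to 0, and the value is exactly -(pi \<open>\<rho> x\<close>)^2.\<close>

lemma spectral_polynomial_nonpos:
  assumes "\<rho> x \<noteq> 0" shows "(spectral_polynomial x :: real) \<le> 0"
proof -
  obtain a b :: "nat \<Rightarrow> real" where
    b: "b \<longlonglongrightarrow> - pi * \<rho> x" and sq: "(\<lambda>k. (a k)\<^sup>2 - (b k)\<^sup>2) \<longlonglongrightarrow> spectral_polynomial x"
    and ab: "(\<lambda>k. a k * b k) \<longlonglongrightarrow> 0"
    by (rule boundary_limits)
  have ne: "- pi * \<rho> x \<noteq> 0" using assms by simp
  from tendsto_divide[OF ab b ne] have "(\<lambda>k. a k * b k / b k) \<longlonglongrightarrow> 0" by simp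
  moreover have "\<forall>\<^sub>F k in sequentially. a k * b k / b k = a k"
    using tendsto_imp_eventually_ne[OF b ne] by eventually_elim simp
  ultimately have "a \<longlonglongrightarrow> 0" by (rule Lim_transform_eventually)
  then have "(\<lambda>k. (a k)\<^sup>2 - (b k)\<^sup>2) \<longlonglongrightarrow> 0\<^sup>2 - (- pi * \<rho> x)\<^sup>2"
    by (intro tendsto_intros b)
  with sq have "spectral_polynomial x = 0\<^sup>2 - (- pi * \<rho> x)\<^sup>2" by (rule LIMSEQ_unique)
  then show ?thesis by simp
qed

lemma spectral_polynomial_nonpos_support:
  assumes "x \<in> fun_support \<rho>" shows "(spectral_polynomial x :: real) \<le> 0"
proof -
  have "fun_support \<rho> \<subseteq> {x. spectral_polynomial x \<le> (0::real)}"
    unfolding fun_support_def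
    using continuous_on_spectral_polynomial[of UNIV] spectral_polynomial_nonpos
    by (intro closure_minimal) (auto intro!: closed_Collect_le continuous_on_const)
  then show ?thesis using assms by auto
qed

text \<open>In the variable \<open>x\<^sup>2\<close> the field of the potential increases while that of the charges decreases
  across a gap of the support. Both agree at the two ends of a gap, so there are no gaps on either
  side of the origin.\<close>

lemma no_gap:
  assumes s: "0 < s" "s < t" and zero: "\<And>x. s < x \<Longrightarrow> x < t \<Longrightarrow> \<rho> x = 0"
    and ends: "(spectral_polynomial s :: real) = 0" "(spectral_polynomial t :: real) = 0"
  shows False
proof -
  define k where "k x = (LBINT y. \<rho> y / (x\<^sup>2 - y\<^sup>2))" for x
  \<comment> \<open>\<open>h\<close> is (U - G) / x for the force U and the field G of the charges,
    since G x = x * k x by evenness. Hence x^2 (h x)^2 is the spectral polynomial inside the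
    gap.\<close>
  define h where "h x = \<mu> + \<theta> * x ^ (2 * n - 2) - k x" for x
  note int\<rho> = compact_support_integrable[OF cont compact]
  have sep: "(x - s) \<le> \<bar>x - y\<bar> \<or> (t - x) \<le> \<bar>x - y\<bar>" if "s < x" "x < t" "\<rho> y \<noteq> 0" for x y
    using zero[of y] that by force
  have kint: "integrable lborel (\<lambda>y. \<rho> y / (x - y))" "integrable lborel (\<lambda>y. \<rho> y / (x + y))"
     "g = x * k x"
    if x: "s < x" "x < t" and g: "g = (LBINT y. \<rho> y / (x - y))" for x g
  proof -
    define \<delta> where "\<delta> = min (x - s) (t - x)"
    have \<delta>: "0 < \<delta>" using x by (simp add: \<delta>_def)
    \<comment> \<open>The kernel is set to 0 away from the charges, where x - y may vanish, so that
      it is bounded on the whole line.\<close>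
    have le: "\<bar>if \<rho> y = 0 then 0 else 1 / (x - y)\<bar> \<le> 1 / \<delta>" for y
      using sep[OF x, of y] \<delta> by (auto simp: \<delta>_def abs_divide divide_simps)
    have [measurable]: "\<rho> \<in> borel_measurable borel" using borel_measurable_integrable[OF int\<rho>] by simp
    have "integrable lborel (\<lambda>y. \<rho> y * (if \<rho> y = 0 then 0 else 1 / (x - y)))"
      by (rule integrable_bounded_mult[OF int\<rho> _ le]) measurable
    also have "(\<lambda>y. \<rho> y * (if \<rho> y = 0 then 0 else 1 / (x - y))) = (\<lambda>y. \<rho> y / (x - y))" by auto
    finally show i1: "integrable lborel (\<lambda>y. \<rho> y / (x - y))" .
    show i2: "integrable lborel (\<lambda>y. \<rho> y / (x + y))"
      using lborel_integrable_real_affine[OF i1, of "-1" 0] by (simp add: even)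
    have "(LBINT y. \<rho> y / (x - y)) = (LBINT y. \<rho> y / (x + y))"
      using lborel_integral_real_affine[of "-1" "\<lambda>y. \<rho> y / (x - y)" 0] by (simp add: even)
    then have "2 * g = (LBINT y. \<rho> y / (x - y)) + (LBINT y. \<rho> y / (x + y))"
      using g by simp
    also have "\<dots> = (LBINT y. \<rho> y / (x - y) + \<rho> y / (x + y))"
      using i1 i2 by simp
    also have "\<dots> = (LBINT y. (2 * x) * (\<rho> y / (x\<^sup>2 - y\<^sup>2)))"
    proof (rule Bochner_Integration.integral_cong[OF refl])
      fix y
      show "\<rho> y / (x - y) + \<rho> y / (x + y) = 2 * x * (\<rho> y / (x\<^sup>2 - y\<^sup>2))"
      proof (cases "\<rho> y = 0")
        case False
        then have "x - y \<noteq> 0" "x - - y \<noteq> 0" using sep[OF x, of y] sep[OF x, of "- y"] x by (auto simp: even)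
        then have "x - y \<noteq> 0" "x + y \<noteq> 0" by auto
        moreover have "x\<^sup>2 - y\<^sup>2 = (x - y) * (x + y)" by (simp add: power2_eq_square algebra_simps)
        ultimately show ?thesis by (simp add: field_simps)
      qed auto
    qed
    also have "\<dots> = 2 * x * k x" unfolding k_def by (rule integral_mult_right_zero)
    finally show "g = x * k x" by simp
  qed
  have sq: "x\<^sup>2 * (h x)\<^sup>2 = spectral_polynomial x" if x: "s < x" "x < t" for x
  proof -
    have "(resolvent_shift (of_real x))\<^sup>2 = spectral_polynomial (of_real x :: complex)"
    proof (rule loop_equation)
      show "0 < min (x - s) (t - x)" using x by simp
      show "min (x - s) (t - x) \<le> cmod (of_real x - of_real y)" if "\<rho> y \<noteq> 0" for y
        using sep[OF x that] by (auto simp flip: of_real_diff)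
    qed
    moreover have "cauchy_transform \<rho> (of_real x) = of_real (LBINT y. \<rho> y / (x - y))"
      unfolding cauchy_transform_def integral_complex_of_real[symmetric]
      by (rule Bochner_Integration.integral_cong) (auto simp: scaleR_conv_of_real)
    ultimately have "(of_real (x * k x - (\<mu> * x + \<theta> * x ^ (2 * n - 1)))) \<^sup>2 = complex_of_real (spectral_polynomial x)"
      using kint(3)[OF x refl] by (simp add: resolvent_shift_def spectral_polynomial_of_real)
    then have "(x * k x - (\<mu> * x + \<theta> * x ^ (2 * n - 1)))\<^sup>2 = spectral_polynomial x"
      unfolding of_real_power[symmetric] of_real_eq_iff .
    moreover have "x ^ (2 * n - 1) = x * x ^ (2 * n - 2)"
      using n by (simp flip: power_Suc add: Suc_diff_Suc numeral_2_eq_2)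
    ultimately show ?thesis
      by (simp add: h_def power2_eq_square algebra_simps)
  qed
  have k_anti: "k y \<le> k x" if x: "s < x" "x < y" "y < t" for x y
    unfolding k_def
  proof (rule integral_mono)
    have *: "integrable lborel (\<lambda>w. \<rho> w / (x\<^sup>2 - w\<^sup>2))" if x: "s < x" "x < t" for x
    proof -
      have "\<rho> w / (x\<^sup>2 - w\<^sup>2) = (\<rho> w / (x - w) + \<rho> w / (x + w)) / (2 * x)" for w
      proof (cases "\<rho> w = 0")
        case False
        then have "x - w \<noteq> 0" "x - - w \<noteq> 0" using sep[OF x, of w] sep[OF x, of "- w"] x by (auto simp: even)
        then have ne: "x - w \<noteq> 0" "x + w \<noteq> 0" "x \<noteq> 0" using x s by auto
        then have "\<rho> w / (x - w) + \<rho> w / (x + w) = 2 * x * \<rho> w / ((x - w) * (x + w))"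
          by (simp add: add_frac_eq algebra_simps)
        moreover have "x\<^sup>2 - w\<^sup>2 = (x - w) * (x + w)" by (simp add: power2_eq_square algebra_simps)
        ultimately show ?thesis using ne by simp
      qed auto
      then show ?thesis using kint[OF x refl] by simp
    qed
    show "integrable lborel (\<lambda>w. \<rho> w / (y\<^sup>2 - w\<^sup>2))" "integrable lborel (\<lambda>w. \<rho> w / (x\<^sup>2 - w\<^sup>2))"
      using x by (auto intro!: *)
    fix w
    show "\<rho> w / (y\<^sup>2 - w\<^sup>2) \<le> \<rho> w / (x\<^sup>2 - w\<^sup>2)"
    proof (cases "\<rho> w = 0")
      case False
      \<comment> \<open>By evenness the mirror image of the gap is empty too, so w^2 lies on one
        side of both x^2 and y^2, and the two denominators have the same sign.\<close>
      have "\<bar>w\<bar> \<le> s \<or> t \<le> \<bar>w\<bar>"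
        using zero[of "\<bar>w\<bar>"] False even[of w] by (cases "w \<ge> 0") force+
      then have "(w\<^sup>2 < x\<^sup>2 \<and> w\<^sup>2 < y\<^sup>2) \<or> (x\<^sup>2 < w\<^sup>2 \<and> y\<^sup>2 < w\<^sup>2)"
        using x s power_strict_mono[of "\<bar>w\<bar>" x 2] power_strict_mono[of "\<bar>w\<bar>" y 2]
          power_strict_mono[of x "\<bar>w\<bar>" 2] power_strict_mono[of y "\<bar>w\<bar>" 2] by auto
      moreover have "x\<^sup>2 \<le> y\<^sup>2" using x s by (intro power_mono) auto
      ultimately show ?thesis
        using nonneg[of w] by (intro divide_left_mono) (auto simp: zero_less_mult_iff)
    qed auto
  qed
  have h_mono: "h x < h y" if x: "s < x" "x < y" "y < t" for x y
  proof -
    have "x ^ (2 * n - 2) < y ^ (2 * n - 2)" using x s n by (intro power_strict_mono) auto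
    then have "\<theta> * x ^ (2 * n - 2) < \<theta> * y ^ (2 * n - 2)" using \<theta> by simp
    then show ?thesis using k_anti[OF x] by (simp add: h_def)
  qed
  have R_cont: "isCont (spectral_polynomial :: real \<Rightarrow> real) x" for x
    using continuous_on_spectral_polynomial[of UNIV] by (auto simp: continuous_on_eq_continuous_at)
  \<comment> \<open>The limit is taken in the polynomial, which is continuous at the ends of the
    gap, where the integral \<open>k\<close> need not converge. A positive value of \<open>h\<close>
    only grows towards t; in \<open>neg\<close>, a negative one only decreases towards s.\<close>
  have pos: False if c: "s < c" "c < t" "0 < h c" for c
  proof -
    have "((spectral_polynomial :: real \<Rightarrow> real) \<longlongrightarrow> spectral_polynomial t) (at_left t)"
      using R_cont[of t] by (auto simp: isCont_def intro: tendsto_mono[OF at_le])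
    moreover have "\<forall>\<^sub>F x in at_left t. c\<^sup>2 * (h c)\<^sup>2 \<le> spectral_polynomial x"
      using eventually_at_left_real[OF c(2)]
    proof eventually_elim
      case (elim x)
      have "c\<^sup>2 * (h c)\<^sup>2 \<le> x\<^sup>2 * (h x)\<^sup>2"
        using h_mono[of c x] elim c s by (intro mult_mono power_mono) auto
      then show ?case using sq[of x] elim c by simp
    qed
    ultimately have "c\<^sup>2 * (h c)\<^sup>2 \<le> spectral_polynomial t" by (intro tendsto_lowerbound) auto
    moreover have "0 < c\<^sup>2 * (h c)\<^sup>2" using c s by simp
    ultimately show False using ends by simp
  qed
  have neg: False if c: "s < c" "c < t" "h c < 0" for c
  proof -
    have "((spectral_polynomial :: real \<Rightarrow> real) \<longlongrightarrow> spectral_polynomial s) (at_right s)"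
      using R_cont[of s] by (auto simp: isCont_def intro: tendsto_mono[OF at_le])
    moreover have "\<forall>\<^sub>F x in at_right s. s\<^sup>2 * (- h c)\<^sup>2 \<le> spectral_polynomial x"
      using eventually_at_right_real[OF c(1)]
    proof eventually_elim
      case (elim x)
      have "s\<^sup>2 * (- h c)\<^sup>2 \<le> x\<^sup>2 * (- h x)\<^sup>2"
        using h_mono[of x c] elim c s by (intro mult_mono power_mono) auto
      then show ?case using sq[of x] elim c by simp
    qed
    ultimately have "s\<^sup>2 * (- h c)\<^sup>2 \<le> spectral_polynomial s" by (intro tendsto_lowerbound) auto
    moreover have "0 < s\<^sup>2 * (- h c)\<^sup>2" using c s by simp
    ultimately show False using ends by simp
  qed
  obtain c where c: "s < c" "c < t" using dense[OF s(2)] by auto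
  obtain d where d: "c < d" "d < t" using dense[OF c(2)] by auto
  have "h c < h d" using h_mono c d by auto
  then have "h c < 0 \<or> 0 < h d" by linarith
  then show False using pos[of d] neg[of c] c d by auto
qed

text \<open>A missing point c is enlarged to the maximal gap around it, because the ends of that gap
  lie in the support and, by continuity, also among the zeros of \<open>\<rho>\<close>, where the
  two sign conditions meet.\<close>

lemma support_convex_right:
  assumes p: "p \<in> fun_support \<rho>" "0 < p" and q: "q \<in> fun_support \<rho>" and c: "p \<le> c" "c \<le> q"
  shows "c \<in> fun_support \<rho>"
proof (rule ccontr)
  let ?K = "fun_support \<rho>"
  assume c_notin: "c \<notin> ?K"
  have S: "compact (?K \<inter> {p..c})" "?K \<inter> {p..c} \<noteq> {}" and T: "compact (?K \<inter> {c..q})" "?K \<inter> {c..q} \<noteq> {}"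
    using p q c by (auto intro: compact_Int_closed[OF compact])
  from compact_attains_sup[OF S] obtain s where s: "s \<in> ?K \<inter> {p..c}" "\<And>x. x \<in> ?K \<inter> {p..c} \<Longrightarrow> x \<le> s" by blast
  from compact_attains_inf[OF T] obtain t where t: "t \<in> ?K \<inter> {c..q}" "\<And>x. x \<in> ?K \<inter> {c..q} \<Longrightarrow> t \<le> x" by blast
  have st: "0 < s" "s < c" "c < t" using s t p c_notin by (auto simp: less_le)
  have zero: "\<rho> x = 0" if "s < x" "x < t" for x
  proof (rule ccontr)
    assume "\<rho> x \<noteq> 0"
    then have "x \<in> ?K" by (rule fun_supportI)
    then show False using that s(1) t(1) s(2)[of x] t(2)[of x] by (cases "x \<le> c") auto
  qed
  have "\<rho> x = 0" if x: "x = s \<or> x = t" for x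
  proof (rule continuous_constant_on_closure[of "{s<..<t}" \<rho> 0])
    show "continuous_on (closure {s<..<t}) \<rho>" using cont by (auto intro: continuous_on_subset)
    show "x \<in> closure {s<..<t}" using st x by auto
  qed (use zero in auto)
  then have "(spectral_polynomial s :: real) = 0" "(spectral_polynomial t :: real) = 0"
    using spectral_polynomial_nonneg spectral_polynomial_nonpos_support s(1) t(1) by (auto intro!: antisym)
  then show False using no_gap[of s t] st zero by auto
qed

text \<open>With a and b the least and the greatest nonnegative point of the support, convexity on
  the right and symmetry leave only the points with |x| between a and b. The case a = 0 is separate
  because \<open>support_convex_right\<close> starts from a positive point.\<close>

lemma support_dichotomy:
  assumes "\<rho> x0 \<noteq> 0"
  shows "(\<exists>b>0. fun_support \<rho> = {-b..b}) \<or> (\<exists>a b. 0 < a \<and> a < b \<and> fun_support \<rho> = {-b..-a} \<union> {a..b})"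
proof -
  let ?K = "fun_support \<rho>" and ?O = "{x. \<rho> x \<noteq> 0}"
  have O: "open ?O" using cont by (intro open_Collect_neq) auto
  have sym: "- x \<in> ?K" if "x \<in> ?K" for x
  proof -
    have "?K \<subseteq> uminus -` ?K"
      unfolding fun_support_def
    proof (rule closure_minimal)
      show "?O \<subseteq> uminus -` closure ?O" by (auto intro!: subsetD[OF closure_subset] simp: even)
      show "closed (uminus -` closure ?O)" by (intro closed_vimage continuous_intros) auto
    qed
    then show ?thesis using that by auto
  qed
  have abs_K: "\<bar>x\<bar> \<in> ?K" if "x \<in> ?K" for x using that sym[OF that] by (simp add: abs_if)
  have K: "compact (?K \<inter> {0..})" "?K \<inter> {0..} \<noteq> {}"
    using abs_K[OF fun_supportI[of \<rho>, OF assms]] by (auto intro: compact_Int_closed[OF compact])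
  from compact_attains_inf[OF K] obtain a where a: "a \<in> ?K" "0 \<le> a" "\<And>x. x \<in> ?K \<Longrightarrow> 0 \<le> x \<Longrightarrow> a \<le> x" by auto
  from compact_attains_sup[OF K] obtain b where b: "b \<in> ?K" "0 \<le> b" "\<And>x. x \<in> ?K \<Longrightarrow> 0 \<le> x \<Longrightarrow> x \<le> b" by auto
  have ab_le: "a \<le> b" using a b by auto
  have ab: "a < b"
  proof (rule ccontr)
    assume "\<not> a < b"
    then have "?K \<subseteq> {-a, a}" using ab_le a(3)[OF abs_K] b(3)[OF abs_K] by (force simp: abs_if split: if_splits)
    then have "?O \<subseteq> {-a, a}" using closure_subset[of ?O] unfolding fun_support_def by blast
    then have "finite ?O" by (rule finite_subset) auto
    then have "?O = {}" using O by (rule finite_imp_not_open)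
    then show False using assms by auto
  qed
  have K_iff: "x \<in> ?K \<longleftrightarrow> \<bar>x\<bar> \<in> ?K" for x using abs_K[of x] sym[of "\<bar>x\<bar>"] by (auto simp: abs_if split: if_splits)
  show ?thesis
  proof (cases "a = 0")
    case False
    then have "0 < a" using a by simp
    have iff: "x \<in> ?K \<longleftrightarrow> a \<le> \<bar>x\<bar> \<and> \<bar>x\<bar> \<le> b" for x
      using support_convex_right[OF a(1) \<open>0 < a\<close> b(1), of "\<bar>x\<bar>"] a(3)[of "\<bar>x\<bar>"] b(3)[of "\<bar>x\<bar>"] K_iff[of x] by auto
    have "?K = {-b..-a} \<union> {a..b}"
    proof (rule set_eqI)
      fix x
      show "x \<in> ?K \<longleftrightarrow> x \<in> {-b..-a} \<union> {a..b}"
        unfolding iff[of x] using \<open>0 < a\<close> by (cases "0 \<le> x") auto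
    qed
    then show ?thesis using \<open>0 < a\<close> ab by blast
  next
    case True
    have in_K: "c \<in> ?K" if c: "0 < c" "c \<le> b" for c
    proof -
      have "0 \<in> closure ?O" using a(1) True by (simp add: fun_support_def)
      then have "?O \<inter> ball 0 c \<noteq> {}"
        using c closure_iff_nhds_not_empty[of 0 ?O] by (auto simp: Int_commute dest!: spec[of _ "ball 0 c"])
      \<comment> \<open>An open set that meets the ball meets it in a point other than 0, from which
        the convexity argument can start.\<close>
      then have "infinite (?O \<inter> ball 0 c)"
        using finite_imp_not_open[OF _ open_Int[OF O open_ball]] by blast
      then have "\<not> ?O \<inter> ball 0 c \<subseteq> {0}" by (meson finite.emptyI finite.insertI finite_subset)
      then obtain y where "y \<in> ?O \<inter> ball 0 c" "y \<notin> {0}" by blast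
      then have y: "\<rho> y \<noteq> 0" "\<bar>y\<bar> < c" "y \<noteq> 0" by auto
      show ?thesis
        by (rule support_convex_right[OF abs_K[OF fun_supportI[of \<rho>, OF y(1)]] _ b(1)]) (use y c in auto)
    qed
    have iff: "x \<in> ?K \<longleftrightarrow> \<bar>x\<bar> \<le> b" for x
    proof (cases "x = 0")
      case False
      then show ?thesis using in_K[of "\<bar>x\<bar>"] b(3)[of "\<bar>x\<bar>"] K_iff[of x] by auto
    qed (use a(1) True b(2) in simp)
    have "?K = {-b..b}"
    proof (rule set_eqI)
      fix x
      show "x \<in> ?K \<longleftrightarrow> x \<in> {-b..b}" unfolding iff[of x] abs_le_iff by (auto simp: minus_le_iff)
    qed
    then show ?thesis using ab True by blast
  qed
qed

end

section \<open>Saddle point solutions as equilibrium densities\<close>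

lemma potential_force_eq:
  assumes "1 \<le> n"
  shows "\<mu> * x + (1 / T) / 2 * deriv (potential n v) x = \<mu> * x + real n * v / T * x ^ (2 * n - 1)"
proof -
  have "((\<lambda>x. v * x ^ (2 * n)) has_real_derivative v * (real (2 * n) * x ^ (2 * n - 1))) (at x)"
    by (auto intro!: derivative_eq_intros)
  then have "deriv (potential n v) x = v * (real (2 * n) * x ^ (2 * n - 1))"
    unfolding potential_def[abs_def] by (rule DERIV_imp_deriv)
  then show ?thesis by simp
qed

lemma nonzero_in_interior_support:
  fixes \<rho> :: "real \<Rightarrow> real"
  assumes "continuous_on UNIV \<rho>" "\<rho> x \<noteq> 0"
  shows "x \<in> interior (fun_support \<rho>)"
proof (rule interiorI[of "{x. \<rho> x \<noteq> 0}"])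
  show "open {x. \<rho> x \<noteq> 0}" using assms by (intro open_Collect_neq) auto
qed (use assms in \<open>auto intro: fun_supportI\<close>)

lemma continuous_saddle_point_cases:
  assumes n: "2 \<le> n" and v: "0 < v" and T: "0 < T"
    and sol: "saddle_point_solution n v T \<rho> \<mu>" and cont: "continuous_on UNIV \<rho>"
  shows "single_cut n v T \<rho> \<mu> \<or> two_cut n v T \<rho> \<mu>"
proof -
  interpret equilibrium_density \<rho> \<mu> "real n * v / T" n
  proof
    show "has_principal_value (\<lambda>y. \<rho> y / (x - y)) x (\<mu> * x + real n * v / T * x ^ (2 * n - 1))"
      if "\<rho> x \<noteq> 0" for x
      using sol nonzero_in_interior_support[OF cont that] potential_force_eq[of n \<mu> x T v] n
      unfolding saddle_point_solution_def by auto
  qed (use n v T sol cont in \<open>auto simp: saddle_point_solution_def\<close>)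
  have "\<not> (\<forall>x. \<rho> x = 0)"
  proof
    assume "\<forall>x. \<rho> x = 0"
    then have "\<rho> = (\<lambda>_. 0)" by auto
    then show False using sol by (auto simp: saddle_point_solution_def has_bochner_integral_iff)
  qed
  then show ?thesis
    using support_dichotomy sol cont unfolding single_cut_def two_cut_def by blast
qed

section \<open>Computing principal values\<close>

lemma set_integrable_truncated:
  fixes g :: "real \<Rightarrow> real"
  assumes g: "integrable lborel g" and \<epsilon>: "0 < \<epsilon>"
  shows "set_integrable lborel {y. \<epsilon> < \<bar>x - y\<bar>} (\<lambda>y. g y / (x - y))"
proof -
  have "integrable lborel (\<lambda>y. g y * (indicator {y. \<epsilon> < \<bar>x - y\<bar>} y / (x - y)))"
    using \<epsilon> by (intro integrable_bounded_mult[OF g, where C="1 / \<epsilon>"]) (auto simp: indicator_def divide_simps)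
  then show ?thesis by (simp add: set_integrable_def mult.commute)
qed

lemma has_principal_value_add:
  assumes "has_principal_value f x I" "has_principal_value g x J"
  shows "has_principal_value (\<lambda>y. f y + g y) x (I + J)"
  unfolding has_principal_value_def
proof (intro conjI allI impI)
  fix \<epsilon> :: real assume "0 < \<epsilon>"
  then show "set_integrable lborel {y. \<epsilon> < \<bar>x - y\<bar>} (\<lambda>y. f y + g y)"
    using assms unfolding has_principal_value_def by (auto intro: set_integral_add)
next
  have "((\<lambda>\<epsilon>. (LINT y:{y. \<epsilon> < \<bar>x - y\<bar>}|lborel. f y) + (LINT y:{y. \<epsilon> < \<bar>x - y\<bar>}|lborel. g y)) \<longlongrightarrow> I + J) (at_right 0)"
    using assms unfolding has_principal_value_def by (intro tendsto_add) auto
  moreover have "\<forall>\<^sub>F \<epsilon> in at_right 0. (LINT y:{y. \<epsilon> < \<bar>x - y\<bar>}|lborel. f y) + (LINT y:{y. \<epsilon> < \<bar>x - y\<bar>}|lborel. g y) =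
      (LINT y:{y. \<epsilon> < \<bar>x - y\<bar>}|lborel. f y + g y)"
    using assms unfolding has_principal_value_def
    by (intro eventually_at_rightI[of 0 1]) (auto simp: set_integral_add)
  ultimately show "((\<lambda>\<epsilon>. LINT y:{y. \<epsilon> < \<bar>x - y\<bar>}|lborel. f y + g y) \<longlongrightarrow> I + J) (at_right 0)"
    by (rule Lim_transform_eventually)
qed

lemma has_principal_value_cmult:
  assumes "has_principal_value f x I"
  shows "has_principal_value (\<lambda>y. c * f y) x (c * I)"
  using assms unfolding has_principal_value_def by (auto intro: tendsto_mult_left)

lemma has_principal_value_cong:
  assumes "has_principal_value f x I" and eq: "\<And>y. y \<noteq> x \<Longrightarrow> f y = g y"
  shows "has_principal_value g x I"
proof -
  have ind: "indicator {y. \<epsilon> < \<bar>x - y\<bar>} y *\<^sub>R f y = indicator {y. \<epsilon> < \<bar>x - y\<bar>} y *\<^sub>R g y" if "0 < \<epsilon>" for \<epsilon> y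
    using eq[of y] that by (auto simp: indicator_def)
  have "\<forall>\<^sub>F \<epsilon> in at_right 0. (LINT y:{y. \<epsilon> < \<bar>x - y\<bar>}|lborel. f y) = (LINT y:{y. \<epsilon> < \<bar>x - y\<bar>}|lborel. g y)"
    by (intro eventually_at_rightI[of 0 1]) (simp_all only: set_lebesgue_integral_def ind greaterThanLessThan_iff)
  moreover have "set_integrable lborel {y. \<epsilon> < \<bar>x - y\<bar>} g" if "0 < \<epsilon>" for \<epsilon>
  proof -
    have "set_integrable lborel {y. \<epsilon> < \<bar>x - y\<bar>} f"
      using assms(1) that unfolding has_principal_value_def by blast
    then show ?thesis unfolding set_integrable_def ind[OF that] .
  qed
  ultimately show ?thesis
    using assms(1) unfolding has_principal_value_def by (auto intro: Lim_transform_eventually)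
qed

lemma has_principal_value_integrable:
  assumes g: "integrable lborel g"
  shows "has_principal_value g x (LBINT y. g y)"
  unfolding has_principal_value_def
proof (intro conjI allI impI)
  have [measurable]: "g \<in> borel_measurable borel" using borel_measurable_integrable[OF g] by simp
  fix \<epsilon> :: real
  show "set_integrable lborel {y. \<epsilon> < \<bar>x - y\<bar>} g"
    unfolding set_integrable_def using g by (intro integrable_mult_indicator) auto
next
  have [measurable]: "g \<in> borel_measurable borel" using borel_measurable_integrable[OF g] by simp
  show "((\<lambda>\<epsilon>. LINT y:{y. \<epsilon> < \<bar>x - y\<bar>}|lborel. g y) \<longlongrightarrow> (LBINT y. g y)) (at_right 0)"
    unfolding tendsto_at_iff_sequentially
  proof (intro allI impI)
    fix e :: "nat \<Rightarrow> real" assume e: "\<forall>i. e i \<in> {0<..} - {0}" "e \<longlonglongrightarrow> 0"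
    have "(\<lambda>k. LBINT y. indicator {y. e k < \<bar>x - y\<bar>} y *\<^sub>R g y) \<longlonglongrightarrow> (LBINT y. g y)"
    proof (rule integral_dominated_convergence[where w="\<lambda>y. \<bar>g y\<bar>"])
      show "AE y in lborel. (\<lambda>k. indicator {y. e k < \<bar>x - y\<bar>} y *\<^sub>R g y) \<longlonglongrightarrow> g y"
        using AE_lborel_singleton[of x]
      proof eventually_elim
        case (elim y)
        have "\<forall>\<^sub>F k in sequentially. e k < \<bar>x - y\<bar>" using order_tendstoD(2)[OF e(2)] elim by auto
        then have "\<forall>\<^sub>F k in sequentially. g y = indicator {y. e k < \<bar>x - y\<bar>} y *\<^sub>R g y"
          by eventually_elim auto
        then show ?case by (rule Lim_transform_eventually[OF tendsto_const])
      qed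
    qed (use g in \<open>auto simp: indicator_def\<close>)
    then show "((\<lambda>\<epsilon>. LINT y:{y. \<epsilon> < \<bar>x - y\<bar>}|lborel. g y) \<circ> e) \<longlonglongrightarrow> (LBINT y. g y)"
      by (simp add: o_def set_lebesgue_integral_def)
  qed
qed

text \<open>From y^2 / (x - y) = x^2 / (x - y) - x - y, where the term in y integrates to 0 because
  F is even. This is the induction step for both families of polynomial densities below.\<close>

lemma has_principal_value_mult_square:
  assumes F: "continuous_on UNIV F" "compact (fun_support F)" "\<And>y. F (- y) = F y"
    and pv: "has_principal_value (\<lambda>y. F y / (x - y)) x I"
  shows "has_principal_value (\<lambda>y. y\<^sup>2 * F y / (x - y)) x (x\<^sup>2 * I - x * (LBINT y. F y))"
proof -
  have int: "integrable lborel F" "integrable lborel (\<lambda>y. F y * y)"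
    using compact_support_mult_integrable[OF F(1,2), of "\<lambda>y. y"] compact_support_integrable[OF F(1,2)]
    by (auto simp: continuous_on_id)
  have "(LBINT y. F y * y) = 0" by (rule integral_odd_eq_0) (simp add: F(3))
  then have "(LBINT y. - x * F y + - (F y * y)) = - x * (LBINT y. F y)"
    using int by simp
  moreover have "has_principal_value (\<lambda>y. - x * F y + - (F y * y)) x (LBINT y. - x * F y + - (F y * y))"
    by (rule has_principal_value_integrable) (use int in auto)
  ultimately have *: "has_principal_value (\<lambda>y. - x * F y + - (F y * y)) x (- x * (LBINT y. F y))" by simp
  have "has_principal_value (\<lambda>y. x\<^sup>2 * (F y / (x - y)) + (- x * F y + - (F y * y))) x
      (x\<^sup>2 * I + - x * (LBINT y. F y))"
    by (rule has_principal_value_add[OF has_principal_value_cmult[OF pv] *])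
  then have "has_principal_value (\<lambda>y. y\<^sup>2 * F y / (x - y)) x (x\<^sup>2 * I + - x * (LBINT y. F y))"
  proof (rule has_principal_value_cong)
    fix y assume "y \<noteq> x"
    then have "x - y \<noteq> 0" by simp
    then show "x\<^sup>2 * (F y / (x - y)) + (- x * F y + - (F y * y)) = y\<^sup>2 * F y / (x - y)"
      by (simp add: field_simps power2_eq_square)
  qed
  then show ?thesis by simp
qed

lemma has_principal_value_reflect:
  assumes F: "\<And>y. F (- y) = F y" and pv: "has_principal_value (\<lambda>y. F y / (x - y)) x I"
  shows "has_principal_value (\<lambda>y. F y / (- x - y)) (- x) (- I)"
proof -
  have ind: "indicator {y. \<epsilon> < \<bar>- x - y\<bar>} (- y) = (indicator {y. \<epsilon> < \<bar>x - y\<bar>} y :: real)" for \<epsilon> y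
    by (auto simp: indicator_def)
  have neg: "F y / (y - x) = - (F y / (x - y))" for y
    by (metis minus_diff_eq minus_divide_right)
  have int: "set_integrable lborel {y. \<epsilon> < \<bar>- x - y\<bar>} (\<lambda>y. F y / (- x - y)) \<longleftrightarrow>
      set_integrable lborel {y. \<epsilon> < \<bar>x - y\<bar>} (\<lambda>y. F y / (x - y))" for \<epsilon>
    unfolding set_integrable_def
    by (subst lborel_integrable_real_affine_iff[of "-1" _ 0, symmetric]) (simp_all add: ind F neg)
  have eq: "(LINT y:{y. \<epsilon> < \<bar>- x - y\<bar>}|lborel. F y / (- x - y)) = - (LINT y:{y. \<epsilon> < \<bar>x - y\<bar>}|lborel. F y / (x - y))" for \<epsilon>
    unfolding set_lebesgue_integral_def
    by (subst lborel_integral_real_affine[of "-1" _ 0]) (simp_all add: ind F neg)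
  show ?thesis using pv unfolding has_principal_value_def int eq by (auto intro: tendsto_minus)
qed

section \<open>Principal values through antiderivatives\<close>

lemma set_integral_FTC_interior:
  fixes L g :: "real \<Rightarrow> real"
  assumes "c \<le> d" "continuous_on {c..d} L" "continuous_on {c..d} g"
    and "\<And>y. c < y \<Longrightarrow> y < d \<Longrightarrow> (L has_real_derivative g y) (at y)"
  shows "(LINT y:{c..d}|lborel. g y) = L d - L c"
proof -
  have "(g has_integral (L d - L c)) {c..d}"
    using assms by (intro fundamental_theorem_of_calculus_interior)
      (auto simp: has_real_derivative_iff_has_vector_derivative)
  moreover have "(LINT y:{c..d}|lborel. g y) = integral {c..d} g"
    by (rule set_borel_integral_eq_integral) (rule borel_integrable_atLeastAtMost'[OF assms(3)])
  ultimately show ?thesis by (simp add: integral_unique)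
qed

text \<open>\<open>L\<close> may have a logarithmic singularity at x if it is asymptotically the
  same on both sides: the truncated integral is L b - L a plus the jump L (x - \<epsilon>) - L (x +
  \<epsilon>).\<close>

lemma has_principal_value_antiderivative:
  assumes x: "a < x" "x < b" and g: "integrable lborel g" "continuous_on {a..b} g"
    and zero: "\<And>y. y < a \<or> b < y \<Longrightarrow> g y = 0"
    and L: "continuous_on ({a..b} - {x}) L"
      "\<And>y. a < y \<Longrightarrow> y < b \<Longrightarrow> y \<noteq> x \<Longrightarrow> (L has_real_derivative g y / (x - y)) (at y)"
      "((\<lambda>\<epsilon>. L (x - \<epsilon>) - L (x + \<epsilon>)) \<longlongrightarrow> 0) (at_right 0)"
  shows "has_principal_value (\<lambda>y. g y / (x - y)) x (L b - L a)"
  unfolding has_principal_value_def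
proof (intro conjI allI impI)
  show "set_integrable lborel {y. \<epsilon> < \<bar>x - y\<bar>} (\<lambda>y. g y / (x - y))" if "0 < \<epsilon>" for \<epsilon>
    by (rule set_integrable_truncated[OF g(1) that])
  have [measurable]: "g \<in> borel_measurable borel" using borel_measurable_integrable[OF g(1)] by simp
  have "((\<lambda>\<epsilon>. (L b - L a) + (L (x - \<epsilon>) - L (x + \<epsilon>))) \<longlongrightarrow> (L b - L a) + 0) (at_right 0)"
    by (intro tendsto_intros L)
  moreover have "\<forall>\<^sub>F \<epsilon> in at_right 0. (L b - L a) + (L (x - \<epsilon>) - L (x + \<epsilon>)) =
      (LINT y:{y. \<epsilon> < \<bar>x - y\<bar>}|lborel. g y / (x - y))"
  proof (intro eventually_at_rightI[of 0 "min (x - a) (b - x)"])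
    fix \<epsilon> assume "\<epsilon> \<in> {0<..<min (x - a) (b - x)}"
    then have \<epsilon>: "0 < \<epsilon>" "a < x - \<epsilon>" "x + \<epsilon> < b" by auto
    have c1: "continuous_on {a..x - \<epsilon>} (\<lambda>y. g y / (x - y))" "continuous_on {x + \<epsilon>..b} (\<lambda>y. g y / (x - y))"
      using \<epsilon> by (auto intro!: continuous_intros intro: continuous_on_subset[OF g(2)])
    have i1: "(LINT y:{a..x - \<epsilon>}|lborel. g y / (x - y)) = L (x - \<epsilon>) - L a"
      using \<epsilon> x by (intro set_integral_FTC_interior c1 L) (auto intro: continuous_on_subset[OF L(1)])
    have i2: "(LINT y:{x + \<epsilon>..b}|lborel. g y / (x - y)) = L b - L (x + \<epsilon>)"
      using \<epsilon> x by (intro set_integral_FTC_interior c1 L) (auto intro: continuous_on_subset[OF L(1)])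
    have "(LINT y:{y. \<epsilon> < \<bar>x - y\<bar>}|lborel. g y / (x - y)) =
        (LBINT y. indicator {a..x - \<epsilon>} y *\<^sub>R (g y / (x - y)) + indicator {x + \<epsilon>..b} y *\<^sub>R (g y / (x - y)))"
      unfolding set_lebesgue_integral_def
    proof (rule integral_cong_AE)
      show "AE y in lborel. indicator {y. \<epsilon> < \<bar>x - y\<bar>} y *\<^sub>R (g y / (x - y)) =
          indicator {a..x - \<epsilon>} y *\<^sub>R (g y / (x - y)) + indicator {x + \<epsilon>..b} y *\<^sub>R (g y / (x - y))"
        using AE_lborel_singleton[of "x - \<epsilon>"] AE_lborel_singleton[of "x + \<epsilon>"]
      proof eventually_elim
        case (elim y)
        consider "y < a \<or> b < y" | "a \<le> y" "y < x - \<epsilon>" | "x - \<epsilon> < y" "y < x + \<epsilon>" | "x + \<epsilon> < y" "y \<le> b"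
          using elim by fastforce
        then show ?case using \<epsilon> zero[of y] by cases (auto simp: indicator_def)
      qed
    qed measurable
    also have "\<dots> = (LINT y:{a..x - \<epsilon>}|lborel. g y / (x - y)) + (LINT y:{x + \<epsilon>..b}|lborel. g y / (x - y))"
      unfolding set_lebesgue_integral_def
      using borel_integrable_atLeastAtMost'[OF c1(1)] borel_integrable_atLeastAtMost'[OF c1(2)]
      by (intro Bochner_Integration.integral_add) (auto simp: set_integrable_def)
    finally show "(L b - L a) + (L (x - \<epsilon>) - L (x + \<epsilon>)) = (LINT y:{y. \<epsilon> < \<bar>x - y\<bar>}|lborel. g y / (x - y))"
      by (simp add: i1 i2)
  qed (use x in auto)
  ultimately show "((\<lambda>\<epsilon>. LINT y:{y. \<epsilon> < \<bar>x - y\<bar>}|lborel. g y / (x - y)) \<longlongrightarrow> L b - L a) (at_right 0)"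
    by (auto intro: Lim_transform_eventually)
qed

text \<open>An antiderivative of sqrt (r^2 - u^2) / (\<sigma> - u), found by multiplying with the
  root and splitting r^2 - u^2 into (\<sigma> + u) (\<sigma> - u) and r^2 - \<sigma>^2. With the
  absolute value one formula holds on both sides of \<sigma>; the first logarithm is regular on the
  whole interval.\<close>

definition semicircle_primitive :: "real \<Rightarrow> real \<Rightarrow> real \<Rightarrow> real" where
  "semicircle_primitive r \<sigma> u = \<sigma> * arcsin (u / r) - sqrt (r\<^sup>2 - u\<^sup>2) +
     sqrt (r\<^sup>2 - \<sigma>\<^sup>2) * (ln (r\<^sup>2 - \<sigma> * u + sqrt (r\<^sup>2 - \<sigma>\<^sup>2) * sqrt (r\<^sup>2 - u\<^sup>2)) - ln \<bar>\<sigma> - u\<bar>)"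

context
  fixes r \<sigma> :: real
  assumes \<sigma>: "\<bar>\<sigma>\<bar> < r"
begin

lemma log_argument_pos:
  assumes "\<bar>u\<bar> \<le> r"
  shows "0 < r\<^sup>2 - \<sigma> * u + sqrt (r\<^sup>2 - \<sigma>\<^sup>2) * sqrt (r\<^sup>2 - u\<^sup>2)"
proof -
  have "u\<^sup>2 \<le> r\<^sup>2" "\<sigma>\<^sup>2 < r\<^sup>2"
    using power_mono[OF assms abs_ge_zero, of 2] power_strict_mono[OF \<sigma> abs_ge_zero, of 2] by simp_all
  then have "0 \<le> sqrt (r\<^sup>2 - \<sigma>\<^sup>2) * sqrt (r\<^sup>2 - u\<^sup>2)"
    by (intro mult_nonneg_nonneg real_sqrt_ge_zero) linarith+
  moreover have "\<sigma> * u < r\<^sup>2"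
  proof -
    have "\<sigma> * u \<le> \<bar>\<sigma>\<bar> * \<bar>u\<bar>" by (simp flip: abs_mult)
    also have "\<dots> \<le> \<bar>\<sigma>\<bar> * r" using assms by (intro mult_left_mono) auto
    also have "\<dots> < r * r" using \<sigma> by (intro mult_strict_right_mono) auto
    finally show ?thesis by (simp add: power2_eq_square)
  qed
  ultimately show ?thesis by linarith
qed

lemma semicircle_primitive_derivative:
  assumes u: "\<bar>u\<bar> < r" "u \<noteq> \<sigma>"
  shows "(semicircle_primitive r \<sigma> has_real_derivative sqrt (r\<^sup>2 - u\<^sup>2) / (\<sigma> - u)) (at u)"
proof -
  define w q D where "w = sqrt (r\<^sup>2 - u\<^sup>2)" and "q = sqrt (r\<^sup>2 - \<sigma>\<^sup>2)" and "D = r\<^sup>2 - \<sigma> * u + q * w"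
  have r: "0 < r" using \<sigma> by linarith
  have "u\<^sup>2 < r\<^sup>2" using power_strict_mono[of "\<bar>u\<bar>" r 2] u by simp
  have "\<sigma>\<^sup>2 < r\<^sup>2" using power_strict_mono[of "\<bar>\<sigma>\<bar>" r 2] \<sigma> by simp
  have w: "0 < w" "w\<^sup>2 = r\<^sup>2 - u\<^sup>2" and q: "0 < q" "q\<^sup>2 = r\<^sup>2 - \<sigma>\<^sup>2"
    using \<open>u\<^sup>2 < r\<^sup>2\<close> \<open>\<sigma>\<^sup>2 < r\<^sup>2\<close> by (auto simp: w_def q_def)
  have D: "0 < D" using log_argument_pos[of u] u by (simp add: D_def w_def q_def)
  have ne: "\<sigma> - u \<noteq> 0" using u by simp
  have d1: "((\<lambda>u. arcsin (u / r)) has_real_derivative 1 / w) (at u)"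
  proof -
    have "sqrt (1 - (u / r)\<^sup>2) = w / r"
    proof -
      have "1 - (u / r)\<^sup>2 = (r\<^sup>2 - u\<^sup>2) / r\<^sup>2" using r by (simp add: field_simps)
      then show ?thesis using r by (simp add: w_def real_sqrt_divide)
    qed
    then show ?thesis
      using u r w by (auto intro!: derivative_eq_intros simp: field_simps abs_less_iff)
  qed
  have d2: "((\<lambda>u. sqrt (r\<^sup>2 - u\<^sup>2)) has_real_derivative - u / w) (at u)"
    using \<open>u\<^sup>2 < r\<^sup>2\<close> by (auto intro!: derivative_eq_intros simp: w_def field_simps)
  have d3: "((\<lambda>u. ln (r\<^sup>2 - \<sigma> * u + q * sqrt (r\<^sup>2 - u\<^sup>2))) has_real_derivative (- \<sigma> + q * (- u / w)) / D) (at u)"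
  proof -
    have "((\<lambda>u. r\<^sup>2 - \<sigma> * u + q * sqrt (r\<^sup>2 - u\<^sup>2)) has_real_derivative 0 - \<sigma> * 1 + q * (- u / w)) (at u)"
      by (intro derivative_intros DERIV_cmult d2)
    from DERIV_chain2[OF DERIV_ln_divide this] D show ?thesis by (simp add: D_def w_def)
  qed
  have d4: "((\<lambda>u. ln \<bar>\<sigma> - u\<bar>) has_real_derivative - 1 / (\<sigma> - u)) (at u)"
  proof (cases "u < \<sigma>")
    case True
    have "((\<lambda>u. ln (\<sigma> - u)) has_real_derivative - 1 / (\<sigma> - u)) (at u)"
      using True by (auto intro!: derivative_eq_intros)
    moreover have "\<forall>\<^sub>F t in nhds u. ln (\<sigma> - t) = ln \<bar>\<sigma> - t\<bar>"
      using eventually_nhds_in_open[of "{..<\<sigma>}" u] True by (auto elim!: eventually_mono)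
    ultimately show ?thesis by (subst DERIV_cong_ev[OF refl _ refl, symmetric])
  next
    case False
    have "((\<lambda>u. ln (u - \<sigma>)) has_real_derivative - 1 / (\<sigma> - u)) (at u)"
      using False u by (auto intro!: derivative_eq_intros simp: field_simps)
    moreover have "\<forall>\<^sub>F t in nhds u. ln (t - \<sigma>) = ln \<bar>\<sigma> - t\<bar>"
      using eventually_nhds_in_open[of "{\<sigma><..}" u] False u by (auto elim!: eventually_mono)
    ultimately show ?thesis by (subst DERIV_cong_ev[OF refl _ refl, symmetric])
  qed
  have "(semicircle_primitive r \<sigma> has_real_derivative
      \<sigma> * (1 / w) - - u / w + q * ((- \<sigma> + q * (- u / w)) / D - - 1 / (\<sigma> - u))) (at u)"
    unfolding semicircle_primitive_def[abs_def] q_def[symmetric]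
    by (intro derivative_intros DERIV_cmult d1 d2 d3 d4)
  moreover have "\<sigma> * (1 / w) - - u / w + q * ((- \<sigma> + q * (- u / w)) / D - - 1 / (\<sigma> - u)) = w / (\<sigma> - u)"
  proof -
    \<comment> \<open>The argument D of the regular logarithm divides the combined numerator, so the
      two logarithms together differentiate to q / (w (\<sigma> - u)).\<close>
    have "w * D - (\<sigma> - u) * (\<sigma> * w + q * u) = w * (r\<^sup>2 - \<sigma>\<^sup>2) + q * (w\<^sup>2 + u\<^sup>2) - \<sigma> * q * u"
      by (simp add: D_def algebra_simps power2_eq_square)
    also have "\<dots> = q * D" unfolding q(2)[symmetric] w(2) by (simp add: D_def algebra_simps power2_eq_square)
    finally have *: "w * D - (\<sigma> - u) * (\<sigma> * w + q * u) = q * D" .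
    have "(- \<sigma> + q * (- u / w)) / D - - 1 / (\<sigma> - u) = (w * D - (\<sigma> - u) * (\<sigma> * w + q * u)) / (w * D * (\<sigma> - u))"
      using w(1) D ne by (simp add: divide_simps) (simp add: algebra_simps)
    also have "\<dots> = q / (w * (\<sigma> - u))" unfolding * using D by simp
    finally have "\<sigma> * (1 / w) - - u / w + q * ((- \<sigma> + q * (- u / w)) / D - - 1 / (\<sigma> - u)) =
        (\<sigma> + u) / w + q\<^sup>2 / (w * (\<sigma> - u))" by (simp add: power2_eq_square add_divide_distrib)
    also have "\<dots> = ((\<sigma> + u) * (\<sigma> - u) + q\<^sup>2) / (w * (\<sigma> - u))"
      using w(1) ne by (simp add: divide_simps)
    also have "(\<sigma> + u) * (\<sigma> - u) + q\<^sup>2 = w * w" using w(2) q(2) by (simp add: algebra_simps power2_eq_square)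
    finally show ?thesis using w(1) by simp
  qed
  ultimately show ?thesis by (simp add: w_def)
qed

lemma semicircle_primitive_regular_part:
  "continuous_on {-r..r} (\<lambda>u. \<sigma> * arcsin (u / r) - sqrt (r\<^sup>2 - u\<^sup>2) +
     sqrt (r\<^sup>2 - \<sigma>\<^sup>2) * ln (r\<^sup>2 - \<sigma> * u + sqrt (r\<^sup>2 - \<sigma>\<^sup>2) * sqrt (r\<^sup>2 - u\<^sup>2)))"
  using \<sigma> log_argument_pos by (intro continuous_intros) (auto simp: abs_le_iff divide_simps less_imp_neq[symmetric])

lemma semicircle_primitive_continuous: "continuous_on ({-r..r} - {\<sigma>}) (semicircle_primitive r \<sigma>)"
proof -
  have "continuous_on ({-r..r} - {\<sigma>}) (\<lambda>u. (\<sigma> * arcsin (u / r) - sqrt (r\<^sup>2 - u\<^sup>2) +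
     sqrt (r\<^sup>2 - \<sigma>\<^sup>2) * ln (r\<^sup>2 - \<sigma> * u + sqrt (r\<^sup>2 - \<sigma>\<^sup>2) * sqrt (r\<^sup>2 - u\<^sup>2))) - sqrt (r\<^sup>2 - \<sigma>\<^sup>2) * ln \<bar>\<sigma> - u\<bar>)"
    by (rule continuous_on_diff[OF continuous_on_subset[OF semicircle_primitive_regular_part]])
      (auto intro!: continuous_intros)
  then show ?thesis by (simp add: semicircle_primitive_def[abs_def] right_diff_distrib add_diff_eq)
qed

text \<open>At u = r and at u = -r the square root vanishes and the difference of the logarithms is
  ln r, so only the increment pi of the arcsine remains.\<close>

lemma semicircle_primitive_ends: "semicircle_primitive r \<sigma> r - semicircle_primitive r \<sigma> (- r) = pi * \<sigma>"
proof -
  have r: "0 < r" using \<sigma> by linarith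
  have "r\<^sup>2 - \<sigma> * r = r * (r - \<sigma>)" "r\<^sup>2 + \<sigma> * r = r * (r + \<sigma>)"
    by (simp_all add: power2_eq_square algebra_simps)
  then have "ln (r\<^sup>2 - \<sigma> * r) = ln r + ln (r - \<sigma>)" "ln (r\<^sup>2 + \<sigma> * r) = ln r + ln (r + \<sigma>)"
    using r \<sigma> by (simp_all add: ln_mult)
  moreover have "\<bar>\<sigma> - r\<bar> = r - \<sigma>" "\<bar>\<sigma> + r\<bar> = r + \<sigma>" using \<sigma> by auto
  ultimately show ?thesis using r by (simp add: semicircle_primitive_def arcsin_minus_1)
qed

text \<open>The two approaches need not be symmetric about \<sigma>: under the substitution u = y^2
  used for two cuts, x - \<epsilon> and x + \<epsilon> have images at different distances, with
  ratio tending to 1.\<close>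

lemma semicircle_primitive_jump:
  fixes \<alpha> \<beta> :: "real \<Rightarrow> real"
  assumes lim: "(\<alpha> \<longlongrightarrow> \<sigma>) F" "(\<beta> \<longlongrightarrow> \<sigma>) F"
    and ne: "\<forall>\<^sub>F e in F. \<alpha> e \<noteq> \<sigma>" "\<forall>\<^sub>F e in F. \<beta> e \<noteq> \<sigma>"
    and ratio: "((\<lambda>e. \<bar>\<sigma> - \<alpha> e\<bar> / \<bar>\<sigma> - \<beta> e\<bar>) \<longlongrightarrow> 1) F"
  shows "((\<lambda>e. semicircle_primitive r \<sigma> (\<alpha> e) - semicircle_primitive r \<sigma> (\<beta> e)) \<longlongrightarrow> 0) F"
proof -
  define c where "c u = \<sigma> * arcsin (u / r) - sqrt (r\<^sup>2 - u\<^sup>2) +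
     sqrt (r\<^sup>2 - \<sigma>\<^sup>2) * ln (r\<^sup>2 - \<sigma> * u + sqrt (r\<^sup>2 - \<sigma>\<^sup>2) * sqrt (r\<^sup>2 - u\<^sup>2))" for u
  have "isCont c \<sigma>"
    using semicircle_primitive_regular_part unfolding c_def[abs_def, symmetric]
    by (rule continuous_on_interior) (use \<sigma> in auto)
  then have "((\<lambda>e. c (\<alpha> e) - c (\<beta> e) - sqrt (r\<^sup>2 - \<sigma>\<^sup>2) * ln (\<bar>\<sigma> - \<alpha> e\<bar> / \<bar>\<sigma> - \<beta> e\<bar>)) \<longlongrightarrow>
      c \<sigma> - c \<sigma> - sqrt (r\<^sup>2 - \<sigma>\<^sup>2) * ln 1) F"
    by (intro tendsto_intros ratio isCont_tendsto_compose[of \<sigma> c] lim) auto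
  moreover have "\<forall>\<^sub>F e in F. c (\<alpha> e) - c (\<beta> e) - sqrt (r\<^sup>2 - \<sigma>\<^sup>2) * ln (\<bar>\<sigma> - \<alpha> e\<bar> / \<bar>\<sigma> - \<beta> e\<bar>) =
      semicircle_primitive r \<sigma> (\<alpha> e) - semicircle_primitive r \<sigma> (\<beta> e)"
    using ne
  proof eventually_elim
    case (elim e)
    then have "ln (\<bar>\<sigma> - \<alpha> e\<bar> / \<bar>\<sigma> - \<beta> e\<bar>) = ln \<bar>\<sigma> - \<alpha> e\<bar> - ln \<bar>\<sigma> - \<beta> e\<bar>"
      by (simp add: ln_div)
    then show ?case unfolding c_def semicircle_primitive_def by (simp only: right_diff_distrib)
  qed
  ultimately show ?thesis by (auto intro: Lim_transform_eventually)
qed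

end

section \<open>One-cut densities\<close>

definition semicircle :: "real \<Rightarrow> real \<Rightarrow> real" where
  "semicircle a y = sqrt (max 0 (a\<^sup>2 - y\<^sup>2))"

lemma continuous_semicircle: "continuous_on A (semicircle a)"
  unfolding semicircle_def[abs_def] by (intro continuous_intros)

lemma semicircle_minus: "semicircle a (- y) = semicircle a y"
  by (simp add: semicircle_def)

lemma semicircle_nonneg: "0 \<le> semicircle a y"
  by (simp add: semicircle_def)

lemma semicircle_eq:
  assumes "0 < a"
  shows "semicircle a y = indicator {-a..a} y * sqrt (a\<^sup>2 - y\<^sup>2)"
proof (cases "\<bar>y\<bar> \<le> a")
  case True
  then have "y\<^sup>2 \<le> a\<^sup>2" using power_mono[OF True abs_ge_zero, of 2] by simp
  then show ?thesis using True by (auto simp: semicircle_def indicator_def)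
next
  case False
  then have "a\<^sup>2 \<le> y\<^sup>2" using power_mono[of a "\<bar>y\<bar>" 2] assms by simp
  then show ?thesis using False by (auto simp: semicircle_def indicator_def)
qed

lemma semicircle_eq_0_iff:
  assumes "0 < a" shows "semicircle a y = 0 \<longleftrightarrow> a \<le> \<bar>y\<bar>"
  using assms abs_le_square_iff[of a y] by (auto simp: semicircle_def max_def)

lemma compact_fun_support:
  assumes "\<And>y. f y \<noteq> 0 \<Longrightarrow> \<bar>y\<bar> \<le> a"
  shows "compact (fun_support f)"
proof -
  have "bounded {x. f x \<noteq> 0}" using assms by (auto simp: bounded_real)
  then show ?thesis by (simp add: fun_support_def compact_closure)
qed

lemma principal_value_semicircle:
  assumes x: "\<bar>x\<bar> < a"
  shows "has_principal_value (\<lambda>y. semicircle a y / (x - y)) x (pi * x)"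
proof -
  have a: "0 < a" using x by linarith
  have "has_principal_value (\<lambda>y. semicircle a y / (x - y)) x (semicircle_primitive a x a - semicircle_primitive a x (- a))"
  proof (rule has_principal_value_antiderivative[where a="- a" and b=a and L="semicircle_primitive a x"])
    show "integrable lborel (semicircle a)"
      by (intro compact_support_integrable continuous_semicircle compact_fun_support[of _ a])
        (auto simp: semicircle_eq_0_iff[OF a])
    show "(semicircle_primitive a x has_real_derivative semicircle a y / (x - y)) (at y)"
      if "- a < y" "y < a" "y \<noteq> x" for y
      using semicircle_primitive_derivative[OF x, of y] that by (simp add: semicircle_eq[OF a] indicator_def)
    have "((\<lambda>\<epsilon>. x - \<epsilon>) \<longlongrightarrow> x - 0) (at_right 0)" "((\<lambda>\<epsilon>. x + \<epsilon>) \<longlongrightarrow> x + 0) (at_right 0)"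
      by (intro tendsto_intros)+
    moreover have "\<forall>\<^sub>F \<epsilon> in at_right 0. 1 = \<bar>x - (x - \<epsilon>)\<bar> / \<bar>x - (x + \<epsilon>)\<bar>"
      by (intro eventually_at_rightI[of 0 1]) auto
    then have "((\<lambda>\<epsilon>. \<bar>x - (x - \<epsilon>)\<bar> / \<bar>x - (x + \<epsilon>)\<bar>) \<longlongrightarrow> 1) (at_right 0)"
      by (rule Lim_transform_eventually[OF tendsto_const])
    ultimately show "((\<lambda>\<epsilon>. semicircle_primitive a x (x - \<epsilon>) - semicircle_primitive a x (x + \<epsilon>)) \<longlongrightarrow> 0) (at_right 0)"
      by (intro semicircle_primitive_jump[OF x]) (auto intro!: eventually_at_rightI[of 0 1])
  qed (use x in \<open>auto simp: semicircle_eq_0_iff[OF a] intro!: continuous_semicircle semicircle_primitive_continuous\<close>)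
  then show ?thesis by (simp add: semicircle_primitive_ends[OF x])
qed

text \<open>The moments of order 2 k of the arcsine law on [-1, 1], equal to binom(2 k, k) / 4^k;
  also the coefficients of (1 - t)^(-1/2).\<close>

primrec arcsine_moment :: "nat \<Rightarrow> real" where
  "arcsine_moment 0 = 1"
| "arcsine_moment (Suc k) = arcsine_moment k * (2 * real k + 1) / (2 * real k + 2)"

lemma arcsine_moment_pos: "0 < arcsine_moment k"
  by (induction k) auto

lemma arcsine_moment_Suc: "(real k + 1) * arcsine_moment (Suc k) = (real k + 1 / 2) * arcsine_moment k"
  by (simp add: field_simps)

lemma arcsine_moment_diff: "arcsine_moment k - arcsine_moment (Suc k) = arcsine_moment k / (2 * real k + 2)"
  by (simp add: field_simps)

text \<open>The square of the generating function (1 - t)^(-1/2) is 1 / (1 - t). The induction is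
  the differential equation of this square, read off coefficient by coefficient.\<close>

lemma arcsine_moment_convolution: "(\<Sum>k\<le>m. arcsine_moment k * arcsine_moment (m - k)) = 1"
proof (induction m)
  case (Suc m)
  let ?c = arcsine_moment
  define S where "S M = (\<Sum>k\<le>M. ?c k * ?c (M - k))" for M
  \<comment> \<open>The reflection of k to M - k shows that the weighted mean of the index is M /
    2.\<close>
  have half: "(\<Sum>k\<le>M. real k * (?c k * ?c (M - k))) = real M / 2 * S M" for M
  proof -
    have "(\<Sum>k\<le>M. real k * (?c k * ?c (M - k))) = (\<Sum>k\<le>M. real (M - k) * (?c k * ?c (M - k)))"
      by (rule sum.reindex_bij_witness[of _ "\<lambda>k. M - k" "\<lambda>k. M - k"]) auto
    then have "2 * (\<Sum>k\<le>M. real k * (?c k * ?c (M - k))) =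
        (\<Sum>k\<le>M. real k * (?c k * ?c (M - k)) + real (M - k) * (?c k * ?c (M - k)))"
      by (simp add: sum.distrib)
    also have "\<dots> = real M * S M"
      unfolding S_def sum_distrib_left by (rule sum.cong) (auto simp: of_nat_diff algebra_simps)
    finally show ?thesis by simp
  qed
  have "real (Suc m) / 2 * S (Suc m) = (\<Sum>k\<le>m. (real k + 1) * (?c (Suc k) * ?c (m - k)))"
    unfolding half[symmetric] by (subst sum.atMost_Suc_shift) (simp add: add.commute)
  also have "\<dots> = (\<Sum>k\<le>m. real k * (?c k * ?c (m - k)) + 1 / 2 * (?c k * ?c (m - k)))"
  proof (rule sum.cong[OF refl])
    fix k
    show "(real k + 1) * (?c (Suc k) * ?c (m - k)) = real k * (?c k * ?c (m - k)) + 1 / 2 * (?c k * ?c (m - k))"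
      unfolding mult.assoc[symmetric] arcsine_moment_Suc by (simp add: algebra_simps)
  qed
  also have "\<dots> = real (Suc m) / 2 * S m"
    unfolding sum.distrib half sum_distrib_left[symmetric] S_def[symmetric] by (simp add: field_simps)
  finally show ?case using Suc by (simp add: S_def)
qed auto

lemma semicircle_moment_integral:
  assumes a: "0 < a"
  shows "(LBINT y. semicircle a y * p y) = (LINT y:{-a..a}|lborel. sqrt (a\<^sup>2 - y\<^sup>2) * p y)"
  unfolding set_lebesgue_integral_def by (simp add: semicircle_eq[OF a] mult.assoc)

lemma sqrt_derivative:
  assumes "0 < a" "- a < y" "y < a"
  shows "((\<lambda>y. sqrt (a\<^sup>2 - y\<^sup>2)) has_real_derivative - y / sqrt (a\<^sup>2 - y\<^sup>2)) (at y)" "0 < a\<^sup>2 - y\<^sup>2"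
proof -
  have "y\<^sup>2 < a\<^sup>2" using power_strict_mono[of "\<bar>y\<bar>" a 2] assms by simp
  then show "0 < a\<^sup>2 - y\<^sup>2" by simp
  then show "((\<lambda>y. sqrt (a\<^sup>2 - y\<^sup>2)) has_real_derivative - y / sqrt (a\<^sup>2 - y\<^sup>2)) (at y)"
    by (auto intro!: derivative_eq_intros simp: field_simps)
qed

lemma semicircle_integrable:
  assumes "0 < a" "continuous_on UNIV p"
  shows "integrable lborel (\<lambda>y. semicircle a y * p y)"
  using compact_support_mult_integrable[of "semicircle a" p]
    compact_fun_support[of "semicircle a" a] continuous_semicircle continuous_on_subset[OF assms(2)]
  by (auto simp: semicircle_eq_0_iff[OF assms(1)])

text \<open>Up to the factor pi the semicircle is a^2 - y^2 times the arcsine density, hence the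
  difference of consecutive arcsine moments. The induction step integrates the derivative of y^(2 k
  + 1) (a^2 - y^2)^(3/2), which vanishes at both ends.\<close>

lemma semicircle_moment:
  assumes a: "0 < a"
  shows "(LBINT y. semicircle a y * y ^ (2 * k)) = pi * a ^ (2 * k + 2) * (arcsine_moment k - arcsine_moment (Suc k))"
proof (induction k)
  case 0
  have "(LINT y:{-a..a}|lborel. sqrt (a\<^sup>2 - y\<^sup>2)) =
      (a * sqrt (a\<^sup>2 - a\<^sup>2) + a\<^sup>2 * arcsin (a / a)) / 2 - ((- a) * sqrt (a\<^sup>2 - (- a)\<^sup>2) + a\<^sup>2 * arcsin ((- a) / a)) / 2"
  proof (rule set_integral_FTC_interior)
    show "continuous_on {- a..a} (\<lambda>y. (y * sqrt (a\<^sup>2 - y\<^sup>2) + a\<^sup>2 * arcsin (y / a)) / 2)"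
      using a by (intro continuous_intros) (auto simp: divide_simps)
    show "continuous_on {- a..a} (\<lambda>y. sqrt (a\<^sup>2 - y\<^sup>2))" by (intro continuous_intros)
    fix y assume y: "- a < y" "y < a"
    define w where "w = sqrt (a\<^sup>2 - y\<^sup>2)"
    have w: "0 < w" "w\<^sup>2 = a\<^sup>2 - y\<^sup>2" using sqrt_derivative(2)[OF a y] by (auto simp: w_def)
    have arc: "((\<lambda>u. arcsin (u / a)) has_real_derivative 1 / w) (at y)"
    proof -
      have "1 - (y / a)\<^sup>2 = (a\<^sup>2 - y\<^sup>2) / a\<^sup>2" using a by (simp add: field_simps)
      then have "sqrt (1 - (y / a)\<^sup>2) = w / a" using a by (simp add: w_def real_sqrt_divide)
      then show ?thesis
        using y a w by (auto intro!: derivative_eq_intros simp: field_simps)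
    qed
    have deriv: "((\<lambda>y. (y * sqrt (a\<^sup>2 - y\<^sup>2) + a\<^sup>2 * arcsin (y / a)) / 2) has_real_derivative
        (1 * sqrt (a\<^sup>2 - y\<^sup>2) + (- y / sqrt (a\<^sup>2 - y\<^sup>2)) * y + a\<^sup>2 * (1 / w)) / 2) (at y)"
      by (intro DERIV_cdivide DERIV_add DERIV_mult DERIV_ident DERIV_cmult arc sqrt_derivative[OF a y])
    have "(1 * w + (- y / w) * y + a\<^sup>2 * (1 / w)) / 2 = w"
    proof -
      have "- y / w * y + a\<^sup>2 * (1 / w) = (a\<^sup>2 - y\<^sup>2) / w" by (simp add: diff_divide_distrib power2_eq_square)
      also have "\<dots> = w" unfolding w(2)[symmetric] using w(1) by (simp add: power2_eq_square)
      finally show ?thesis by simp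
    qed
    then show "((\<lambda>y. (y * sqrt (a\<^sup>2 - y\<^sup>2) + a\<^sup>2 * arcsin (y / a)) / 2) has_real_derivative sqrt (a\<^sup>2 - y\<^sup>2)) (at y)"
      by (intro DERIV_cong[OF deriv]) (simp only: w_def)
  qed (use a in auto)
  then show ?case
    using a semicircle_moment_integral[OF a, of "\<lambda>_. 1"] by (simp add: arcsin_minus_1 field_simps power2_eq_square)
next
  case (Suc k)
  have "(LINT y:{-a..a}|lborel. sqrt (a\<^sup>2 - y\<^sup>2) * ((2 * real k + 1) * a\<^sup>2 * y ^ (2 * k) - (2 * real k + 4) * y ^ (2 * Suc k))) =
      a ^ (2 * k + 1) * ((a\<^sup>2 - a\<^sup>2) * sqrt (a\<^sup>2 - a\<^sup>2)) - (- a) ^ (2 * k + 1) * ((a\<^sup>2 - (- a)\<^sup>2) * sqrt (a\<^sup>2 - (- a)\<^sup>2))"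
  proof (rule set_integral_FTC_interior)
    fix y assume y: "- a < y" "y < a"
    define w where "w = sqrt (a\<^sup>2 - y\<^sup>2)"
    have w: "0 < w" "w\<^sup>2 = a\<^sup>2 - y\<^sup>2" using sqrt_derivative(2)[OF a y] by (auto simp: w_def)
    have "((\<lambda>y. y ^ (2 * k + 1) * ((a\<^sup>2 - y\<^sup>2) * sqrt (a\<^sup>2 - y\<^sup>2))) has_real_derivative
        (real (2 * k + 1) * (1 * y ^ (2 * k + 1 - Suc 0))) * ((a\<^sup>2 - y\<^sup>2) * sqrt (a\<^sup>2 - y\<^sup>2)) +
        ((0 - real 2 * (1 * y ^ (2 - Suc 0))) * sqrt (a\<^sup>2 - y\<^sup>2) + (- y / sqrt (a\<^sup>2 - y\<^sup>2)) * (a\<^sup>2 - y\<^sup>2)) * y ^ (2 * k + 1)) (at y)"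
      by (intro DERIV_mult DERIV_diff DERIV_const DERIV_power DERIV_ident sqrt_derivative[OF a y])
    moreover have "(real (2 * k + 1) * (1 * y ^ (2 * k + 1 - Suc 0))) * ((a\<^sup>2 - y\<^sup>2) * w) +
        ((0 - real 2 * (1 * y ^ (2 - Suc 0))) * w + (- y / w) * (a\<^sup>2 - y\<^sup>2)) * y ^ (2 * k + 1) =
      w * ((2 * real k + 1) * a\<^sup>2 * y ^ (2 * k) - (2 * real k + 4) * y ^ (2 * Suc k))"
    proof -
      have "(- y / w) * (a\<^sup>2 - y\<^sup>2) = - y * w"
        unfolding w(2)[symmetric] using w(1) by (simp add: power2_eq_square)
      then show ?thesis by (simp only:) (simp add: algebra_simps power2_eq_square)
    qed
    ultimately show "((\<lambda>y. y ^ (2 * k + 1) * ((a\<^sup>2 - y\<^sup>2) * sqrt (a\<^sup>2 - y\<^sup>2))) has_real_derivative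
        sqrt (a\<^sup>2 - y\<^sup>2) * ((2 * real k + 1) * a\<^sup>2 * y ^ (2 * k) - (2 * real k + 4) * y ^ (2 * Suc k))) (at y)"
      by (simp only: w_def)
  qed (use a in \<open>auto intro!: continuous_intros\<close>)
  then have "(LBINT y. semicircle a y * ((2 * real k + 1) * a\<^sup>2 * y ^ (2 * k) - (2 * real k + 4) * y ^ (2 * Suc k))) = 0"
    unfolding semicircle_moment_integral[OF a] by simp
  moreover have "(LBINT y. semicircle a y * ((2 * real k + 1) * a\<^sup>2 * y ^ (2 * k) - (2 * real k + 4) * y ^ (2 * Suc k))) =
      (LBINT y. (2 * real k + 1) * a\<^sup>2 * (semicircle a y * y ^ (2 * k)) - (2 * real k + 4) * (semicircle a y * y ^ (2 * Suc k)))"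
    by (simp add: algebra_simps)
  moreover have "\<dots> = (2 * real k + 1) * a\<^sup>2 * (LBINT y. semicircle a y * y ^ (2 * k)) -
      (2 * real k + 4) * (LBINT y. semicircle a y * y ^ (2 * Suc k))"
    by (subst Bochner_Integration.integral_diff)
      (auto simp del: power_Suc mult_Suc_right intro!: integrable_mult_right semicircle_integrable a continuous_intros)
  ultimately have "(2 * real k + 4) * (LBINT y. semicircle a y * y ^ (2 * Suc k)) =
      (2 * real k + 1) * a\<^sup>2 * (pi * a ^ (2 * k + 2) * (arcsine_moment k / (2 * real k + 2)))"
    using Suc.IH unfolding arcsine_moment_diff by simp
  also have "\<dots> = (2 * real k + 4) * (pi * a ^ (2 * Suc k + 2) * (arcsine_moment (Suc k) / (2 * real (Suc k) + 2)))"
  proof -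
    have "2 * real (Suc k) + 2 = 2 * real k + 4" "2 * real k + 4 \<noteq> 0" by simp_all
    then have "(2 * real k + 4) * (pi * a ^ (2 * Suc k + 2) * (arcsine_moment (Suc k) / (2 * real (Suc k) + 2))) =
        pi * a ^ (2 * Suc k + 2) * arcsine_moment (Suc k)" by (simp only:) simp
    then show ?thesis by (simp add: power2_eq_square)
  qed
  finally show ?case
    unfolding arcsine_moment_diff mult_cancel_left by (auto simp: add_eq_0_iff)
qed

text \<open>The polynomial part of \<open>x ^ (2 * n) / (x * sqrt (x\<^sup>2 - a\<^sup>2))\<close> at infinity, by Horner's scheme.\<close>

primrec cut_poly :: "real \<Rightarrow> nat \<Rightarrow> real \<Rightarrow> real" where
  "cut_poly a 0 x = 0"
| "cut_poly a (Suc n) x = x\<^sup>2 * cut_poly a n x + arcsine_moment n * a ^ (2 * n)"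

lemma continuous_cut_poly: "continuous_on A (cut_poly a n)"
  by (induction n) (auto intro!: continuous_intros)

lemma cut_poly_minus: "cut_poly a n (- x) = cut_poly a n x"
  by (induction n) auto

lemma cut_poly_nonneg: "0 < a \<Longrightarrow> 0 \<le> cut_poly a n x"
  by (induction n) (auto simp: arcsine_moment_pos less_imp_le)

text \<open>The coefficients are positive and for n at least 2 the power x^2 occurs, so the minimum
  at the origin is strict. Nonnegativity of a one-cut density is thereby a condition at the origin
  alone.\<close>

lemma cut_poly_gt_0:
  assumes "0 < a" "2 \<le> n" "x \<noteq> 0"
  shows "cut_poly a n 0 < cut_poly a n x"
proof -
  obtain m where n: "n = Suc (Suc m)" using assms(2) by (metis add_2_eq_Suc le_iff_add)
  have "0 < cut_poly a (Suc m) x"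
    using cut_poly_nonneg[OF assms(1), of m x] arcsine_moment_pos[of m] assms(1)
    by (auto intro!: add_nonneg_pos)
  then show ?thesis using assms(3) by (simp add: n del: cut_poly.simps add: cut_poly.simps(2)[of a "Suc m"])
qed

text \<open>Horner's step multiplies by x^2 and so raises the order of the moment; hence the
  induction over n with j arbitrary. The sums are differences of two convolutions.\<close>

lemma cut_poly_moment_sum:
  assumes a: "0 < a"
  shows "(LBINT y. semicircle a y * (cut_poly a n y * y ^ (2 * j))) =
    pi * a ^ (2 * n + 2 * j) * (\<Sum>k<n. arcsine_moment k * (arcsine_moment (j + n - Suc k) - arcsine_moment (j + n - k)))"
proof (induction n arbitrary: j)
  case (Suc n)
  have "(LBINT y. semicircle a y * (cut_poly a (Suc n) y * y ^ (2 * j))) =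
      (LBINT y. semicircle a y * (cut_poly a n y * y ^ (2 * Suc j)) +
        arcsine_moment n * a ^ (2 * n) * (semicircle a y * y ^ (2 * j)))"
    by (simp add: algebra_simps power2_eq_square)
  also have "\<dots> = (LBINT y. semicircle a y * (cut_poly a n y * y ^ (2 * Suc j))) +
      arcsine_moment n * a ^ (2 * n) * (LBINT y. semicircle a y * y ^ (2 * j))"
    by (subst Bochner_Integration.integral_add)
      (auto simp del: power_Suc mult_Suc_right intro!: integrable_mult_right semicircle_integrable a continuous_intros continuous_cut_poly)
  also have "\<dots> = pi * a ^ (2 * n + 2 * Suc j) * (\<Sum>k<n. arcsine_moment k * (arcsine_moment (Suc j + n - Suc k) - arcsine_moment (Suc j + n - k))) +
      arcsine_moment n * a ^ (2 * n) * (pi * a ^ (2 * j + 2) * (arcsine_moment j - arcsine_moment (Suc j)))"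
    unfolding Suc.IH semicircle_moment[OF a] ..
  also have "\<dots> = pi * a ^ (2 * Suc n + 2 * j) * (\<Sum>k<Suc n. arcsine_moment k * (arcsine_moment (j + Suc n - Suc k) - arcsine_moment (j + Suc n - k)))"
    by (simp del: arcsine_moment.simps add: distrib_left power_add mult_ac Suc_diff_le)
  finally show ?case .
qed auto

lemma arcsine_moment_convolution_less:
  "(\<Sum>k<n. arcsine_moment k * arcsine_moment (n - k)) = 1 - arcsine_moment n"
  using arcsine_moment_convolution[of n] by (simp add: lessThan_Suc_atMost[symmetric])

lemma cut_poly_moment_0:
  assumes a: "0 < a" and n: "1 \<le> n"
  shows "(LBINT y. semicircle a y * cut_poly a n y) = pi * a ^ (2 * n) * arcsine_moment n"
proof -
  obtain m where m: "n = Suc m" using n by (cases n) auto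
  have "(\<Sum>k<n. arcsine_moment k * arcsine_moment (n - Suc k)) = 1"
    using arcsine_moment_convolution[of m] by (simp add: m lessThan_Suc_atMost)
  then show ?thesis
    using cut_poly_moment_sum[OF a, of n 0] arcsine_moment_convolution_less[of n]
    by (simp add: right_diff_distrib sum_subtractf)
qed

lemma cut_poly_moment_2:
  assumes a: "0 < a"
  shows "(LBINT y. semicircle a y * (cut_poly a n y * y\<^sup>2)) =
    pi * a ^ (2 * n + 2) * (arcsine_moment (Suc n) - arcsine_moment n / 2)"
proof -
  \<comment> \<open>The convolution at n + 1 without its last two terms: index n + 1 contributes
    \<open>arcsine_moment (Suc n)\<close>, and index n contributes half of
    \<open>arcsine_moment n\<close>.\<close>
  have "(\<Sum>k<n. arcsine_moment k * arcsine_moment (Suc n - k)) = 1 - arcsine_moment (Suc n) - arcsine_moment n / 2"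
    using arcsine_moment_convolution_less[of "Suc n"] by (simp add: Suc_diff_le del: arcsine_moment.simps(2)) simp
  then show ?thesis
    using cut_poly_moment_sum[OF a, of n 1] arcsine_moment_convolution_less[of n]
    by (simp add: right_diff_distrib sum_subtractf del: arcsine_moment.simps)
qed

text \<open>This singles out the coefficients of \<open>cut_poly\<close>: multiplication by y^2
  costs x times the integral of the previous density, and the semicircle added with the next
  coefficient, whose field is pi x, restores it.\<close>

lemma principal_value_cut_poly:
  assumes x: "\<bar>x\<bar> < a"
  shows "has_principal_value (\<lambda>y. semicircle a y * cut_poly a (Suc n) y / (x - y)) x (pi * x ^ (2 * n + 1))"
proof (induction n)
  case 0
  then show ?case using principal_value_semicircle[OF x] by simp
next
  case (Suc n)
  have a: "0 < a" using x by linarith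
  let ?F = "\<lambda>y. semicircle a y * cut_poly a (Suc n) y" and ?c = "arcsine_moment (Suc n) * a ^ (2 * Suc n)"
  have "has_principal_value (\<lambda>y. y\<^sup>2 * ?F y / (x - y)) x (x\<^sup>2 * (pi * x ^ (2 * n + 1)) - x * (LBINT y. ?F y))"
  proof (rule has_principal_value_mult_square[OF _ _ _ Suc.IH])
    show "continuous_on UNIV ?F" by (intro continuous_intros continuous_semicircle continuous_cut_poly)
    show "compact (fun_support ?F)"
      by (rule compact_fun_support[of _ a]) (auto simp: semicircle_eq_0_iff[OF a])
    show "?F (- y) = ?F y" for y by (simp only: semicircle_minus cut_poly_minus)
  qed
  then have pv: "has_principal_value (\<lambda>y. y\<^sup>2 * ?F y / (x - y) + ?c * (semicircle a y / (x - y))) x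
      ((x\<^sup>2 * (pi * x ^ (2 * n + 1)) - x * (LBINT y. ?F y)) + ?c * (pi * x))"
    by (rule has_principal_value_add[OF _ has_principal_value_cmult[OF principal_value_semicircle[OF x]]])
  have fn: "(\<lambda>y. y\<^sup>2 * ?F y / (x - y) + ?c * (semicircle a y / (x - y))) =
      (\<lambda>y. semicircle a y * cut_poly a (Suc (Suc n)) y / (x - y))"
    unfolding cut_poly.simps(2)[of a "Suc n"]
    by (rule ext) (simp add: distrib_left add_divide_distrib mult_ac del: cut_poly.simps arcsine_moment.simps)
  have "(LBINT y. ?F y) = pi * a ^ (2 * Suc n) * arcsine_moment (Suc n)"
    by (rule cut_poly_moment_0[OF a]) simp
  then have val: "(x\<^sup>2 * (pi * x ^ (2 * n + 1)) - x * (LBINT y. ?F y)) + ?c * (pi * x) = pi * x ^ (2 * Suc n + 1)"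
    by (simp only:) (simp add: power2_eq_square del: arcsine_moment.simps)
  from pv show ?case unfolding fn val .
qed

section \<open>One-cut densities: moment conditions and positivity\<close>

definition one_cut_density :: "real \<Rightarrow> nat \<Rightarrow> real \<Rightarrow> real \<Rightarrow> real \<Rightarrow> real" where
  "one_cut_density a n \<mu> \<theta> y = semicircle a y * (\<mu> + \<theta> * cut_poly a n y) / pi"

lemma continuous_one_cut_density: "continuous_on A (one_cut_density a n \<mu> \<theta>)"
  unfolding one_cut_density_def[abs_def] by (intro continuous_intros continuous_semicircle continuous_cut_poly) simp

lemma principal_value_one_cut_density:
  assumes x: "\<bar>x\<bar> < a" and n: "1 \<le> n"
  shows "has_principal_value (\<lambda>y. one_cut_density a n \<mu> \<theta> y / (x - y)) x (\<mu> * x + \<theta> * x ^ (2 * n - 1))"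
proof -
  obtain m where m: "n = Suc m" using n by (cases n) auto
  have "has_principal_value (\<lambda>y. \<mu> / pi * (semicircle a y / (x - y)) + \<theta> / pi * (semicircle a y * cut_poly a (Suc m) y / (x - y))) x
      (\<mu> / pi * (pi * x) + \<theta> / pi * (pi * x ^ (2 * m + 1)))"
    by (intro has_principal_value_add has_principal_value_cmult principal_value_semicircle principal_value_cut_poly x)
  moreover have "(\<lambda>y. \<mu> / pi * (semicircle a y / (x - y)) + \<theta> / pi * (semicircle a y * cut_poly a (Suc m) y / (x - y))) =
      (\<lambda>y. one_cut_density a n \<mu> \<theta> y / (x - y))"
    unfolding one_cut_density_def m by (simp only: distrib_left add_divide_distrib times_divide_eq_right times_divide_eq_left mult_ac
      divide_divide_eq_left)
  ultimately show ?thesis by (simp add: m)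
qed

lemma one_cut_density_moments:
  assumes a: "0 < a" and n: "1 \<le> n"
  shows "has_bochner_integral lborel (one_cut_density a n \<mu> \<theta>) (\<mu> * a\<^sup>2 / 2 + \<theta> * arcsine_moment n * a ^ (2 * n))"
    and "has_bochner_integral lborel (\<lambda>y. one_cut_density a n \<mu> \<theta> y * y\<^sup>2)
      (\<mu> * a ^ 4 / 8 + \<theta> * arcsine_moment n * a ^ (2 * n + 2) * real n / (2 * (real n + 1)))"
proof -
  have i: "integrable lborel (\<lambda>y. semicircle a y * p y)" if "continuous_on UNIV p" for p
    by (rule semicircle_integrable[OF a that])
  have c: "continuous_on UNIV (cut_poly a n)" "continuous_on UNIV (\<lambda>y. cut_poly a n y * y\<^sup>2)" "continuous_on UNIV (\<lambda>y::real. y\<^sup>2)"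
    "continuous_on UNIV (\<lambda>y::real. 1 :: real)"
    by (intro continuous_intros continuous_cut_poly)+
  have m0: "(LBINT y. semicircle a y) = pi * a\<^sup>2 / 2" "(LBINT y. semicircle a y * y\<^sup>2) = pi * a ^ 4 / 8"
    using semicircle_moment[OF a, of 0] semicircle_moment[OF a, of 1] by (simp_all add: power2_eq_square)
  have "has_bochner_integral lborel (\<lambda>y. \<mu> / pi * (semicircle a y * 1) + \<theta> / pi * (semicircle a y * cut_poly a n y))
      (\<mu> / pi * (pi * a\<^sup>2 / 2) + \<theta> / pi * (pi * a ^ (2 * n) * arcsine_moment n))"
    using i[OF c(4)] i[OF c(1)] cut_poly_moment_0[OF a n] m0
    by (intro has_bochner_integral_add has_bochner_integral_mult_right) (auto simp: has_bochner_integral_iff)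
  moreover have "(\<lambda>y. \<mu> / pi * (semicircle a y * 1) + \<theta> / pi * (semicircle a y * cut_poly a n y)) = one_cut_density a n \<mu> \<theta>"
    by (auto simp: one_cut_density_def fun_eq_iff field_simps)
  ultimately show "has_bochner_integral lborel (one_cut_density a n \<mu> \<theta>) (\<mu> * a\<^sup>2 / 2 + \<theta> * arcsine_moment n * a ^ (2 * n))"
    by (simp add: mult_ac)
  have "has_bochner_integral lborel (\<lambda>y. \<mu> / pi * (semicircle a y * y\<^sup>2) + \<theta> / pi * (semicircle a y * (cut_poly a n y * y\<^sup>2)))
      (\<mu> / pi * (pi * a ^ 4 / 8) + \<theta> / pi * (pi * a ^ (2 * n + 2) * (arcsine_moment (Suc n) - arcsine_moment n / 2)))"
    using i[OF c(3)] i[OF c(2)] cut_poly_moment_2[OF a, of n] m0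
    by (intro has_bochner_integral_add has_bochner_integral_mult_right) (auto simp: has_bochner_integral_iff simp del: arcsine_moment.simps)
  moreover have "(\<lambda>y. \<mu> / pi * (semicircle a y * y\<^sup>2) + \<theta> / pi * (semicircle a y * (cut_poly a n y * y\<^sup>2))) = (\<lambda>y. one_cut_density a n \<mu> \<theta> y * y\<^sup>2)"
    by (auto simp: one_cut_density_def fun_eq_iff field_simps)
  moreover have "arcsine_moment (Suc n) - arcsine_moment n / 2 = arcsine_moment n * (real n / (2 * (real n + 1)))"
    by (simp add: field_simps)
  ultimately show "has_bochner_integral lborel (\<lambda>y. one_cut_density a n \<mu> \<theta> y * y\<^sup>2)
      (\<mu> * a ^ 4 / 8 + \<theta> * arcsine_moment n * a ^ (2 * n + 2) * real n / (2 * (real n + 1)))"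
    by (simp add: mult_ac)
qed

text \<open>The mass condition is linear in \<open>\<mu>\<close> and is solved for it; the second
  moment condition then becomes a single relation between the endpoint and \<open>\<theta>\<close>,
  that is, the temperature.\<close>

lemma one_cut_equations:
  fixes a \<mu> \<theta> :: real
  assumes a: "0 < a" and n: "2 \<le> n"
  shows "\<mu> * a\<^sup>2 / 2 + \<theta> * arcsine_moment n * a ^ (2 * n) = 1 \<and>
      \<mu> * a ^ 4 / 8 + \<theta> * arcsine_moment n * a ^ (2 * n + 2) * real n / (2 * (real n + 1)) = 1 \<longleftrightarrow>
    \<mu> = 2 / a\<^sup>2 * (1 - \<theta> * arcsine_moment n * a ^ (2 * n)) \<and>
      \<theta> * arcsine_moment n * a ^ (2 * n + 2) * (real n - 1) = (real n + 1) * (4 - a\<^sup>2)"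
proof -
  define X where "X = \<theta> * arcsine_moment n * a ^ (2 * n)"
  have X2: "\<theta> * arcsine_moment n * a ^ (2 * n + 2) = X * a\<^sup>2" by (simp add: X_def power2_eq_square)
  have mu: "\<mu> * a\<^sup>2 / 2 + X = 1 \<longleftrightarrow> \<mu> = 2 / a\<^sup>2 * (1 - X)" using a by (auto simp: field_simps)
  have "\<mu> * a ^ 4 / 8 + X * a\<^sup>2 * real n / (2 * (real n + 1)) = 1 \<longleftrightarrow> X * a\<^sup>2 * (real n - 1) = (real n + 1) * (4 - a\<^sup>2)"
    if "\<mu> = 2 / a\<^sup>2 * (1 - X)"
  proof -
    have mu4: "\<mu> * a ^ 4 = 2 * a\<^sup>2 * (1 - X)" using a that by (simp add: power2_eq_square power4_eq_xxxx)
    have clear: "(p / 8 + q / (2 * N) - 1) * (4 * N) = p * N / 2 + 2 * q - 4 * N" if "0 < N" for p q N :: real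
      using that by (simp add: field_simps)
    have "(\<mu> * a ^ 4 / 8 + X * a\<^sup>2 * real n / (2 * (real n + 1)) - 1) * (4 * (real n + 1)) =
        X * a\<^sup>2 * (real n - 1) - (real n + 1) * (4 - a\<^sup>2)"
    proof (subst clear)
      have "\<mu> * a ^ 4 * (real n + 1) / 2 = a\<^sup>2 * (1 - X) * (real n + 1)" by (simp add: mu4)
      then show "\<mu> * a ^ 4 * (real n + 1) / 2 + 2 * (X * a\<^sup>2 * real n) - 4 * (real n + 1) =
          X * a\<^sup>2 * (real n - 1) - (real n + 1) * (4 - a\<^sup>2)"
        by (simp only:) (simp add: algebra_simps)
    qed simp
    moreover have "4 * (real n + 1) \<noteq> 0" by simp
    ultimately show ?thesis by (metis eq_iff_diff_eq_0 mult_eq_0_iff)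
  qed
  then show ?thesis unfolding X2 X_def[symmetric] using mu by blast
qed

text \<open>The source of the critical endpoint: once both moment conditions hold, the density at
  the origin has the sign of 3 n a^2 - 4 (n + 1).\<close>

lemma one_cut_density_at_0:
  assumes a: "0 < a" and n: "2 \<le> n"
    and eqs: "\<mu> = 2 / a\<^sup>2 * (1 - \<theta> * arcsine_moment n * a ^ (2 * n))"
      "\<theta> * arcsine_moment n * a ^ (2 * n + 2) * (real n - 1) = (real n + 1) * (4 - a\<^sup>2)"
  shows "(\<mu> + \<theta> * cut_poly a n 0) * ((2 * real n - 1) * a ^ 4) = 2 * (3 * real n * a\<^sup>2 - 4 * (real n + 1))"
proof -
  obtain m where m: "n = Suc m" using n by (cases n) auto
  define X where "X = \<theta> * arcsine_moment n * a ^ (2 * n)"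
  have eq2: "X * (real n - 1) * a\<^sup>2 = (real n + 1) * (4 - a\<^sup>2)"
    using eqs(2) by (simp add: X_def power2_eq_square mult_ac)
  have mu: "\<mu> * a\<^sup>2 = 2 * (1 - X)" using a eqs(1) by (simp add: X_def)
  \<comment> \<open>Only the last Horner coefficient survives at the origin; the recursion relates
    it to \<open>arcsine_moment n\<close>.\<close>
  have "(2 * real n - 1) * arcsine_moment m = 2 * real n * arcsine_moment n"
    by (simp add: m field_simps)
  then have c: "(2 * real n - 1) * (\<theta> * cut_poly a n 0) * a\<^sup>2 = 2 * real n * X"
    by (simp add: m X_def power2_eq_square del: arcsine_moment.simps)
  have "(\<mu> + \<theta> * cut_poly a n 0) * ((2 * real n - 1) * a ^ 4) =
      ((2 * real n - 1) * (\<mu> * a\<^sup>2) + (2 * real n - 1) * (\<theta> * cut_poly a n 0) * a\<^sup>2) * a\<^sup>2"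
    by (simp add: algebra_simps power2_eq_square power4_eq_xxxx)
  also have "\<dots> = 2 * (2 * real n - 1) * a\<^sup>2 - 2 * (X * (real n - 1) * a\<^sup>2)"
    unfolding mu c by (simp add: algebra_simps)
  also have "\<dots> = 2 * (3 * real n * a\<^sup>2 - 4 * (real n + 1))"
    unfolding eq2 by (simp add: algebra_simps)
  finally show ?thesis .
qed

text \<open>In the critical case the density vanishes at the origin, which nevertheless belongs to
  the support.\<close>

lemma closure_minus_origin:
  assumes a: "0 < (a::real)"
  shows "closure ({-a<..<a} - {0}) = {-a..a}"
proof
  show "closure ({-a<..<a} - {0}) \<subseteq> {-a..a}"
    by (rule closure_minimal) auto
  have "{-a<..<a} - {0} = {-a<..<0} \<union> {0<..<a}" using a by auto
  moreover have "closure {-a<..<0} = {-a..0}" "closure {0<..<a} = {0..a}" using a by simp_all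
  ultimately have eq: "closure ({-a<..<a} - {0}) = {-a..0} \<union> {0..a}" by (simp only: closure_Un)
  show "{-a..a} \<subseteq> closure ({-a<..<a} - {0})" unfolding eq by (rule subsetI) (simp, linarith)
qed

lemma single_cut_exists:
  assumes n: "2 \<le> n" and v: "0 < v" and T: "0 < T" and a: "0 < a"
    and eq: "real n * v / T * arcsine_moment n * a ^ (2 * n + 2) * (real n - 1) = (real n + 1) * (4 - a\<^sup>2)"
    and large: "4 * (real n + 1) \<le> 3 * real n * a\<^sup>2"
  shows "\<exists>\<rho> \<mu>. single_cut n v T \<rho> \<mu>"
proof -
  define \<theta> \<mu> where "\<theta> = real n * v / T" and "\<mu> = 2 / a\<^sup>2 * (1 - \<theta> * arcsine_moment n * a ^ (2 * n))"
  have \<theta>: "0 < \<theta>" using n v T by (simp add: \<theta>_def)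
  have "0 \<le> (\<mu> + \<theta> * cut_poly a n 0) * ((2 * real n - 1) * a ^ 4)"
    using one_cut_density_at_0[OF a n \<mu>_def eq[folded \<theta>_def]] large by simp
  moreover have "0 < (2 * real n - 1) * a ^ 4" using n a by simp
  ultimately have M0: "0 \<le> \<mu> + \<theta> * cut_poly a n 0" by (simp add: zero_le_mult_iff)
  have M: "0 < \<mu> + \<theta> * cut_poly a n y" if "y \<noteq> 0" for y
    using cut_poly_gt_0[OF a n that] \<theta> M0 by (smt (verit) mult_strict_left_mono)
  let ?\<rho> = "one_cut_density a n \<mu> \<theta>"
  have nz: "?\<rho> y = 0 \<Longrightarrow> y = 0 \<or> a \<le> \<bar>y\<bar>" and z: "a \<le> \<bar>y\<bar> \<Longrightarrow> ?\<rho> y = 0" for y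
    using M[of y] by (cases "y = 0"; auto simp: one_cut_density_def semicircle_eq_0_iff[OF a])+
  have supp: "fun_support ?\<rho> = {-a..a}"
  proof
    have "{y. ?\<rho> y \<noteq> 0} \<subseteq> {-a..a}" using z by (force simp: not_le[symmetric])
    then show "fun_support ?\<rho> \<subseteq> {-a..a}" unfolding fun_support_def by (rule closure_minimal) auto
    have "{-a<..<a} - {0} \<subseteq> {y. ?\<rho> y \<noteq> 0}" using nz by (force simp: abs_if split: if_splits)
    from closure_mono[OF this] show "{-a..a} \<subseteq> fun_support ?\<rho>"
      unfolding fun_support_def closure_minus_origin[OF a] .
  qed
  have mom: "\<mu> * a\<^sup>2 / 2 + \<theta> * arcsine_moment n * a ^ (2 * n) = 1"
      "\<mu> * a ^ 4 / 8 + \<theta> * arcsine_moment n * a ^ (2 * n + 2) * real n / (2 * (real n + 1)) = 1"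
    using one_cut_equations[OF a n, of \<mu> \<theta>] eq unfolding \<theta>_def[symmetric] by (auto simp: \<mu>_def)
  have "saddle_point_solution n v T ?\<rho> \<mu>"
    unfolding saddle_point_solution_def
  proof (intro conjI allI ballI)
    show "0 \<le> ?\<rho> y" for y
      using M[of y] M0 semicircle_nonneg[of a y] by (cases "y = 0") (auto simp: one_cut_density_def)
    show "?\<rho> (- y) = ?\<rho> y" for y by (simp add: one_cut_density_def semicircle_minus cut_poly_minus)
    show "compact (fun_support ?\<rho>)" unfolding supp by simp
    show "has_bochner_integral lborel ?\<rho> 1" "has_bochner_integral lborel (\<lambda>y. ?\<rho> y * y\<^sup>2) 1"
      using one_cut_density_moments[OF a, of n \<mu> \<theta>] n mom by auto
    show "has_principal_value (\<lambda>y. ?\<rho> y / (x - y)) x (\<mu> * x + 1 / T / 2 * deriv (potential n v) x)"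
      if "x \<in> interior (fun_support ?\<rho>)" for x
    proof -
      have "\<bar>x\<bar> < a" using that unfolding supp by (auto simp: abs_less_iff)
      then show ?thesis
        using principal_value_one_cut_density[of x a n \<mu> \<theta>] n potential_force_eq[of n \<mu> x T v] by (simp add: \<theta>_def)
    qed
  qed
  then show ?thesis
    unfolding single_cut_def using supp a continuous_one_cut_density by blast
qed

text \<open>The explicit density is taken with the given multiplier \<open>\<mu>\<close>, so that
  its field agrees with that of \<open>\<rho>\<close> on the open interval and the difference falls
  under the uniqueness lemma. The moment conditions enter only after this identification.\<close>

lemma single_cut_equations:
  assumes n: "2 \<le> n" and v: "0 < v" and T: "0 < T" and sol: "single_cut n v T \<rho> \<mu>"
  obtains a where "0 < a" "fun_support \<rho> = {-a..a}"
    "real n * v / T * arcsine_moment n * a ^ (2 * n + 2) * (real n - 1) = (real n + 1) * (4 - a\<^sup>2)"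
    "4 * (real n + 1) \<le> 3 * real n * a\<^sup>2" "\<rho> 0 = 0 \<longleftrightarrow> 4 * (real n + 1) = 3 * real n * a\<^sup>2"
proof -
  from sol obtain a where a: "0 < a" and supp: "fun_support \<rho> = {-a..a}" and cont: "continuous_on UNIV \<rho>"
    and sp: "saddle_point_solution n v T \<rho> \<mu>" by (auto simp: single_cut_def)
  define \<theta> where "\<theta> = real n * v / T"
  let ?e = "one_cut_density a n \<mu> \<theta>"
  have out: "\<rho> x = 0" if "a < \<bar>x\<bar>" for x
    using fun_supportI[of \<rho> x] that unfolding supp by (cases "\<rho> x = 0") auto
  \<comment> \<open>The endpoints are not interior to the support and carry no field equation, so
    the difference must be known to vanish there.\<close>
  have ends: "\<rho> x = 0" if "\<bar>x\<bar> = a" for x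
  proof (rule continuous_constant_on_closure[of "- {-a..a}" \<rho> 0])
    have "x \<in> closure {..<-a} \<or> x \<in> closure {a<..}" using that by (auto simp: abs_if split: if_splits)
    moreover have "- {-a..a} = {..<-a} \<union> {a<..}" using a by auto
    ultimately show "x \<in> closure (- {-a..a})" by (simp add: closure_Un)
    show "continuous_on (closure (- {-a..a})) \<rho>" using cont by (auto intro: continuous_on_subset)
    show "\<rho> x = 0" if "x \<in> - {-a..a}" for x using that by (intro out) auto
  qed
  have eq: "\<rho> x - ?e x = 0" for x
  proof (rule zero_principal_value_imp_zero[of "\<lambda>x. \<rho> x - ?e x"])
    show "continuous_on UNIV (\<lambda>x. \<rho> x - ?e x)" by (intro continuous_intros cont continuous_one_cut_density)
    have in_a: "\<bar>x\<bar> < a" if "\<rho> x - ?e x \<noteq> 0" for x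
      using that out[of x] ends[of x] by (force simp: one_cut_density_def semicircle_eq_0_iff[OF a] not_le[symmetric])
    then show "compact (fun_support (\<lambda>x. \<rho> x - ?e x))"
      by (intro compact_fun_support[of _ a]) (auto intro: less_imp_le)
    show "has_principal_value (\<lambda>y. (\<rho> y - ?e y) / (x - y)) x 0" if "\<rho> x - ?e x \<noteq> 0" for x
    proof -
      have x: "\<bar>x\<bar> < a" by (rule in_a[OF that])
      then have "x \<in> interior (fun_support \<rho>)" unfolding supp by auto
      then have "has_principal_value (\<lambda>y. \<rho> y / (x - y)) x (\<mu> * x + (1 / T) / 2 * deriv (potential n v) x)"
        using sp unfolding saddle_point_solution_def by blast
      then have "has_principal_value (\<lambda>y. \<rho> y / (x - y)) x (\<mu> * x + \<theta> * x ^ (2 * n - 1))"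
        unfolding potential_force_eq[OF order_trans[OF one_le_numeral n]] \<theta>_def .
      from has_principal_value_add[OF this has_principal_value_cmult[OF principal_value_one_cut_density[OF x, of n \<mu> \<theta>], of "-1"]]
      show ?thesis using n by (simp add: diff_divide_distrib)
    qed
  qed
  then have \<rho>: "\<rho> = ?e" by (simp add: fun_eq_iff)
  have "has_bochner_integral lborel ?e 1" "has_bochner_integral lborel (\<lambda>y. ?e y * y\<^sup>2) 1"
    using sp unfolding \<rho> saddle_point_solution_def by auto
  then have "\<mu> * a\<^sup>2 / 2 + \<theta> * arcsine_moment n * a ^ (2 * n) = 1 \<and>
      \<mu> * a ^ 4 / 8 + \<theta> * arcsine_moment n * a ^ (2 * n + 2) * real n / (2 * (real n + 1)) = 1"
    using one_cut_density_moments[OF a, of n \<mu> \<theta>] n by (auto dest: has_bochner_integral_eq)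
  then have eqs: "\<mu> = 2 / a\<^sup>2 * (1 - \<theta> * arcsine_moment n * a ^ (2 * n))"
      "\<theta> * arcsine_moment n * a ^ (2 * n + 2) * (real n - 1) = (real n + 1) * (4 - a\<^sup>2)"
    using one_cut_equations[OF a n, of \<mu> \<theta>] by auto
  have pos: "0 < (2 * real n - 1) * a ^ 4" using n a by simp
  have \<rho>0: "\<rho> 0 = a * (\<mu> + \<theta> * cut_poly a n 0) / pi"
    unfolding \<rho> using a by (simp add: one_cut_density_def semicircle_def)
  have "0 \<le> \<rho> 0" using sp by (simp add: saddle_point_solution_def)
  then have M0: "0 \<le> \<mu> + \<theta> * cut_poly a n 0" unfolding \<rho>0 using a pi_gt_zero
    by (simp add: zero_le_divide_iff zero_le_mult_iff)
  show ?thesis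
  proof (rule that[OF a supp eqs(2)[unfolded \<theta>_def]])
    show "4 * (real n + 1) \<le> 3 * real n * a\<^sup>2"
      using one_cut_density_at_0[OF a n eqs] mult_nonneg_nonneg[OF M0 less_imp_le[OF pos]] by simp
    show "\<rho> 0 = 0 \<longleftrightarrow> 4 * (real n + 1) = 3 * real n * a\<^sup>2"
      using one_cut_density_at_0[OF a n eqs] pos a unfolding \<rho>0
      by (metis (no_types, opaque_lifting) divide_eq_0_iff eq_iff_diff_eq_0 less_irrefl mult_eq_0_iff pi_neq_zero zero_neq_numeral)
  qed
qed

section \<open>Two-cut densities\<close>

text \<open>The semicircle over [a^2, b^2] in the variable y^2, with |y| as half the Jacobian. For a
  = 0 it is y^2 times the semicircle of radius b, so the family extends to a closed gap.\<close>

definition gap_weight :: "real \<Rightarrow> real \<Rightarrow> real \<Rightarrow> real" where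
  "gap_weight a b y = \<bar>y\<bar> * sqrt (max 0 ((y\<^sup>2 - a\<^sup>2) * (b\<^sup>2 - y\<^sup>2)))"

lemma continuous_gap_weight: "continuous_on A (gap_weight a b)"
  unfolding gap_weight_def[abs_def] by (intro continuous_intros)

lemma gap_weight_minus: "gap_weight a b (- y) = gap_weight a b y"
  by (simp add: gap_weight_def)

lemma gap_weight_nonneg: "0 \<le> gap_weight a b y"
  by (simp add: gap_weight_def)

lemma gap_weight_pos_iff:
  assumes "0 \<le> a" "a \<le> b"
  shows "0 < gap_weight a b y \<longleftrightarrow> a < \<bar>y\<bar> \<and> \<bar>y\<bar> < b"
proof -
  have "a < \<bar>y\<bar> \<longleftrightarrow> a\<^sup>2 < y\<^sup>2" "\<bar>y\<bar> < b \<longleftrightarrow> y\<^sup>2 < b\<^sup>2"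
    using abs_le_square_iff[of y a] abs_le_square_iff[of b y] assms by (auto simp: not_le[symmetric])
  moreover have "a\<^sup>2 \<le> b\<^sup>2" using assms by (simp add: power_mono)
  moreover have "0 < gap_weight a b y \<longleftrightarrow> y \<noteq> 0 \<and> 0 < (y\<^sup>2 - a\<^sup>2) * (b\<^sup>2 - y\<^sup>2)"
    by (auto simp: gap_weight_def zero_less_mult_iff less_max_iff_disj)
  ultimately show ?thesis using assms(1) by (auto simp: zero_less_mult_iff)
qed

lemma gap_weight_support:
  assumes "0 \<le> a" "a \<le> b" "gap_weight a b y \<noteq> 0"
  shows "a < \<bar>y\<bar>" "\<bar>y\<bar> < b"
  using gap_weight_pos_iff[OF assms(1,2), of y] gap_weight_nonneg[of a b y] assms(3) by auto

text \<open>By evenness the two halves of the weight combine to the kernel 2 x / (x^2 - y^2) on the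
  right half, a semicircle integral in u = y^2. \<open>g\<close> carries this kernel;
  \<open>h\<close> and its reflection, with equal integrals, move the contribution of 1 / (x + y)
  back to the left half.\<close>

lemma principal_value_gap_weight_pos:
  assumes a: "0 \<le> a" and x: "a < x" "x < b"
  shows "has_principal_value (\<lambda>y. gap_weight a b y / (x - y)) x (pi * x * (x\<^sup>2 - (a\<^sup>2 + b\<^sup>2) / 2))"
proof -
  \<comment> \<open>Centre and half length of [a^2, b^2], and the position of x^2 relative to the
    centre.\<close>
  define m r \<sigma> where "m = (a\<^sup>2 + b\<^sup>2) / 2" and "r = (b\<^sup>2 - a\<^sup>2) / 2" and "\<sigma> = x\<^sup>2 - m"
  define p where "p y = (if 0 \<le> y then gap_weight a b y else 0)" for y
  define g where "g y = p y * (2 * x / (x + y))" for y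
  define h where "h y = p y * (1 / (x + y))" for y
  define L where "L y = x * semicircle_primitive r \<sigma> (y\<^sup>2 - m)" for y
  have x0: "0 < x" and ab: "a \<le> b" using a x by auto
  have p_eq: "p y = max 0 y * sqrt (max 0 ((y\<^sup>2 - a\<^sup>2) * (b\<^sup>2 - y\<^sup>2)))" for y
    by (auto simp: p_def gap_weight_def max_def)
  have p_cont: "continuous_on UNIV p" unfolding p_eq[abs_def] by (intro continuous_intros)
  have p_supp: "a < y \<and> y < b" if "p y \<noteq> 0" for y
    using that gap_weight_support[OF a ab, of y] by (auto simp: p_def split: if_splits)
  have p_cpt: "compact (fun_support p)"
    by (rule compact_fun_support[of _ b]) (use p_supp a in force)
  have supp: "fun_support p \<subseteq> {a..b}"
    unfolding fun_support_def by (rule closure_minimal) (use p_supp in force)+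
  have "continuous_on (fun_support p) (\<lambda>y. 2 * x / (x + y))" "continuous_on (fun_support p) (\<lambda>y. 1 / (x + y))"
    using supp a x0 by (intro continuous_intros; force)+
  from compact_support_mult_integrable[OF p_cont p_cpt this(1)] compact_support_mult_integrable[OF p_cont p_cpt this(2)]
  have int: "integrable lborel g" "integrable lborel h"
    by (simp_all add: g_def[abs_def] h_def[abs_def])
  have sq_less: "s\<^sup>2 < t\<^sup>2" if "0 \<le> s" "s < t" for s t :: real
    using that by (intro power_strict_mono) auto
  have \<sigma>: "\<bar>\<sigma>\<bar> < r"
    using sq_less[OF a x(1)] sq_less[of x b] x x0 by (simp add: \<sigma>_def r_def m_def abs_less_iff field_simps)
  have pv_g: "has_principal_value (\<lambda>y. g y / (x - y)) x (L b - L a)"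
  proof (rule has_principal_value_antiderivative[OF x int(1)])
    show "continuous_on {a..b} g"
      unfolding g_def[abs_def] using a x0
      by (intro continuous_intros continuous_on_subset[OF p_cont]) auto
    show "g y = 0" if "y < a \<or> b < y" for y
      using p_supp[of y] that by (auto simp: g_def)
    show "continuous_on ({a..b} - {x}) L"
      unfolding L_def
    proof (intro continuous_intros continuous_on_compose2[OF semicircle_primitive_continuous[OF \<sigma>]])
      show "(\<lambda>y. y\<^sup>2 - m) ` ({a..b} - {x}) \<subseteq> {-r..r} - {\<sigma>}"
      proof (rule image_subsetI)
        fix y assume y: "y \<in> {a..b} - {x}"
        then have "a\<^sup>2 \<le> y\<^sup>2" "y\<^sup>2 \<le> b\<^sup>2" using a by (auto intro!: power_mono)
        moreover have "y\<^sup>2 \<noteq> x\<^sup>2" using y a x0 by (auto simp: power2_eq_iff)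
        ultimately show "y\<^sup>2 - m \<in> {-r..r} - {\<sigma>}" by (auto simp: \<sigma>_def m_def r_def field_simps)
      qed
    qed
    show "(L has_real_derivative g y / (x - y)) (at y)" if y: "a < y" "y < b" "y \<noteq> x" for y
    proof -
      have y0: "0 < y" using a y by linarith
      have u: "\<bar>y\<^sup>2 - m\<bar> < r"
        using sq_less[OF a y(1)] sq_less[of y b] y y0 by (simp add: r_def m_def abs_less_iff field_simps)
      have "y\<^sup>2 \<noteq> x\<^sup>2" using y y0 x0 by (auto simp: power2_eq_iff)
      then have ne: "y\<^sup>2 - m \<noteq> \<sigma>" by (simp add: \<sigma>_def)
      have "((\<lambda>y. y\<^sup>2 - m) has_real_derivative 2 * y) (at y)" by (auto intro!: derivative_eq_intros)
      from DERIV_cmult[OF DERIV_chain2[OF semicircle_primitive_derivative[OF \<sigma> u ne] this], of x]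
      have d: "(L has_real_derivative x * (sqrt (r\<^sup>2 - (y\<^sup>2 - m)\<^sup>2) / (\<sigma> - (y\<^sup>2 - m)) * (2 * y))) (at y)"
        unfolding L_def[abs_def] .
      have rm: "r\<^sup>2 - (y\<^sup>2 - m)\<^sup>2 = (y\<^sup>2 - a\<^sup>2) * (b\<^sup>2 - y\<^sup>2)"
        by (simp add: r_def m_def power2_eq_square field_simps)
      have pos: "0 \<le> (y\<^sup>2 - a\<^sup>2) * (b\<^sup>2 - y\<^sup>2)"
        using sq_less[OF a y(1)] sq_less[of y b] y y0 by simp
      have "\<sigma> - (y\<^sup>2 - m) = (x - y) * (x + y)" by (simp add: \<sigma>_def power2_eq_square algebra_simps)
      then show ?thesis
        using d pos y0 unfolding rm by (simp add: g_def p_eq max_def mult_ac)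
    qed
    have "((\<lambda>\<epsilon>. semicircle_primitive r \<sigma> ((x - \<epsilon>)\<^sup>2 - m) - semicircle_primitive r \<sigma> ((x + \<epsilon>)\<^sup>2 - m)) \<longlongrightarrow> 0) (at_right 0)"
    proof (rule semicircle_primitive_jump[OF \<sigma>])
      have "((\<lambda>\<epsilon>. (x - \<epsilon>)\<^sup>2 - m) \<longlongrightarrow> (x - 0)\<^sup>2 - m) (at_right 0)" "((\<lambda>\<epsilon>. (x + \<epsilon>)\<^sup>2 - m) \<longlongrightarrow> (x + 0)\<^sup>2 - m) (at_right 0)"
        by (intro tendsto_intros)+
      then show "((\<lambda>\<epsilon>. (x - \<epsilon>)\<^sup>2 - m) \<longlongrightarrow> \<sigma>) (at_right 0)" "((\<lambda>\<epsilon>. (x + \<epsilon>)\<^sup>2 - m) \<longlongrightarrow> \<sigma>) (at_right 0)"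
        by (simp_all add: \<sigma>_def)
      have d: "\<sigma> - ((x - \<epsilon>)\<^sup>2 - m) = \<epsilon> * (2 * x - \<epsilon>)" "\<sigma> - ((x + \<epsilon>)\<^sup>2 - m) = - (\<epsilon> * (2 * x + \<epsilon>))" for \<epsilon>
        by (simp_all add: \<sigma>_def power2_eq_square algebra_simps)
      show "\<forall>\<^sub>F \<epsilon> in at_right 0. (x - \<epsilon>)\<^sup>2 - m \<noteq> \<sigma>"
      proof (rule eventually_at_rightI[OF _ x0])
        fix \<epsilon> assume "\<epsilon> \<in> {0<..<x}"
        then have "\<epsilon> * (2 * x - \<epsilon>) \<noteq> 0" by auto
        then show "(x - \<epsilon>)\<^sup>2 - m \<noteq> \<sigma>" using d(1)[of \<epsilon>] by auto
      qed
      show "\<forall>\<^sub>F \<epsilon> in at_right 0. (x + \<epsilon>)\<^sup>2 - m \<noteq> \<sigma>"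
      proof (rule eventually_at_rightI[OF _ x0])
        fix \<epsilon> assume "\<epsilon> \<in> {0<..<x}"
        then have "\<epsilon> * (2 * x + \<epsilon>) \<noteq> 0" by auto
        then show "(x + \<epsilon>)\<^sup>2 - m \<noteq> \<sigma>" using d(2)[of \<epsilon>] by auto
      qed
      have "((\<lambda>\<epsilon>. (2 * x - \<epsilon>) / (2 * x + \<epsilon>)) \<longlongrightarrow> (2 * x - 0) / (2 * x + 0)) (at_right 0)"
        using x0 by (intro tendsto_intros) auto
      moreover have "\<forall>\<^sub>F \<epsilon> in at_right 0. (2 * x - \<epsilon>) / (2 * x + \<epsilon>) =
          \<bar>\<sigma> - ((x - \<epsilon>)\<^sup>2 - m)\<bar> / \<bar>\<sigma> - ((x + \<epsilon>)\<^sup>2 - m)\<bar>"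
        by (rule eventually_at_rightI[OF _ x0]) (auto simp: d abs_mult)
      ultimately show "((\<lambda>\<epsilon>. \<bar>\<sigma> - ((x - \<epsilon>)\<^sup>2 - m)\<bar> / \<bar>\<sigma> - ((x + \<epsilon>)\<^sup>2 - m)\<bar>) \<longlongrightarrow> 1) (at_right 0)"
        using x0 by (auto intro: Lim_transform_eventually)
    qed
    from tendsto_mult_left[OF this, of x] show "((\<lambda>\<epsilon>. L (x - \<epsilon>) - L (x + \<epsilon>)) \<longlongrightarrow> 0) (at_right 0)"
      by (simp add: L_def right_diff_distrib)
  qed
  have "b\<^sup>2 - m = r" "a\<^sup>2 - m = - r" by (auto simp: m_def r_def field_simps)
  then have "L b - L a = pi * x * \<sigma>"
    using semicircle_primitive_ends[OF \<sigma>] by (simp add: L_def right_diff_distrib[symmetric])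
  moreover have "has_principal_value (\<lambda>y. h (- y) - h y) x 0"
  proof -
    have int': "integrable lborel (\<lambda>y. h (- y))"
      using lborel_integrable_real_affine[OF int(2), of "-1" 0] by simp
    moreover have "(LBINT y. h (- y)) = (LBINT y. h y)"
      using lborel_integral_real_affine[of "-1" h 0] by simp
    ultimately have "integrable lborel (\<lambda>y. h (- y) - h y)" "(LBINT y. h (- y) - h y) = 0"
      using int(2) by auto
    then show ?thesis using has_principal_value_integrable by metis
  qed
  ultimately have "has_principal_value (\<lambda>y. g y / (x - y) + (h (- y) - h y)) x (pi * x * \<sigma> + 0)"
    using pv_g by (intro has_principal_value_add) auto
  then have "has_principal_value (\<lambda>y. gap_weight a b y / (x - y)) x (pi * x * \<sigma> + 0)"
  proof (rule has_principal_value_cong)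
    fix y assume y: "y \<noteq> x"
    have g: "g y / (x - y) - h y = p y / (x - y)"
    proof (cases "p y = 0")
      case False
      then have "x + y \<noteq> 0" using p_supp[OF False] a x0 by auto
      moreover have "x - y \<noteq> 0" using y by simp
      ultimately have "2 * x / (x + y) / (x - y) - 1 / (x + y) = 1 / (x - y)"
        by (simp add: divide_simps)
      then have "p y * (2 * x / (x + y) / (x - y) - 1 / (x + y)) = p y * (1 / (x - y))" by simp
      then show ?thesis by (simp add: g_def h_def right_diff_distrib)
    qed (auto simp: g_def h_def)
    have "gap_weight a b y = p y + p (- y)"
    proof -
      have "gap_weight a b 0 = 0" by (simp add: gap_weight_def)
      then show ?thesis by (cases "y = 0") (auto simp: p_def gap_weight_minus)
    qed
    then have "gap_weight a b y / (x - y) = p y / (x - y) + p (- y) / (x - y)" by (simp add: add_divide_distrib)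
    then show "g y / (x - y) + (h (- y) - h y) = gap_weight a b y / (x - y)"
      unfolding g[symmetric] by (simp add: h_def)
  qed
  then show ?thesis by (simp add: \<sigma>_def m_def)
qed

lemma principal_value_gap_weight:
  assumes a: "0 \<le> a" and x: "a < \<bar>x\<bar>" "\<bar>x\<bar> < b"
  shows "has_principal_value (\<lambda>y. gap_weight a b y / (x - y)) x (pi * x * (x\<^sup>2 - (a\<^sup>2 + b\<^sup>2) / 2))"
proof (cases "0 \<le> x")
  case False
  then have "has_principal_value (\<lambda>y. gap_weight a b y / (- (- x) - y)) (- (- x)) (- (pi * (- x) * ((- x)\<^sup>2 - (a\<^sup>2 + b\<^sup>2) / 2)))"
    using x by (intro has_principal_value_reflect gap_weight_minus principal_value_gap_weight_pos[OF a]) auto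
  then show ?thesis by simp
qed (use principal_value_gap_weight_pos[OF a] x in auto)

text \<open>In the variable \<open>x\<^sup>2\<close>, the field generated by the \<open>j\<close>-th polynomial times the weight is
  \<open>x ^ (2 * j + 2)\<close> minus the \<open>j\<close>-th constant; each step of the recursion adds the multiple of the
  weight that cancels the term linear in \<open>x\<^sup>2\<close>.\<close>

primrec gap_pair :: "real \<Rightarrow> real \<Rightarrow> nat \<Rightarrow> (real \<Rightarrow> real) \<times> real" where
  "gap_pair a b 0 = (\<lambda>y. 1, (a\<^sup>2 + b\<^sup>2) / 2)"
| "gap_pair a b (Suc j) = (\<lambda>y. y\<^sup>2 * fst (gap_pair a b j) y + snd (gap_pair a b j),
     (a\<^sup>2 + b\<^sup>2) / 2 * snd (gap_pair a b j) + (LBINT y. gap_weight a b y * fst (gap_pair a b j) y) / pi)"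

definition gap_poly :: "real \<Rightarrow> real \<Rightarrow> nat \<Rightarrow> real \<Rightarrow> real" where
  "gap_poly a b j = fst (gap_pair a b j)"

definition gap_const :: "real \<Rightarrow> real \<Rightarrow> nat \<Rightarrow> real" where
  "gap_const a b j = snd (gap_pair a b j)"

definition gap_moment :: "real \<Rightarrow> real \<Rightarrow> nat \<Rightarrow> nat \<Rightarrow> real" where
  "gap_moment a b j i = (LBINT y. gap_weight a b y * (gap_poly a b j y * y ^ (2 * i))) / pi"

lemma gap_poly_simps [simp]:
  "gap_poly a b 0 y = 1" "gap_poly a b (Suc j) y = y\<^sup>2 * gap_poly a b j y + gap_const a b j"
  by (simp_all add: gap_poly_def gap_const_def)

lemma gap_const_simps [simp]:
  "gap_const a b 0 = (a\<^sup>2 + b\<^sup>2) / 2"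
  "gap_const a b (Suc j) = (a\<^sup>2 + b\<^sup>2) / 2 * gap_const a b j + gap_moment a b j 0"
  by (simp_all add: gap_poly_def gap_const_def gap_moment_def)

lemma continuous_gap_poly: "continuous_on A (gap_poly a b j)"
  by (induction j) (auto intro!: continuous_intros simp: gap_poly_def[of _ _ 0])

lemma gap_poly_minus: "gap_poly a b j (- y) = gap_poly a b j y"
  by (induction j) auto

text \<open>All coefficients are positive, so a density with a gap is positive inside its support
  for every choice of endpoints; the condition at the origin that governs a single cut has no
  counterpart.\<close>

lemma gap_poly_const_pos:
  assumes "0 \<le> a" "a \<le> b" "0 < b"
  shows "0 < gap_poly a b j y \<and> 0 < gap_const a b j"
proof (induction j arbitrary: y)
  case 0
  have "0 < a\<^sup>2 + b\<^sup>2" using assms by (simp add: add_nonneg_pos)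
  then show ?case by simp
next
  case (Suc j)
  then have *: "0 < gap_poly a b j y" "0 < gap_const a b j" for y by auto
  have "0 \<le> gap_moment a b j 0"
    unfolding gap_moment_def using gap_weight_nonneg less_imp_le[OF *(1)]
    by (auto intro!: integral_nonneg divide_nonneg_pos)
  moreover have "0 < (a\<^sup>2 + b\<^sup>2) / 2" using assms by (simp add: add_nonneg_pos)
  ultimately have "0 < (a\<^sup>2 + b\<^sup>2) / 2 * gap_const a b j + gap_moment a b j 0"
    using *(2) by (intro add_pos_nonneg mult_pos_pos)
  moreover have "0 < y\<^sup>2 * gap_poly a b j y + gap_const a b j"
    using * by (intro add_nonneg_pos mult_nonneg_nonneg) (auto intro: less_imp_le)
  ultimately show ?case by simp
qed

lemma gap_weight_integrable:
  assumes "0 \<le> a" "a \<le> b" "continuous_on UNIV p"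
  shows "integrable lborel (\<lambda>y. gap_weight a b y * p y)"
  using compact_support_mult_integrable[OF continuous_gap_weight compact_fun_support[of "gap_weight a b" b], of p]
    gap_weight_support[OF assms(1,2)] continuous_on_subset[OF assms(3)]
  by (auto intro: less_imp_le)

lemma principal_value_gap_poly:
  assumes a: "0 \<le> a" and x: "a < \<bar>x\<bar>" "\<bar>x\<bar> < b"
  shows "has_principal_value (\<lambda>y. gap_weight a b y * gap_poly a b j y / (x - y)) x
    (pi * x * (x ^ (2 * j + 2) - gap_const a b j))"
proof (induction j)
  case 0
  then show ?case using principal_value_gap_weight[OF a x] by (simp add: power2_eq_square)
next
  case (Suc j)
  have ab: "a \<le> b" using x by linarith
  let ?F = "\<lambda>y. gap_weight a b y * gap_poly a b j y"
  have "has_principal_value (\<lambda>y. y\<^sup>2 * ?F y / (x - y)) x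
      (x\<^sup>2 * (pi * x * (x ^ (2 * j + 2) - gap_const a b j)) - x * (LBINT y. ?F y))"
  proof (rule has_principal_value_mult_square[OF _ _ _ Suc.IH])
    show "continuous_on UNIV ?F" by (intro continuous_intros continuous_gap_weight continuous_gap_poly)
    show "compact (fun_support ?F)"
      by (rule compact_fun_support[of _ b]) (use gap_weight_support[OF a ab] in \<open>auto intro: less_imp_le\<close>)
    show "?F (- y) = ?F y" for y by (simp add: gap_weight_minus gap_poly_minus)
  qed
  then have pv: "has_principal_value (\<lambda>y. y\<^sup>2 * ?F y / (x - y) + gap_const a b j * (gap_weight a b y / (x - y))) x
      ((x\<^sup>2 * (pi * x * (x ^ (2 * j + 2) - gap_const a b j)) - x * (LBINT y. ?F y)) +
        gap_const a b j * (pi * x * (x\<^sup>2 - (a\<^sup>2 + b\<^sup>2) / 2)))"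
    by (rule has_principal_value_add[OF _ has_principal_value_cmult[OF principal_value_gap_weight[OF a x]]])
  have fn: "(\<lambda>y. y\<^sup>2 * ?F y / (x - y) + gap_const a b j * (gap_weight a b y / (x - y))) =
      (\<lambda>y. gap_weight a b y * gap_poly a b (Suc j) y / (x - y))"
    by (rule ext) (simp add: distrib_left add_divide_distrib mult_ac)
  have "(LBINT y. ?F y) = pi * gap_moment a b j 0" by (simp add: gap_moment_def)
  then have val: "(x\<^sup>2 * (pi * x * (x ^ (2 * j + 2) - gap_const a b j)) - x * (LBINT y. ?F y)) +
        gap_const a b j * (pi * x * (x\<^sup>2 - (a\<^sup>2 + b\<^sup>2) / 2)) = pi * x * (x ^ (2 * Suc j + 2) - gap_const a b (Suc j))"
    by (simp only: gap_const_simps) (simp add: algebra_simps power2_eq_square)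
  from pv show ?case unfolding fn val .
qed

section \<open>Scaling and continuity in the endpoints\<close>

lemma gap_weight_scale:
  assumes "0 < c" shows "gap_weight (c * a) (c * b) (c * y) = c ^ 3 * gap_weight a b y"
proof -
  have "max 0 (((c * y)\<^sup>2 - (c * a)\<^sup>2) * ((c * b)\<^sup>2 - (c * y)\<^sup>2)) = (c\<^sup>2)\<^sup>2 * max 0 ((y\<^sup>2 - a\<^sup>2) * (b\<^sup>2 - y\<^sup>2))"
  proof -
    have "((c * y)\<^sup>2 - (c * a)\<^sup>2) * ((c * b)\<^sup>2 - (c * y)\<^sup>2) = (c\<^sup>2)\<^sup>2 * ((y\<^sup>2 - a\<^sup>2) * (b\<^sup>2 - y\<^sup>2))"
      by (simp add: power_mult_distrib algebra_simps power2_eq_square)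
    then show ?thesis by (simp add: max_mult_distrib_left)
  qed
  then show ?thesis
    using assms by (simp add: gap_weight_def real_sqrt_mult abs_mult power3_eq_cube power2_eq_square)
qed

text \<open>Homogeneity: the weight has degree 3, the polynomial 2 j, and dy adds one. The two
  endpoints are thereby reduced to their ratio and a scale, which equality of two moments will
  fix.\<close>

lemma gap_scale:
  assumes c: "0 < c"
  shows "(\<forall>y. gap_poly (c * a) (c * b) j (c * y) = c ^ (2 * j) * gap_poly a b j y) \<and>
    gap_const (c * a) (c * b) j = c ^ (2 * j + 2) * gap_const a b j \<and>
    (\<forall>i. gap_moment (c * a) (c * b) j i = c ^ (2 * j + 2 * i + 4) * gap_moment a b j i)"
proof (induction j)
  have moment: "gap_moment (c * a) (c * b) j i = c ^ (2 * j + 2 * i + 4) * gap_moment a b j i"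
    if "\<And>y. gap_poly (c * a) (c * b) j (c * y) = c ^ (2 * j) * gap_poly a b j y" for i j
  proof -
    have "(LBINT y. gap_weight (c * a) (c * b) y * (gap_poly (c * a) (c * b) j y * y ^ (2 * i))) =
        c * (LBINT y. gap_weight (c * a) (c * b) (c * y) * (gap_poly (c * a) (c * b) j (c * y) * (c * y) ^ (2 * i)))"
      using lborel_integral_real_affine[of c "\<lambda>y. gap_weight (c * a) (c * b) y * (gap_poly (c * a) (c * b) j y * y ^ (2 * i))" 0] c
      by simp
    also have "\<dots> = c * (LBINT y. c ^ (2 * j + 2 * i + 3) * (gap_weight a b y * (gap_poly a b j y * y ^ (2 * i))))"
      unfolding that gap_weight_scale[OF c] by (simp add: power_mult_distrib power_add mult_ac)
    also have "\<dots> = c ^ (2 * j + 2 * i + 4) * (LBINT y. gap_weight a b y * (gap_poly a b j y * y ^ (2 * i)))"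
      by (subst integral_mult_right_zero) (simp add: power_add eval_nat_numeral)
    finally show ?thesis by (simp add: gap_moment_def)
  qed
  {
    case 0
    have "gap_moment (c * a) (c * b) 0 i = c ^ (2 * 0 + 2 * i + 4) * gap_moment a b 0 i" for i
      by (rule moment) simp
    then show ?case by (simp add: power_mult_distrib field_simps power2_eq_square)
  next
    case (Suc j)
    then have IH: "gap_poly (c * a) (c * b) j (c * y) = c ^ (2 * j) * gap_poly a b j y"
      "gap_const (c * a) (c * b) j = c ^ (2 * j + 2) * gap_const a b j"
      "gap_moment (c * a) (c * b) j i = c ^ (2 * j + 2 * i + 4) * gap_moment a b j i" for y i
      by auto
    have poly: "gap_poly (c * a) (c * b) (Suc j) (c * y) = c ^ (2 * Suc j) * gap_poly a b (Suc j) y" for y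
      unfolding gap_poly_simps IH by (simp add: power_mult_distrib algebra_simps power2_eq_square)
    moreover have "gap_const (c * a) (c * b) (Suc j) = c ^ (2 * Suc j + 2) * gap_const a b (Suc j)"
      unfolding gap_const_simps IH by (simp add: power_mult_distrib field_simps eval_nat_numeral)
    moreover have "gap_moment (c * a) (c * b) (Suc j) i = c ^ (2 * Suc j + 2 * i + 4) * gap_moment a b (Suc j) i" for i
      by (rule moment) (rule poly)
    ultimately show ?case by blast
  }
qed

lemma continuous_on_integral_bounded:
  fixes F :: "real \<Rightarrow> real \<Rightarrow> real"
  assumes w: "integrable lborel w" "\<And>\<alpha> y. \<alpha> \<in> A \<Longrightarrow> \<bar>F \<alpha> y\<bar> \<le> w y"
    and meas: "\<And>\<alpha>. F \<alpha> \<in> borel_measurable borel"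
    and cont: "\<And>y. continuous_on A (\<lambda>\<alpha>. F \<alpha> y)"
  shows "continuous_on A (\<lambda>\<alpha>. LBINT y. F \<alpha> y)"
  unfolding continuous_on_sequentially
proof (intro ballI allI impI, elim conjE)
  fix \<alpha> and u :: "nat \<Rightarrow> real"
  assume \<alpha>: "\<alpha> \<in> A" and u: "\<forall>k. u k \<in> A" "u \<longlonglongrightarrow> \<alpha>"
  have "(\<lambda>k. LBINT y. F (u k) y) \<longlonglongrightarrow> (LBINT y. F \<alpha> y)"
  proof (rule integral_dominated_convergence[OF _ _ w(1)])
    show "AE y in lborel. (\<lambda>k. F (u k) y) \<longlonglongrightarrow> F \<alpha> y"
      using cont \<alpha> u unfolding continuous_on_sequentially by (auto simp: o_def)
    show "AE y in lborel. norm (F (u k) y) \<le> w y" for k using w(2) u by auto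
  qed (use meas in auto)
  then show "((\<lambda>\<alpha>. LBINT y. F \<alpha> y) \<circ> u) \<longlonglongrightarrow> (LBINT y. F \<alpha> y)" by (simp add: o_def)
qed

lemma gap_weight_le:
  assumes "0 \<le> \<alpha>" "\<alpha> \<le> 1"
  shows "gap_weight \<alpha> 1 y \<le> indicator {-1..1} y"
proof (cases "gap_weight \<alpha> 1 y = 0")
  case False
  then have y: "\<alpha> < \<bar>y\<bar>" "\<bar>y\<bar> < 1" using gap_weight_support[OF assms] by auto
  have "y\<^sup>2 \<le> 1" "\<alpha>\<^sup>2 \<le> y\<^sup>2"
    using y power_mono[of "\<bar>y\<bar>" 1 2] power_mono[of \<alpha> "\<bar>y\<bar>" 2] assms by auto
  then have "y\<^sup>2 - \<alpha>\<^sup>2 \<le> 1" "1 - y\<^sup>2 \<le> 1" "0 \<le> 1 - y\<^sup>2"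
    using zero_le_power2[of \<alpha>] zero_le_power2[of y] by linarith+
  then have "(y\<^sup>2 - \<alpha>\<^sup>2) * (1 - y\<^sup>2) \<le> 1 * 1" by (intro mult_mono) auto
  then have "sqrt (max 0 ((y\<^sup>2 - \<alpha>\<^sup>2) * (1 - y\<^sup>2))) \<le> 1" by simp
  then have "\<bar>y\<bar> * sqrt (max 0 ((y\<^sup>2 - \<alpha>\<^sup>2) * (1 - y\<^sup>2))) \<le> 1 * 1" using y by (intro mult_mono) auto
  then show ?thesis using y by (auto simp: gap_weight_def indicator_def)
qed (auto simp: indicator_def)

text \<open>One induction for everything, since each constant uses a moment of the step before. The
  bound on the polynomials yields the dominating function for the moments. The ratio 1, where the
  weight vanishes, is included to reach low temperatures.\<close>

lemma gap_continuous:
  shows "(\<forall>y. continuous_on {0..1} (\<lambda>\<alpha>. gap_poly \<alpha> 1 j y)) \<and> continuous_on {0..1} (\<lambda>\<alpha>. gap_const \<alpha> 1 j) \<and>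
    (\<exists>B. \<forall>\<alpha>\<in>{0..1}. \<forall>y\<in>{-1..1}. \<bar>gap_poly \<alpha> 1 j y\<bar> \<le> B) \<and> (\<forall>i. continuous_on {0..1} (\<lambda>\<alpha>. gap_moment \<alpha> 1 j i))"
proof (induction j)
  have moment: "continuous_on {0..1} (\<lambda>\<alpha>. gap_moment \<alpha> 1 j i)"
    if cont: "\<And>y. continuous_on {0..1} (\<lambda>\<alpha>. gap_poly \<alpha> 1 j y)"
      and B: "\<And>\<alpha> y. \<alpha> \<in> {0..1} \<Longrightarrow> y \<in> {-1..1} \<Longrightarrow> \<bar>gap_poly \<alpha> 1 j y\<bar> \<le> B" for i j B
    unfolding gap_moment_def
  proof (intro continuous_on_divide continuous_on_integral_bounded continuous_on_const)
    show "integrable lborel (\<lambda>y::real. indicator {-1..1} y * B)" by (auto intro!: integrable_real_indicator)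
    show "\<bar>gap_weight \<alpha> 1 y * (gap_poly \<alpha> 1 j y * y ^ (2 * i))\<bar> \<le> indicator {-1..1} y * B"
      if \<alpha>: "\<alpha> \<in> {0..1}" for \<alpha> y
    proof (cases "y \<in> {-1..1}")
      case True
      then have "\<bar>y ^ (2 * i)\<bar> \<le> 1" unfolding power_abs by (intro power_le_one) auto
      then have "\<bar>gap_poly \<alpha> 1 j y\<bar> * \<bar>y ^ (2 * i)\<bar> \<le> B * 1"
        using B[OF \<alpha> True] by (intro mult_mono) auto
      then have "\<bar>gap_weight \<alpha> 1 y\<bar> * \<bar>gap_poly \<alpha> 1 j y * y ^ (2 * i)\<bar> \<le> indicator {-1..1} y * B"
        using gap_weight_le[of \<alpha> y] gap_weight_nonneg[of \<alpha> 1 y] \<alpha> B[OF \<alpha> True]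
        by (intro mult_mono) (auto simp: abs_mult)
      then show ?thesis by (simp add: abs_mult)
    next
      case False
      then have "gap_weight \<alpha> 1 y = 0" using gap_weight_le[of \<alpha> y] gap_weight_nonneg[of \<alpha> 1 y] \<alpha> by auto
      then show ?thesis using False by simp
    qed
    show "(\<lambda>y. gap_weight \<alpha> 1 y * (gap_poly \<alpha> 1 j y * y ^ (2 * i))) \<in> borel_measurable borel" for \<alpha>
      by (intro borel_measurable_continuous_onI continuous_intros continuous_gap_weight continuous_gap_poly)
    show "continuous_on {0..1} (\<lambda>\<alpha>. gap_weight \<alpha> 1 y * (gap_poly \<alpha> 1 j y * y ^ (2 * i)))" for y
      unfolding gap_weight_def by (intro continuous_intros cont)
  qed simp
  {
    case 0
    have "continuous_on {0..1} (\<lambda>\<alpha>. gap_moment \<alpha> 1 0 i)" for i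
      by (rule moment[where B=1]) auto
    moreover have "\<exists>B. \<forall>\<alpha>\<in>{0..1}. \<forall>y\<in>{-1..1}. \<bar>gap_poly \<alpha> 1 0 y\<bar> \<le> B" by (intro exI[of _ 1]) simp
    ultimately show ?case by (auto intro!: continuous_intros)
  next
    case (Suc j)
    then have cont: "continuous_on {0..1} (\<lambda>\<alpha>. gap_poly \<alpha> 1 j y)" and
      e: "continuous_on {0..1} (\<lambda>\<alpha>. gap_const \<alpha> 1 j)" and m: "continuous_on {0..1} (\<lambda>\<alpha>. gap_moment \<alpha> 1 j i)" for y i
      by auto
    from Suc obtain B where B: "\<And>\<alpha> y. \<alpha> \<in> {0..1} \<Longrightarrow> y \<in> {-1..1} \<Longrightarrow> \<bar>gap_poly \<alpha> 1 j y\<bar> \<le> B" by blast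
    have "bounded ((\<lambda>\<alpha>. gap_const \<alpha> 1 j) ` {0..1})"
      by (intro compact_imp_bounded compact_continuous_image e) auto
    then obtain E where "\<forall>t\<in>(\<lambda>\<alpha>. gap_const \<alpha> 1 j) ` {0..1}. \<bar>t\<bar> \<le> E" unfolding bounded_real by blast
    then have E: "\<bar>gap_const \<alpha> 1 j\<bar> \<le> E" if "\<alpha> \<in> {0..1}" for \<alpha> using that by blast
    have cont': "continuous_on {0..1} (\<lambda>\<alpha>. gap_poly \<alpha> 1 (Suc j) y)" for y
      by (simp, intro continuous_intros cont e)
    have B': "\<bar>gap_poly \<alpha> 1 (Suc j) y\<bar> \<le> B + E" if "\<alpha> \<in> {0..1}" "y \<in> {-1..1}" for \<alpha> y
    proof -
      have "\<bar>y\<bar> \<le> 1" using that by auto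
      then have "y\<^sup>2 \<le> 1" by (simp add: abs_square_le_1)
      then have "\<bar>y\<^sup>2\<bar> * \<bar>gap_poly \<alpha> 1 j y\<bar> \<le> 1 * B" using B[OF that] by (intro mult_mono) auto
      then show ?thesis using E[OF that(1)] abs_triangle_ineq[of "y\<^sup>2 * gap_poly \<alpha> 1 j y" "gap_const \<alpha> 1 j"]
        by (simp add: abs_mult)
    qed
    have "continuous_on {0..1} (\<lambda>\<alpha>. gap_const \<alpha> 1 (Suc j))"
      by (simp, intro continuous_intros e m) simp
    moreover have "continuous_on {0..1} (\<lambda>\<alpha>. gap_moment \<alpha> 1 (Suc j) i)" for i
      by (rule moment[OF cont' B'])
    ultimately show ?case using cont' B' by blast
  }
qed

lemma gap_moment_pos:
  assumes a: "0 \<le> a" "a < b"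
  shows "0 < gap_moment a b j i"
proof -
  let ?f = "\<lambda>y. gap_weight a b y * (gap_poly a b j y * y ^ (2 * i))"
  have nn: "0 \<le> ?f y" for y
    using gap_weight_nonneg[of a b y] gap_poly_const_pos[of a b j y] a by simp
  have cont: "continuous_on UNIV ?f" by (intro continuous_intros continuous_gap_weight continuous_gap_poly)
  have int: "integrable lborel ?f"
    by (rule gap_weight_integrable) (use a in \<open>auto intro!: continuous_intros continuous_gap_poly\<close>)
  obtain y0 where y0: "a < y0" "y0 < b" using dense[OF a(2)] by auto
  have f0: "0 < ?f y0"
    using gap_weight_pos_iff[of a b y0] gap_poly_const_pos[of a b j y0] a y0 by (intro mult_pos_pos zero_less_power) auto
  have "isCont ?f y0" using cont by (auto simp: continuous_on_eq_continuous_at)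
  then have "\<forall>\<^sub>F y in at y0. ?f y0 / 2 < ?f y" using f0 unfolding isCont_def by (intro order_tendstoD(1)) auto
  then obtain d where d: "0 < d" "\<And>y. y \<noteq> y0 \<Longrightarrow> dist y y0 < d \<Longrightarrow> ?f y0 / 2 < ?f y"
    by (auto simp: eventually_at)
  have le: "?f y0 / 2 * indicator {y0..y0 + d / 2} y \<le> ?f y" for y
  proof (cases "y \<in> {y0..y0 + d / 2}")
    case True
    then have "y = y0 \<or> (y \<noteq> y0 \<and> dist y y0 < d)" using d(1) by (auto simp: dist_real_def)
    then show ?thesis using d(2)[of y] f0 True by (auto simp: less_imp_le)
  qed (use nn[of y] in simp)
  have "(LBINT y. ?f y0 / 2 * indicator {y0..y0 + d / 2} y) \<le> (LBINT y. ?f y)"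
    by (rule integral_mono[OF _ int le], rule integrable_mult_right, rule integrable_real_indicator)
      (use d(1) in auto)
  moreover have "(LBINT y. ?f y0 / 2 * indicator {y0..y0 + d / 2} y) = ?f y0 / 2 * (d / 2)"
    using d(1) by (subst integral_mult_right_zero) simp
  moreover have "0 < ?f y0 / 2 * (d / 2)" using f0 d(1) by (intro mult_pos_pos) auto
  ultimately have "0 < (LBINT y. ?f y)" by linarith
  then show ?thesis by (simp add: gap_moment_def)
qed

text \<open>On the support y^2 is at least \<alpha>^2. This keeps the scale factor bounded while the
  moments tend to 0 as the two intervals shrink.\<close>

lemma gap_moment_ratio:
  assumes "0 \<le> \<alpha>" "\<alpha> \<le> 1"
  shows "\<alpha>\<^sup>2 * gap_moment \<alpha> 1 j 0 \<le> gap_moment \<alpha> 1 j 1"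
proof -
  have int: "integrable lborel (\<lambda>y. gap_weight \<alpha> 1 y * (gap_poly \<alpha> 1 j y * y ^ (2 * i)))" for i
    by (rule gap_weight_integrable) (use assms in \<open>auto intro!: continuous_intros continuous_gap_poly\<close>)
  have "(LBINT y. \<alpha>\<^sup>2 * (gap_weight \<alpha> 1 y * (gap_poly \<alpha> 1 j y * y ^ (2 * 0)))) \<le>
      (LBINT y. gap_weight \<alpha> 1 y * (gap_poly \<alpha> 1 j y * y ^ (2 * 1)))"
  proof (rule integral_mono[OF integrable_mult_right[OF int] int])
    fix y
    show "\<alpha>\<^sup>2 * (gap_weight \<alpha> 1 y * (gap_poly \<alpha> 1 j y * y ^ (2 * 0))) \<le> gap_weight \<alpha> 1 y * (gap_poly \<alpha> 1 j y * y ^ (2 * 1))"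
    proof (cases "gap_weight \<alpha> 1 y = 0")
      case False
      then have "\<alpha>\<^sup>2 \<le> y\<^sup>2"
        using gap_weight_support[OF assms False] power_mono[of \<alpha> "\<bar>y\<bar>" 2] assms by auto
      then have "(gap_weight \<alpha> 1 y * gap_poly \<alpha> 1 j y) * \<alpha>\<^sup>2 \<le> (gap_weight \<alpha> 1 y * gap_poly \<alpha> 1 j y) * y\<^sup>2"
        using gap_weight_nonneg[of \<alpha> 1 y] gap_poly_const_pos[of \<alpha> 1 j y] assms by (intro mult_left_mono) auto
      then show ?thesis by (simp add: mult_ac power2_eq_square)
    qed simp
  qed
  then show ?thesis by (simp add: gap_moment_def divide_right_mono)
qed

section \<open>Densities with a gap as saddle point solutions\<close>

definition gap_density :: "real \<Rightarrow> real \<Rightarrow> nat \<Rightarrow> real \<Rightarrow> real \<Rightarrow> real" where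
  "gap_density a b j \<theta> y = \<theta> / pi * (gap_weight a b y * gap_poly a b j y)"

text \<open>For a = 0 the origin is interior to the support although the weight vanishes there, so
  the field equation at this point is checked separately.\<close>

lemma principal_value_even_at_0:
  assumes F: "integrable lborel F" "\<And>y. F (- y) = F y"
  shows "has_principal_value (\<lambda>y. F y / (0 - y)) 0 0"
proof -
  have "(LINT y:{y. \<epsilon> < \<bar>0 - y\<bar>}|lborel. F y / (0 - y)) = 0" for \<epsilon>
    unfolding set_lebesgue_integral_def
    by (rule integral_odd_eq_0) (simp add: F(2) indicator_def)
  then show ?thesis
    unfolding has_principal_value_def using set_integrable_truncated[OF F(1), of _ 0] by simp
qed

lemma gap_density_solution:
  assumes n: "n = j + 2" and v: "0 < v" and ab: "0 \<le> a" "a < b"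
    and eq: "gap_moment a b j 1 = gap_moment a b j 0"
  defines "I \<equiv> gap_moment a b j 0"
  defines "\<rho> \<equiv> gap_density a b j (1 / I)"
  shows "saddle_point_solution n v (real n * v * I) \<rho> (- gap_const a b j / I) \<and> continuous_on UNIV \<rho> \<and>
    fun_support \<rho> = {-b..-a} \<union> {a..b} \<and> \<rho> 0 = 0"
proof -
  have I: "0 < I" unfolding I_def by (rule gap_moment_pos[OF ab])
  have ab': "a \<le> b" "0 < b" using ab by auto
  have cont: "continuous_on UNIV \<rho>"
    unfolding \<rho>_def gap_density_def[abs_def]
    by (intro continuous_intros continuous_gap_weight continuous_gap_poly)
  have pos: "0 < \<rho> y \<longleftrightarrow> a < \<bar>y\<bar> \<and> \<bar>y\<bar> < b" and nn: "0 \<le> \<rho> y" for y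
    using gap_poly_const_pos[OF ab(1) ab', of j y] I gap_weight_pos_iff[OF ab(1) ab'(1), of y] gap_weight_nonneg[of a b y]
    by (auto simp: \<rho>_def gap_density_def zero_less_mult_iff)
  have even: "\<rho> (- y) = \<rho> y" for y
    by (simp add: \<rho>_def gap_density_def gap_weight_minus gap_poly_minus)
  have supp: "fun_support \<rho> = {-b..-a} \<union> {a..b}"
  proof -
    have "{y. \<rho> y \<noteq> 0} = {y. 0 < \<rho> y}" using nn by (auto simp: less_le)
    also have "\<dots> = {-b<..<-a} \<union> {a<..<b}" using ab(1) unfolding pos by (auto simp: abs_if split: if_splits)
    finally show ?thesis using ab by (simp add: fun_support_def closure_Un)
  qed
  have hb: "has_bochner_integral lborel (\<lambda>y. \<rho> y * y ^ (2 * i)) (gap_moment a b j i / I)" for i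
  proof -
    have "integrable lborel (\<lambda>y. gap_weight a b y * (gap_poly a b j y * y ^ (2 * i)))"
      by (rule gap_weight_integrable) (use ab in \<open>auto intro!: continuous_intros continuous_gap_poly\<close>)
    then have "has_bochner_integral lborel (\<lambda>y. gap_weight a b y * (gap_poly a b j y * y ^ (2 * i))) (pi * gap_moment a b j i)"
      by (simp add: has_bochner_integral_iff gap_moment_def)
    from has_bochner_integral_mult_right[OF this, of "1 / I / pi"]
    show ?thesis by (simp add: \<rho>_def gap_density_def mult_ac)
  qed
  have pv: "has_principal_value (\<lambda>y. \<rho> y / (x - y)) x (- gap_const a b j / I * x + 1 / I * x ^ (2 * n - 1))"
    if x: "a < \<bar>x\<bar>" "\<bar>x\<bar> < b" for x
  proof -
    have "has_principal_value (\<lambda>y. 1 / I / pi * (gap_weight a b y * gap_poly a b j y / (x - y))) x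
        (1 / I / pi * (pi * x * (x ^ (2 * j + 2) - gap_const a b j)))"
      by (rule has_principal_value_cmult[OF principal_value_gap_poly[OF ab(1) x]])
    moreover have "1 / I / pi * (pi * x * (x ^ (2 * j + 2) - gap_const a b j)) =
        - gap_const a b j / I * x + 1 / I * x ^ (2 * n - 1)"
      using I by (simp add: n field_simps)
    ultimately show ?thesis by (simp add: \<rho>_def gap_density_def)
  qed
  have \<theta>: "real n * v / (real n * v * I) = 1 / I" using n v by simp
  have "saddle_point_solution n v (real n * v * I) \<rho> (- gap_const a b j / I)"
    unfolding saddle_point_solution_def
  proof (intro conjI allI ballI)
    show "0 \<le> \<rho> y" "\<rho> (- y) = \<rho> y" for y by (rule nn even)+
    show "compact (fun_support \<rho>)" unfolding supp by (intro compact_Un compact_Icc)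
    show "has_bochner_integral lborel \<rho> 1" using hb[of 0] I by (simp add: I_def)
    show "has_bochner_integral lborel (\<lambda>y. \<rho> y * y\<^sup>2) 1" using hb[of 1] I eq by (simp add: I_def)
    fix x assume x: "x \<in> interior (fun_support \<rho>)"
    then obtain e where e: "0 < e" "cball x e \<subseteq> {-b..-a} \<union> {a..b}"
      unfolding supp mem_interior_cball by blast
    then have "x - e \<in> {-b..-a} \<union> {a..b}" "x + e \<in> {-b..-a} \<union> {a..b}" "x \<in> {-b..-a} \<union> {a..b}"
      by (auto simp: subset_iff dist_real_def)
    \<comment> \<open>The points x - e and x + e alone do not exclude an inner endpoint, since the
      ball may reach across the gap; that case is removed next by a step towards the origin.\<close>
    then have cases: "(a < \<bar>x\<bar> \<and> \<bar>x\<bar> < b) \<or> (x = 0 \<and> a = 0) \<or> \<bar>x\<bar> = a \<and> 0 < a"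
      using e(1) ab by (auto simp: abs_if)
    moreover have "\<not> (\<bar>x\<bar> = a \<and> 0 < a)"
    proof
      assume xa: "\<bar>x\<bar> = a \<and> 0 < a"
      define d where "d = min e a"
      have "x - sgn x * d \<in> cball x e" using e(1) xa by (auto simp: d_def dist_real_def abs_mult sgn_if)
      then have "x - sgn x * d \<in> {-b..-a} \<union> {a..b}" using e(2) by blast
      then show False using xa e(1) by (auto simp: d_def sgn_if abs_if min_def split: if_splits)
    qed
    ultimately have "has_principal_value (\<lambda>y. \<rho> y / (x - y)) x (- gap_const a b j / I * x + 1 / I * x ^ (2 * n - 1))"
    proof (elim disjE)
      assume "x = 0 \<and> a = 0"
      moreover have "integrable lborel \<rho>" using hb[of 0] by (simp add: has_bochner_integral_iff)
      ultimately show ?thesis using principal_value_even_at_0[of \<rho>] even n by simp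
    qed (use pv in auto)
    then show "has_principal_value (\<lambda>y. \<rho> y / (x - y)) x
        (- gap_const a b j / I * x + 1 / (real n * v * I) / 2 * deriv (potential n v) x)"
      using potential_force_eq[of n "- gap_const a b j / I" x "real n * v * I" v] n unfolding \<theta> by simp
  qed
  moreover have "\<rho> 0 = 0" by (simp add: \<rho>_def gap_density_def gap_weight_def)
  ultimately show ?thesis using cont supp by blast
qed

section \<open>The phase transition\<close>

lemma Gamma_half_arcsine_moment: "Gamma (real k + 1 / 2) = sqrt pi * fact k * arcsine_moment k"
proof (induction k)
  case (Suc k)
  have "Gamma (real (Suc k) + 1 / 2) = Gamma ((real k + 1 / 2) + 1)" by (simp add: algebra_simps)
  also have "\<dots> = (real k + 1 / 2) * Gamma (real k + 1 / 2)"
    by (rule Gamma_plus1) (auto simp: nonpos_Ints_def)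
  also have "\<dots> = sqrt pi * fact k * ((real k + 1 / 2) * arcsine_moment k)" by (simp add: Suc)
  also have "\<dots> = sqrt pi * fact (Suc k) * arcsine_moment (Suc k)"
    unfolding arcsine_moment_Suc[symmetric] by (simp add: mult_ac)
  finally show ?case .
qed (simp add: Gamma_one_half_real)

text \<open>The first form trades the Gamma quotient for an arcsine moment. The second says that the
  critical temperature solves the one-cut relation at a^2 = s, where the density vanishes at the
  origin.\<close>

lemma critical_temperature_eq:
  assumes n: "2 \<le> n" and s: "s = 4 * (real n + 1) / (3 * real n)"
  shows "critical_temperature n v = v / 2 * (real n - 1) * arcsine_moment (n - 1) * s ^ n"
    and "real n * v * arcsine_moment n * s ^ (n + 1) * (real n - 1) = critical_temperature n v * ((real n + 1) * (4 - s))"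
proof -
  obtain j where j: "n = j + 2" using n by (metis add.commute le_iff_add)
  have "real n - 1 / 2 = real (j + 1) + 1 / 2" "real n - 1 = 1 + real j" by (auto simp: j)
  then have "Gamma (real n - 1 / 2) / Gamma (real n - 1) = sqrt pi * fact (j + 1) * arcsine_moment (j + 1) / fact j"
    using Gamma_half_arcsine_moment[of "j + 1"] Gamma_fact[of j, where 'a=real] by simp
  also have "\<dots> = sqrt pi * ((real n - 1) * arcsine_moment (n - 1))" by (simp add: j del: arcsine_moment.simps)
  finally have G: "Gamma (real n - 1 / 2) / Gamma (real n - 1) = sqrt pi * ((real n - 1) * arcsine_moment (n - 1))" .
  have "4 / 3 * (1 + 1 / real n) = s" using n by (simp add: s field_simps)
  then show Tc: "critical_temperature n v = v / 2 * (real n - 1) * arcsine_moment (n - 1) * s ^ n"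
    unfolding critical_temperature_def G by (simp add: field_simps)
  have s2: "(real n + 1) * (4 - s) = s * (2 * real n - 1)"
    using n by (simp add: s field_simps)
  have "2 * real n * arcsine_moment n = (2 * real n - 1) * arcsine_moment (n - 1)"
    using arcsine_moment_Suc[of "j + 1"] by (simp add: j algebra_simps del: arcsine_moment.simps)
  then have c: "v * s ^ (n + 1) * (real n - 1) * (2 * real n * arcsine_moment n) =
      v * s ^ (n + 1) * (real n - 1) * ((2 * real n - 1) * arcsine_moment (n - 1))" by (simp only:)
  then show "real n * v * arcsine_moment n * s ^ (n + 1) * (real n - 1) = critical_temperature n v * ((real n + 1) * (4 - s))"
    unfolding Tc s2 by (simp add: field_simps)
qed

lemma single_cut_temperature:
  assumes n: "2 \<le> n" and v: "0 < v" and T: "0 < T" and sol: "single_cut n v T \<rho> \<mu>"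
  defines "s \<equiv> 4 * (real n + 1) / (3 * real n)"
  obtains a where "0 < a" "fun_support \<rho> = {-a..a}" "s \<le> a\<^sup>2" "\<rho> 0 = 0 \<longleftrightarrow> a\<^sup>2 = s"
    "critical_temperature n v \<le> T" "T = critical_temperature n v \<longleftrightarrow> a\<^sup>2 = s"
proof -
  from single_cut_equations[OF n v T sol] obtain a where a: "0 < a" "fun_support \<rho> = {-a..a}"
    and eq: "real n * v / T * arcsine_moment n * a ^ (2 * n + 2) * (real n - 1) = (real n + 1) * (4 - a\<^sup>2)"
    and le: "4 * (real n + 1) \<le> 3 * real n * a\<^sup>2" and zero: "\<rho> 0 = 0 \<longleftrightarrow> 4 * (real n + 1) = 3 * real n * a\<^sup>2" .
  define K t where "K = real n * v * arcsine_moment n * (real n - 1)" and "t = a\<^sup>2"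
  have K: "0 < K" using n v arcsine_moment_pos[of n] by (simp add: K_def)
  have s: "0 < s" using n by (simp add: s_def)
  have "a ^ (2 * n + 2) = t ^ (n + 1)" unfolding t_def power_mult[symmetric] by simp
  then have eqT: "K * t ^ (n + 1) = T * ((real n + 1) * (4 - t))"
    using eq T by (simp add: K_def t_def field_simps)
  have eqs: "K * s ^ (n + 1) = critical_temperature n v * ((real n + 1) * (4 - s))"
    using critical_temperature_eq(2)[OF n s_def[THEN meta_eq_to_obj_eq], of v] by (simp add: K_def mult_ac)
  have st: "s \<le> t" using le n by (simp add: s_def t_def field_simps)
  have iff: "4 * (real n + 1) = 3 * real n * a\<^sup>2 \<longleftrightarrow> a\<^sup>2 = s" using n by (auto simp: s_def field_simps)
  \<comment> \<open>The left side of the one-cut relation is positive, so a^2 < 4 and the factor 4 -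
    t can be cancelled.\<close>
  have t4: "t < 4"
  proof -
    have "0 < K * t ^ (n + 1)" using K st s by simp
    then show ?thesis unfolding eqT using T by (simp add: zero_less_mult_iff)
  qed
  have Tc: "0 < critical_temperature n v"
    unfolding critical_temperature_eq(1)[OF n s_def[THEN meta_eq_to_obj_eq]]
    using n v s arcsine_moment_pos[of "n - 1"] by (intro mult_pos_pos zero_less_power) auto
  have main: "critical_temperature n v * ((real n + 1) * (4 - t)) \<le> critical_temperature n v * ((real n + 1) * (4 - s))"
    using Tc st by (intro mult_left_mono) auto
  have pow: "K * s ^ (n + 1) \<le> K * t ^ (n + 1)" using K s st by (intro mult_left_mono power_mono) auto
  have le: "critical_temperature n v * ((real n + 1) * (4 - t)) \<le> T * ((real n + 1) * (4 - t))"
    using main pow unfolding eqT eqs by linarith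
  have pos: "0 < (real n + 1) * (4 - t)" using t4 by simp
  have TTc: "critical_temperature n v \<le> T" using mult_right_le_imp_le[OF le pos] .
  have "T = critical_temperature n v \<longleftrightarrow> t = s"
  proof
    assume "t = s"
    then show "T = critical_temperature n v" using eqT eqs pos t4 by simp
  next
    assume Teq: "T = critical_temperature n v"
    show "t = s"
    proof (rule ccontr)
      assume "t \<noteq> s"
      then have "s ^ (n + 1) < t ^ (n + 1)" using st s by (intro power_strict_mono) auto
      then have "K * s ^ (n + 1) < K * t ^ (n + 1)" using K by simp
      then show False using main unfolding eqT eqs Teq by linarith
    qed
  qed
  then show ?thesis using that[OF a] st zero iff TTc by (auto simp: t_def)
qed

lemma single_cut_exists_above:
  assumes n: "2 \<le> n" and v: "0 < v" and T: "0 < T" and le: "critical_temperature n v \<le> T"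
  shows "\<exists>\<rho> \<mu>. single_cut n v T \<rho> \<mu>"
proof -
  define s where "s = 4 * (real n + 1) / (3 * real n)"
  define K where "K = real n * v * arcsine_moment n * (real n - 1)"
  have K: "0 < K" using n v arcsine_moment_pos[of n] by (simp add: K_def)
  have s: "0 < s" "s \<le> 4" using n by (auto simp: s_def field_simps)
  \<comment> \<open>A zero of \<open>D\<close> is a squared endpoint at temperature T. At s the sign
    is that of the critical temperature minus T; 4 is the squared radius of the semicircle law with
    unit variance, the limit of infinite temperature.\<close>
  define D where "D t = K * t ^ (n + 1) - T * ((real n + 1) * (4 - t))" for t
  have "K * s ^ (n + 1) = critical_temperature n v * ((real n + 1) * (4 - s))"
    using critical_temperature_eq(2)[OF n s_def, of v] by (simp add: K_def mult_ac)
  also have "\<dots> \<le> T * ((real n + 1) * (4 - s))" using le s by (intro mult_right_mono) auto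
  finally have "D s \<le> 0" by (simp add: D_def)
  moreover have "0 \<le> D 4" using K by (simp add: D_def)
  moreover have "continuous_on {s..4} D" unfolding D_def[abs_def] by (intro continuous_intros)
  ultimately obtain t where t: "s \<le> t" "t \<le> 4" "D t = 0" using IVT'[of D s 0 4] s by auto
  define a where "a = sqrt t"
  have a: "0 < a" "a\<^sup>2 = t" using t s by (auto simp: a_def)
  have "a ^ (2 * n + 2) = t ^ (n + 1)" unfolding a(2)[symmetric] power_mult[symmetric] by simp
  then have "real n * v / T * arcsine_moment n * a ^ (2 * n + 2) * (real n - 1) = (real n + 1) * (4 - a\<^sup>2)"
    using t(3) T unfolding a(2) by (simp add: D_def K_def field_simps)
  moreover have "4 * (real n + 1) \<le> 3 * real n * a\<^sup>2"
    using t(1) n unfolding a(2) by (simp add: s_def field_simps)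
  ultimately show ?thesis by (rule single_cut_exists[OF n v T a(1)])
qed

lemma two_cut_exists_below:
  assumes n: "2 \<le> n" and v: "0 < v" and T: "0 < T" and less: "T < critical_temperature n v"
  shows "\<exists>\<rho> \<mu>. two_cut n v T \<rho> \<mu>"
proof -
  obtain j where j: "n = j + 2" using n by (metis add.commute le_iff_add)
  define I where "I i \<alpha> = gap_moment \<alpha> 1 j i" for i \<alpha>
  \<comment> \<open>\<open>c\<close> rescales the endpoints \<alpha> and 1 so that the two moments
    agree, and \<open>\<tau>\<close> is the temperature of the rescaled density; its n-th power is
    c^(2 j + 4) = (c^2)^n.\<close>
  define c where "c \<alpha> = sqrt (I 0 \<alpha> / I 1 \<alpha>)" for \<alpha>
  define \<tau> where "\<tau> \<alpha> = real n * v * ((I 0 \<alpha> / I 1 \<alpha>) ^ n * I 0 \<alpha>)" for \<alpha>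
  have I_pos: "0 < I i \<alpha>" if "0 \<le> \<alpha>" "\<alpha> < 1" for i \<alpha>
    unfolding I_def by (rule gap_moment_pos[OF that])
  have I_cont: "continuous_on {0..1} (I i)" for i
    unfolding I_def[abs_def] using gap_continuous[of j] by blast
  have sol: "\<exists>\<rho> \<mu>. saddle_point_solution n v (\<tau> \<alpha>) \<rho> \<mu> \<and> continuous_on UNIV \<rho> \<and>
      fun_support \<rho> = {-(c \<alpha>)..-(c \<alpha> * \<alpha>)} \<union> {c \<alpha> * \<alpha>..c \<alpha>} \<and> \<rho> 0 = 0" and c_pos: "0 < c \<alpha>"
    if \<alpha>: "0 \<le> \<alpha>" "\<alpha> < 1" for \<alpha>
  proof -
    show c: "0 < c \<alpha>" using I_pos[OF \<alpha>] by (simp add: c_def)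
    have sq: "(c \<alpha>)\<^sup>2 = I 0 \<alpha> / I 1 \<alpha>" using I_pos[OF \<alpha>] by (simp add: c_def less_imp_le)
    have m: "gap_moment (c \<alpha> * \<alpha>) (c \<alpha> * 1) j i = c \<alpha> ^ (2 * j + 2 * i + 4) * I i \<alpha>" for i
      unfolding I_def using gap_scale[OF c] by blast
    have "c \<alpha> ^ (2 * j + 2 * 1 + 4) * I 1 \<alpha> = c \<alpha> ^ (2 * j + 2 * 0 + 4) * ((c \<alpha>)\<^sup>2 * I 1 \<alpha>)"
      by (simp only: mult.assoc[symmetric] power_add[symmetric]) simp
    also have "(c \<alpha>)\<^sup>2 * I 1 \<alpha> = I 0 \<alpha>" unfolding sq using I_pos[OF \<alpha>, of 1] by simp
    finally have eq: "gap_moment (c \<alpha> * \<alpha>) (c \<alpha> * 1) j 1 = gap_moment (c \<alpha> * \<alpha>) (c \<alpha> * 1) j 0"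
      unfolding m .
    have "c \<alpha> ^ (2 * j + 2 * 0 + 4) = (I 0 \<alpha> / I 1 \<alpha>) ^ n"
      unfolding sq[symmetric] power_mult[symmetric] by (rule arg_cong) (simp add: j)
    then have \<tau>: "\<tau> \<alpha> = real n * v * gap_moment (c \<alpha> * \<alpha>) (c \<alpha> * 1) j 0"
      unfolding m \<tau>_def by simp
    have "0 \<le> c \<alpha> * \<alpha>" "c \<alpha> * \<alpha> < c \<alpha> * 1" using c \<alpha> by auto
    from gap_density_solution[OF j v this eq]
    show "\<exists>\<rho> \<mu>. saddle_point_solution n v (\<tau> \<alpha>) \<rho> \<mu> \<and> continuous_on UNIV \<rho> \<and>
      fun_support \<rho> = {-(c \<alpha>)..-(c \<alpha> * \<alpha>)} \<union> {c \<alpha> * \<alpha>..c \<alpha>} \<and> \<rho> 0 = 0"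
      unfolding \<tau> mult_1_right by blast
  qed
  have \<tau>_pos: "0 < \<tau> \<alpha>" if "0 \<le> \<alpha>" "\<alpha> < 1" for \<alpha>
    using I_pos[OF that] n v by (simp add: \<tau>_def)
  \<comment> \<open>Read off from the single-cut analysis instead of evaluating the
    integrals.\<close>
  have \<tau>0: "\<tau> 0 = critical_temperature n v"
  proof -
    from sol[of 0] obtain \<rho> \<mu> where \<rho>: "saddle_point_solution n v (\<tau> 0) \<rho> \<mu>" "continuous_on UNIV \<rho>"
      "fun_support \<rho> = {-(c 0)..-(c 0 * 0)} \<union> {c 0 * 0..c 0}" "\<rho> 0 = 0" by auto
    have "fun_support \<rho> = {-(c 0)..c 0}" unfolding \<rho>(3) using c_pos[of 0] by auto
    then have "single_cut n v (\<tau> 0) \<rho> \<mu>" using \<rho> c_pos[of 0] unfolding single_cut_def by auto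
    from single_cut_temperature[OF n v _ this] \<tau>_pos[of 0] \<rho>(4) show ?thesis by fastforce
  qed
  \<comment> \<open>As \<alpha> tends to 1 the quotient of the moments is of the form 0 / 0, but for
    \<alpha> at least 1/2 it is at most 1 / \<alpha>^2, hence at most 4, and \<tau> tends to 0
    together with \<open>I 0\<close>.\<close>
  obtain \<beta> where \<beta>: "0 < \<beta>" "\<beta> < 1" "\<tau> \<beta> \<le> T"
  proof -
    have "I 0 1 = 0"
    proof -
      have "gap_weight 1 1 y = 0" for y using gap_weight_pos_iff[of 1 1 y] gap_weight_nonneg[of 1 1 y] by auto
      then show ?thesis by (simp add: I_def gap_moment_def)
    qed
    moreover have "((\<lambda>\<alpha>. real n * v * (4 ^ n * I 0 \<alpha>)) \<longlongrightarrow> real n * v * (4 ^ n * I 0 1)) (at 1 within {0..1})"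
      using I_cont[of 0] unfolding continuous_on_def by (intro tendsto_intros) auto
    ultimately have "\<forall>\<^sub>F \<alpha> in at 1 within {0..1}. real n * v * (4 ^ n * I 0 \<alpha>) < T"
      using T by (intro order_tendstoD(2)) auto
    then obtain d where d: "0 < d" "\<And>\<alpha>. \<alpha> \<in> {0..1} \<Longrightarrow> \<alpha> \<noteq> 1 \<Longrightarrow> dist \<alpha> 1 < d \<Longrightarrow> real n * v * (4 ^ n * I 0 \<alpha>) < T"
      by (auto simp: eventually_at)
    define \<beta> where "\<beta> = max (1 / 2) (1 - d / 2)"
    have \<beta>: "1 / 2 \<le> \<beta>" "\<beta> < 1" "dist \<beta> 1 < d" using d(1) by (auto simp: \<beta>_def dist_real_def max_def)
    have "I 0 \<beta> / I 1 \<beta> \<le> 4"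
    proof -
      have "(1 / 2)\<^sup>2 \<le> \<beta>\<^sup>2" using \<beta> by (intro power_mono) auto
      then have "1 / 4 * I 0 \<beta> \<le> \<beta>\<^sup>2 * I 0 \<beta>"
        using I_pos[of \<beta> 0] \<beta> by (intro mult_right_mono) (auto simp: power2_eq_square)
      also have "\<dots> \<le> I 1 \<beta>" unfolding I_def using \<beta> by (intro gap_moment_ratio) auto
      finally show ?thesis using I_pos[of \<beta> 1] \<beta> by (simp add: field_simps)
    qed
    then have "(I 0 \<beta> / I 1 \<beta>) ^ n * I 0 \<beta> \<le> 4 ^ n * I 0 \<beta>"
      using I_pos[of \<beta>] \<beta> by (intro mult_right_mono power_mono) (auto intro: less_imp_le)
    then have "\<tau> \<beta> \<le> real n * v * (4 ^ n * I 0 \<beta>)"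
      unfolding \<tau>_def using v by (intro mult_left_mono) auto
    also have "\<dots> < T" using \<beta> by (intro d(2)) auto
    finally show ?thesis using that[of \<beta>] \<beta> by auto
  qed
  \<comment> \<open>The interval stops at \<beta> < 1 because \<open>I 1\<close> is the denominator
    in \<open>\<tau>\<close> and vanishes at ratio 1.\<close>
  have "continuous_on {0..\<beta>} \<tau>"
    unfolding \<tau>_def[abs_def] using I_pos[of _ 1] \<beta>
    by (intro continuous_intros continuous_on_subset[OF I_cont]) (auto simp: less_imp_neq[symmetric])
  then obtain \<alpha> where \<alpha>: "0 \<le> \<alpha>" "\<alpha> \<le> \<beta>" "\<tau> \<alpha> = T"
    using IVT2'[of \<tau> \<beta> T 0] \<beta> less \<tau>0 by auto
  \<comment> \<open>Ratio 0 would close the gap; it is excluded because \<open>\<tau> 0\<close>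
    exceeds T.\<close>
  then have \<alpha>01: "0 < \<alpha>" "\<alpha> < 1" using less \<tau>0 \<beta> by (auto simp: less_le)
  from sol[OF \<alpha>(1) \<alpha>01(2)] obtain \<rho> \<mu> where \<rho>: "saddle_point_solution n v T \<rho> \<mu>" "continuous_on UNIV \<rho>"
      "fun_support \<rho> = {-(c \<alpha>)..-(c \<alpha> * \<alpha>)} \<union> {c \<alpha> * \<alpha>..c \<alpha>}" unfolding \<alpha>(3) by auto
  moreover have "0 < c \<alpha> * \<alpha>" "c \<alpha> * \<alpha> < c \<alpha>" using c_pos[OF \<alpha>(1) \<alpha>01(2)] \<alpha>01 by auto
  ultimately show ?thesis unfolding two_cut_def by blast
qed

theorem mainTheorem1:
  fixes n :: nat and v :: real
  assumes "n \<ge> 2" and "v > 0"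
  shows "(\<forall>T>0. (\<exists>\<rho> \<mu>. single_cut n v T \<rho> \<mu>) \<longleftrightarrow> T \<ge> critical_temperature n v) \<and>
    (\<forall>\<rho> \<mu>. single_cut n v (critical_temperature n v) \<rho> \<mu> \<longrightarrow>
       \<rho> 0 = 0 \<and>
       (\<exists>a>0. fun_support \<rho> = {-a..a} \<and> a\<^sup>2 = 4 / 3 * ((real n + 1) / real n))) \<and>
    (\<forall>T. 0 < T \<and> T < critical_temperature n v \<longrightarrow>
       (\<exists>\<rho> \<mu>. two_cut n v T \<rho> \<mu>) \<and>
       (\<forall>\<rho> \<mu>. saddle_point_solution n v T \<rho> \<mu> \<and> continuous_on UNIV \<rho> \<longrightarrow>
          two_cut n v T \<rho> \<mu>))"
proof (intro conjI allI impI)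
  note n = assms(1) and v = assms(2)
  have Tc: "0 < critical_temperature n v"
  proof -
    have "0 < 4 * (real n + 1) / (3 * real n)" using n by simp
    then show ?thesis
      unfolding critical_temperature_eq(1)[OF n refl] using n v arcsine_moment_pos[of "n - 1"]
      by (intro mult_pos_pos zero_less_power) auto
  qed
  show iff: "(\<exists>\<rho> \<mu>. single_cut n v T \<rho> \<mu>) \<longleftrightarrow> T \<ge> critical_temperature n v" if "0 < T" for T
    using single_cut_exists_above[OF n v that] single_cut_temperature[OF n v that] by metis
  show "\<rho> 0 = 0" "\<exists>a>0. fun_support \<rho> = {-a..a} \<and> a\<^sup>2 = 4 / 3 * ((real n + 1) / real n)"
    if "single_cut n v (critical_temperature n v) \<rho> \<mu>" for \<rho> \<mu>
    using single_cut_temperature[OF n v Tc that] by (force simp: field_simps)+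
  show "\<exists>\<rho> \<mu>. two_cut n v T \<rho> \<mu>" if "0 < T \<and> T < critical_temperature n v" for T
    using two_cut_exists_below[OF n v] that by blast
  \<comment> \<open>The dichotomy of supports holds at every temperature; below the critical one the
    single-cut alternative contradicts \<open>iff\<close>.\<close>
  show "two_cut n v T \<rho> \<mu>"
    if T: "0 < T \<and> T < critical_temperature n v" and sol: "saddle_point_solution n v T \<rho> \<mu> \<and> continuous_on UNIV \<rho>" for T \<rho> \<mu>
    using continuous_saddle_point_cases[OF n v _ conjunct1[OF sol] conjunct2[OF sol]] iff[of T] T by fastforce
qed

end
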